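(* Let $k$ be a field of characteristic $0$, $n\ge1$, $G=\mathrm{GL}_{n/k}$ and $w\in\mathcal S_n$. For $1\le d\le n-1$ and $1\le i_1<\dots<i_d\le n$, let $P_{w,i_1\ldots i_d}(\lambda)$ be the polynomial in $\lambda$ with coefficients in the polynomial ring $\mathbb Z[x_{j_1\ldots j_d},u_{kl},t_m]$ (over all $1\le j_1<\dots<j_d\le n$, $1\le k<l\le n$, $1\le m\le n$) given by $$P_{w,i_1\ldots i_d}(\lambda)=\sum_{j_1<\dots<j_d}\Delta^{j_1\ldots j_d}_{i_1\ldots i_d}(u+\lambda\,\mathrm{id})\,x_{j_1\ldots j_d}-\Big(\prod_{k=1}^d(t_{w(k)}+\lambda)\Big)x_{i_1\ldots i_d},$$ and write $P_{w,i_1\ldots i_d}(\lambda)=\sum_{s=0}^{d-1}P_{w,i_1\ldots i_d,s}\lambda^s$. Then, in the Plücker coordinates $(x_{i_1\ldots i_d})$ on $G/B$ and the affine coordinates $(u_{kl},t_m)$ on $\mathfrak b$, the variety $\widetilde V_w$ is defined inside $\prod_{d=1}^{n-1}\mathbb P(\bigwedge^dk^n)\times\mathfrak b$ by: – the Plücker relations in dimension $d$ for each $1\le d\le n-1$: $\sum_{m=1}^{d+1}(-1)^mx_{i_1\ldots i_{d-1}j_m}x_{j_1\ldots\widehat{j_m}\ldots j_{d+1}}=0$ for all increasing sequences $(i_1,\dots,i_{d-1})$, $(j_1,\dots,j_{d+1})$; – the incidence relations in dimensions $(d,d+1)$ for each $1\le d\le n-2$: $\sum_{m=1}^{d+2}(-1)^mx_{i_1\ldots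 i_{d-1}j_m}x_{j_1\ldots\widehat{j_m}\ldots j_{d+2}}=0$ for all increasing sequences $(i_1,\dots,i_{d-1})$, $(j_1,\dots,j_{d+2})$; – for each $1\le d\le n-1$: $x_{w(1)\ldots w(d)}\ne0$, and $x_{i_1\ldots i_d}=0$ whenever $\{i_1,\dots,i_d\}\not\preceq\{w(1),\dots,w(d)\}$; – the equations $P_{w,i_1\ldots i_d,s}=0$ for all $1\le d\le n-1$, $1\le i_1<\dots<i_d\le n$ and $0\le s\le d-1$.
   Context: $B$ is the subgroup of upper triangular matrices, $\mathfrak b$ its Lie algebra; $\mathcal S_n$ is the Weyl group (permutation matrices, $we_i=e_{w(i)}$). $\widetilde X=\{(gB,\psi)\in G/B\times\mathfrak b:\mathrm{Ad}(g^{-1})\psi\in\mathfrak b\}$ (reduced), $\widetilde V_w=\{(gB,\psi)\in\widetilde X:gB\in BwB/B\}$. Coordinates: $gB$ is identified with the flag $(V_1,\dots,V_{n-1})$, $V_d$ the span of the first $d$ columns of $g$, embedded in $\prod_{d}\mathbb P(\bigwedge^dk^n)$ by sending $V_d=\langle v_1,\dots,v_d\rangle$ to the line of $v_1\wedge\dots\wedge v_d=\sum x_{i_1\ldots i_d}e_{i_1}\wedge\dots\wedge e_{i_d}$. The symbols $x_{i_1\ldots i_d}$ are extended to all index sequences by antisymmetry (zero if two indices coincide); a hat means omission. $\psi$ is the upper triangular matrix $u$ with entries $u_{kl}$ ($k<l$) and diagonal entries $t_m$. $\Delta^{j_1\ldots j_d}_{i_1\ldots i_d}(M)$ is the minor of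 $M$ with rows $i_1,\dots,i_d$ and columns $j_1,\dots,j_d$. For size-$d$ subsets $A=\{a_1<\dots<a_d\}$ and $A'=\{a'_1<\dots<a'_d\}$, $A\preceq A'$ iff $a_k\le a'_k$ for all $k$. *)

theory Defs
  imports
    "HOL-Library.Poly_Mapping"
    "HOL-Combinatorics.Permutations"
    "HOL-Algebra.Coset"
    "HOL-Algebra.Ideal"
    "HOL-Algebra.Algebraic_Closure_Type"
    "Jordan_Normal_Form.Determinant"
    "Jordan_Normal_Form.DL_Submatrix"
    "Jordan_Normal_Form.Ring_Hom_Matrix"
begin

text \<open>
  Rows, columns and the letters permuted by \<open>w\<close> are numbered \<open>0, \<dots>, n - 1\<close>
  (as in the matrix library) instead of \<open>1, \<dots>, n\<close>; thus \<open>w(1), \<dots>, w(d)\<close> becomes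
  \<open>w 0, \<dots>, w (d - 1)\<close>. Dimensions \<open>d\<close> are not shifted and range over \<open>1, \<dots>, n - 1\<close>.
\<close>

section \<open>The varieties\<close>

text \<open>
  The sets below are the sets of points over a field \<open>'a\<close>; a point of \<open>G/B\<close> is a
  left coset (over a field, every rational point of the flag variety is one). The reduced
  scheme structure enters through \<open>chart_ideal\<close> at the end.
\<close>

definition GL :: "nat \<Rightarrow> 'a::field mat monoid" where
  "GL n = units_of (ring_mat TYPE('a) n ())"

definition Borel :: "nat \<Rightarrow> 'a::field mat set" where
  "Borel n = {g \<in> carrier (GL n). upper_triangular g}"

definition borel_alg :: "nat \<Rightarrow> 'a::field mat set" where
  "borel_alg n = {M \<in> carrier_mat n n. upper_triangular M}"

definition perm_mat :: "nat \<Rightarrow> (nat \<Rightarrow> nat) \<Rightarrow> 'a::field mat" where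
  "perm_mat n w = mat n n (\<lambda>(i, j). if i = w j then 1 else 0)"

definition Ad :: "nat \<Rightarrow> 'a::field mat \<Rightarrow> 'a mat \<Rightarrow> 'a mat" where
  "Ad n g M = g * M * (inv\<^bsub>GL n\<^esub> g)"

definition X_tilde :: "nat \<Rightarrow> ('a::field mat set \<times> 'a mat) set" where
  "X_tilde n = {(g <#\<^bsub>GL n\<^esub> Borel n, \<psi>) | g \<psi>.
     g \<in> carrier (GL n) \<and> \<psi> \<in> borel_alg n \<and> Ad n (inv\<^bsub>GL n\<^esub> g) \<psi> \<in> borel_alg n}"

definition schubert_cell :: "nat \<Rightarrow> (nat \<Rightarrow> nat) \<Rightarrow> 'a::field mat set set" where
  "schubert_cell n w =
     {(b * perm_mat n w * b') <#\<^bsub>GL n\<^esub> Borel n | b b'. b \<in> Borel n \<and> b' \<in> Borel n}"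

definition V_tilde :: "nat \<Rightarrow> (nat \<Rightarrow> nat) \<Rightarrow> ('a::field mat set \<times> 'a mat) set" where
  "V_tilde n w = {(C, \<psi>) \<in> X_tilde n. C \<in> schubert_cell n w}"

section \<open>Pluecker coordinates\<close>

definition subsets_of_size :: "nat \<Rightarrow> nat \<Rightarrow> nat set set" where
  "subsets_of_size n d = {I. I \<subseteq> {..<n} \<and> card I = d}"

definition minor :: "'a::comm_ring_1 mat \<Rightarrow> nat set \<Rightarrow> nat set \<Rightarrow> 'a" where
  "minor M I J = det (submatrix M I J)"

text \<open>
  The coordinate of \<open>v\<^sub>1 \<and> \<dots> \<and> v\<^sub>d\<close> at \<open>e\<^bsub>I\<^esub>\<close>, where \<open>d = card I\<close> and \<open>v\<^sub>1, \<dots>, v\<^sub>d\<close> are the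
  first \<open>d\<close> columns of \<open>g\<close>.
\<close>
definition plucker_coord :: "'a::field mat \<Rightarrow> nat set \<Rightarrow> 'a" where
  "plucker_coord g I = minor g I {..<card I}"

text \<open>
  A vector of the \<open>d\<close>-th exterior power of \<open>k^n\<close> is the function giving its coordinates in the
  basis \<open>e\<^bsub>I\<^esub>\<close>, zero outside the \<open>d\<close>-subsets. A point of the projective space
  is a line, as a set of vectors. A single function \<open>x\<close> on index sets collects
  homogeneous coordinates for all \<open>d\<close> at once.
\<close>
definition ext_line :: "nat \<Rightarrow> nat \<Rightarrow> (nat set \<Rightarrow> 'a::field) \<Rightarrow> (nat set \<Rightarrow> 'a) set" where
  "ext_line n d x = {(\<lambda>I. if I \<in> subsets_of_size n d then c * x I else 0) | c. True}"

definition multiproj :: "nat \<Rightarrow> (nat set \<Rightarrow> 'a::field) \<Rightarrow> nat \<Rightarrow> (nat set \<Rightarrow> 'a) set" where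
  "multiproj n x = (\<lambda>d\<in>{1..<n}. ext_line n d x)"

text \<open>Image of a subset of \<open>G/B \<times> \<bb>\<close> under the Pluecker embedding.\<close>
definition plucker_image ::
  "nat \<Rightarrow> ('a::field mat set \<times> 'a mat) set \<Rightarrow> ((nat \<Rightarrow> (nat set \<Rightarrow> 'a) set) \<times> 'a mat) set" where
  "plucker_image n S =
     {(multiproj n (plucker_coord g), \<psi>) | g \<psi>.
        g \<in> carrier (GL n) \<and> (g <#\<^bsub>GL n\<^esub> Borel n, \<psi>) \<in> S}"

definition inversions :: "nat list \<Rightarrow> (nat \<times> nat) set" where
  "inversions js = {(a, b). a < b \<and> b < length js \<and> js ! a > js ! b}"

text \<open>Extension of \<open>x\<close> from increasing index sequences to all sequences by antisymmetry.\<close>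
definition antisym_ext :: "(nat set \<Rightarrow> 'a::ring_1) \<Rightarrow> nat list \<Rightarrow> 'a" where
  "antisym_ext x js =
     (if distinct js then (- 1) ^ card (inversions js) * x (set js) else 0)"

section \<open>Polynomials in the coordinates\<close>

text \<open>
  \<open>XC I\<close>, \<open>UC k l\<close>, \<open>TC m\<close> stand for the variables \<open>x\<^bsub>I\<^esub>\<close>, \<open>u\<^bsub>kl\<^esub>\<close>, \<open>t\<^bsub>m\<^esub>\<close>. The type has infinitely
  many variables; \<open>coords n\<close> selects those of the statement.
\<close>
datatype coord = XC "nat set" | UC nat nat | TC nat

type_synonym 'a mpol = "(coord \<Rightarrow>\<^sub>0 nat) \<Rightarrow>\<^sub>0 'a"

definition coords :: "nat \<Rightarrow> coord set" where
  "coords n = XC ` (\<Union>d\<in>{1..<n}. subsets_of_size n d)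
     \<union> {UC k l | k l. k < l \<and> l < n} \<union> TC ` {..<n}"

definition mvar :: "coord \<Rightarrow> 'a::comm_ring_1 mpol" where
  "mvar v = Poly_Mapping.single (Poly_Mapping.single v 1) 1"

definition mpol_ring :: "nat \<Rightarrow> 'a::comm_ring_1 mpol ring" where
  "mpol_ring n =
     \<lparr>carrier = {f. \<forall>m \<in> Poly_Mapping.keys f. Poly_Mapping.keys m \<subseteq> coords n},
      monoid.mult = (*), one = 1, zero = 0, add = (+)\<rparr>"

definition meval :: "('c::zero \<Rightarrow> 'a::comm_ring_1) \<Rightarrow> (coord \<Rightarrow> 'a) \<Rightarrow> 'c mpol \<Rightarrow> 'a" where
  "meval h p f = (\<Sum>m\<in>Poly_Mapping.keys f.
     h (Poly_Mapping.lookup f m) * (\<Prod>v\<in>Poly_Mapping.keys m. p v ^ Poly_Mapping.lookup m v))"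

fun coord_val :: "(nat set \<Rightarrow> 'a) \<Rightarrow> 'a mat \<Rightarrow> coord \<Rightarrow> 'a" where
  "coord_val x \<psi> (XC I) = x I"
| "coord_val x \<psi> (UC k l) = \<psi> $$ (k, l)"
| "coord_val x \<psi> (TC m) = \<psi> $$ (m, m)"

definition base_change :: "int mpol \<Rightarrow> 'a::comm_ring_1 mpol" where
  "base_change = Poly_Mapping.map of_int"

section \<open>The equations\<close>

abbreviation xs_sym :: "nat list \<Rightarrow> int mpol" where
  "xs_sym \<equiv> antisym_ext (\<lambda>I. mvar (XC I))"

definition incr_seqs :: "nat \<Rightarrow> nat \<Rightarrow> nat list set" where
  "incr_seqs n d = {js. length js = d \<and> sorted_wrt (<) js \<and> set js \<subseteq> {..<n}}"

definition omit :: "nat \<Rightarrow> nat list \<Rightarrow> nat list" where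
  "omit m js = take m js @ drop (Suc m) js"

text \<open>
  The Pluecker relations in dimension \<open>d\<close> are the case where \<open>js\<close> has length \<open>d + 1\<close>, the
  incidence relations in dimensions \<open>(d, d + 1)\<close> the case of length \<open>d + 2\<close>. As \<open>m\<close> starts
  from \<open>0\<close>, the sign is \<open>(- 1) ^ Suc m\<close>.
\<close>
definition exchange_rel :: "nat list \<Rightarrow> nat list \<Rightarrow> int mpol" where
  "exchange_rel is js =
     (\<Sum>m<length js. (- 1) ^ Suc m * xs_sym (is @ [js ! m]) * xs_sym (omit m js))"

definition plucker_rels :: "nat \<Rightarrow> int mpol set" where
  "plucker_rels n = {exchange_rel is js | d is js.
     d \<in> {1..<n} \<and> is \<in> incr_seqs n (d - 1) \<and> js \<in> incr_seqs n (d + 1)}"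

definition incidence_rels :: "nat \<Rightarrow> int mpol set" where
  "incidence_rels n = {exchange_rel is js | d is js.
     1 \<le> d \<and> d + 2 \<le> n \<and> is \<in> incr_seqs n (d - 1) \<and> js \<in> incr_seqs n (d + 2)}"

definition index_le :: "nat set \<Rightarrow> nat set \<Rightarrow> bool" where
  "index_le A A' = list_all2 (\<le>) (sorted_list_of_set A) (sorted_list_of_set A')"

definition schubert_rels :: "nat \<Rightarrow> (nat \<Rightarrow> nat) \<Rightarrow> int mpol set" where
  "schubert_rels n w = {mvar (XC I) | d I.
     d \<in> {1..<n} \<and> I \<in> subsets_of_size n d \<and> \<not> index_le I (w ` {..<d})}"

definition nonvanishing :: "nat \<Rightarrow> (nat \<Rightarrow> nat) \<Rightarrow> int mpol set" where
  "nonvanishing n w = {xs_sym (map w [0..<d]) | d. d \<in> {1..<n}}"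

definition u_plus_lambda :: "nat \<Rightarrow> int mpol poly mat" where
  "u_plus_lambda n = mat n n (\<lambda>(k, l).
     if k < l then [:mvar (UC k l):] else if k = l then [:mvar (TC k):] else 0)
   + [:0, 1:] \<cdot>\<^sub>m 1\<^sub>m n"

definition P_poly :: "nat \<Rightarrow> (nat \<Rightarrow> nat) \<Rightarrow> nat set \<Rightarrow> int mpol poly" where
  "P_poly n w I =
     (\<Sum>J\<in>subsets_of_size n (card I). minor (u_plus_lambda n) I J * [:mvar (XC J):])
     - (\<Prod>k<card I. [:mvar (TC (w k)):] + [:0, 1:]) * [:mvar (XC I):]"

definition P_rels :: "nat \<Rightarrow> (nat \<Rightarrow> nat) \<Rightarrow> int mpol set" where
  "P_rels n w = {coeff (P_poly n w I) s | d I s.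
     d \<in> {1..<n} \<and> I \<in> subsets_of_size n d \<and> s < d}"

definition equations :: "nat \<Rightarrow> (nat \<Rightarrow> nat) \<Rightarrow> int mpol set" where
  "equations n w = plucker_rels n \<union> incidence_rels n \<union> schubert_rels n w \<union> P_rels n w"

section \<open>Loci and ideals\<close>

text \<open>
  Points with values in a field \<open>'b\<close>, an extension of the coefficient field via \<open>\<iota>\<close>,
  at which \<open>E\<close> vanishes and no element of \<open>H\<close> does. The
  elements of \<open>equations n w\<close> and \<open>nonvanishing n w\<close> are homogeneous in the coordinates of
  each exterior power, so the conditions do not depend on the homogeneous coordinates \<open>x\<close>.
\<close>
definition locus ::
  "('a::field \<Rightarrow> 'b::field) \<Rightarrow> nat \<Rightarrow> 'a mpol set \<Rightarrow> 'a mpol set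
     \<Rightarrow> ((nat \<Rightarrow> (nat set \<Rightarrow> 'b) set) \<times> 'b mat) set" where
  "locus \<iota> n E H = {(multiproj n x, \<psi>) | x \<psi>.
     (\<forall>d\<in>{1..<n}. \<exists>I\<in>subsets_of_size n d. x I \<noteq> 0) \<and> \<psi> \<in> borel_alg n \<and>
     (\<forall>f\<in>E. meval \<iota> (coord_val x \<psi>) f = 0) \<and>
     (\<forall>f\<in>H. meval \<iota> (coord_val x \<psi>) f \<noteq> 0)}"

text \<open>
  The open subscheme of the product of projective spaces and \<open>\<bb>\<close> where all elements of
  \<open>nonvanishing n w\<close> are nonzero is affine: normalising these coordinates to \<open>1\<close>
  identifies it with the closed subscheme of affine space given by
  \<open>chart_eqs n w\<close>. For a set \<open>Z\<close> of geometric points of this open subscheme, \<open>chart_ideal n w Z\<close> is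
  the ideal of polynomials over the base field vanishing on \<open>Z\<close>, that is, the ideal
  of \<open>Z\<close> with its reduced structure; it contains \<open>chart_eqs n w\<close>.
\<close>
definition chart_eqs :: "nat \<Rightarrow> (nat \<Rightarrow> nat) \<Rightarrow> int mpol set" where
  "chart_eqs n w = (\<lambda>h. h - 1) ` nonvanishing n w"

definition chart_ideal ::
  "nat \<Rightarrow> (nat \<Rightarrow> nat)
     \<Rightarrow> ((nat \<Rightarrow> (nat set \<Rightarrow> 'a::field alg_closure) set) \<times> 'a alg_closure mat) set
     \<Rightarrow> 'a mpol set" where
  "chart_ideal n w Z = {f \<in> carrier (mpol_ring n).
     \<forall>x \<psi>. (\<forall>d\<in>{1..<n}. antisym_ext x (map w [0..<d]) = 1) \<and> (multiproj n x, \<psi>) \<in> Z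
       \<longrightarrow> meval to_ac (coord_val x \<psi>) f = 0}"

end

(* The point of the Schubert cell with Pluecker coordinates x, normalised by x_{w(1)...w(d)} = 1,
   is the flag of U w, where U is upper unitriangular with the entry x_{w(1)...w(k-1) i} in
   position (i, w k). The exchange relations express every other coordinate as a polynomial in
   these entries, so modulo the relations x agrees with the flag minors of U w. By Cauchy-Binet
   the equations P say, again modulo the relations, that the d-th exterior power of
   A + lambda, A = (U w)^-1 psi (U w), has the basis vector e_1 ^ ... ^ e_d as an eigenvector;
   the coefficient of lambda^(d-1) yields that A is upper triangular. Everything is done modulo an ideal of
   an arbitrary commutative ring. The zero ideal of a field gives the equality of points.
   In the polynomial ring one obtains a substitution that is the identity modulo the relations
   and whose values at every point lie on the variety, so a polynomial vanishing on the variety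
   is killed by it and hence lies in the ideal of the relations. *)

theory Submission
  imports Defs "Jordan_Normal_Form.Char_Poly"
begin

section \<open>Minors and the Cauchy--Binet formula\<close>

text \<open>The last claim of the theorem is reducedness: the relations generate the whole vanishing
  ideal, not just one with the right zeros. This asks for congruences and for constructions without
  division: U is unitriangular, so its adjugate is its inverse over every commutative ring. A
  retraction exists because the normalised variety is an affine space. With B = U^-1 psi U = w A
  w^-1, its parameters are the entries of U kept by \<open>cell_unip\<close> and the entries of B on
  or above the diagonal except those at (w i, w j) with j < i. Overwriting the latter by 0 and
  conjugating back by U is the retraction in psi. The diagonal of A needs no separate equation: B is
  upper triangular with the diagonal of psi, which is also why the eigenvalue in P is the product of
  the t_{w(k)} + lambda. The exponent d - 1 comes from the minor of A + lambda with rows 1, ...,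
  d-1, b and columns 1, ..., d, where b > d: its last row is free of lambda, so the coefficient is
  A_{b,d}. Characteristic 0 makes the powers of 2 distinct, whence a polynomial with only zero
  values over the algebraic closure is zero.\<close>

definition rc_det :: "'a::comm_ring_1 mat \<Rightarrow> nat list \<Rightarrow> nat list \<Rightarrow> 'a" where
  "rc_det M is js = det (mat (length is) (length is) (\<lambda>(i, j). M $$ (is ! i, js ! j)))"

lemma det_mat_leibniz:
  "det (mat d d (\<lambda>(i, j). f i j)) =
     (\<Sum>p | p permutes {0..<d}. signof p * (\<Prod>i = 0..<d. f i (p i)))"
  unfolding det_def
  by (auto intro!: sum.cong prod.cong arg_cong2[of _ _ _ _ "(*)"] simp: permutes_in_image)

lemma pick_nth:
  assumes "finite I" "i < card I"
  shows "pick I i = sorted_list_of_set I ! i"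
proof -
  have s: "sorted_wrt (<) (map (pick I) [0..<card I])"
    by (auto simp: sorted_wrt_map sorted_wrt_iff_nth_less intro!: pick_mono_le)
  have "pick I ` {0..<card I} = I"
  proof (rule card_subset_eq[OF assms(1)])
    show "pick I ` {0..<card I} \<subseteq> I" by (auto intro: pick_in_set_le)
    have "inj_on (pick I) {0..<card I}"
      by (rule linorder_inj_onI) (auto simp: pick_mono_le less_imp_neq)
    then show "card (pick I ` {0..<card I}) = card I" by (simp add: card_image)
  qed
  then have "map (pick I) [0..<card I] = sorted_list_of_set I"
    using s by (metis list.set_map set_upt sorted_list_of_set.idem_if_sorted_distinct strict_sorted_iff)
  then show ?thesis using assms(2) by (metis add_0 diff_zero length_upt nth_map nth_upt)
qed

text \<open>Minors indexed by lists allow rows in any order and with repetitions, as the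
  antisymmetric extension and Laplace expansions require; the increasing enumerations recover
  \<open>minor\<close>.\<close>

lemma minor_rc_det:
  assumes "I \<subseteq> {..<dim_row M}" "J \<subseteq> {..<dim_col M}" "card I = card J"
  shows "minor M I J = rc_det M (sorted_list_of_set I) (sorted_list_of_set J)"
proof -
  have f: "finite I" "finite J" using assms finite_subset by blast+
  have "{i. i < dim_row M \<and> i \<in> I} = I" "{j. j < dim_col M \<and> j \<in> J} = J"
    using assms by auto
  then show ?thesis
    unfolding minor_def submatrix_def rc_det_def using assms(3) f
    by (intro arg_cong[of _ _ det] eq_matI) (simp_all add: pick_nth)
qed

lemma sorted_list_of_lessThan [simp]: "sorted_list_of_set {..<d} = [0..<d::nat]"
  by (simp add: lessThan_atLeast0)

lemma rc_det_swap:
  "rc_det M (xs @ b # a # ys) js = - rc_det M (xs @ a # b # ys) js"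
proof -
  let ?n = "length xs + 2 + length ys"
  let ?A = "mat ?n ?n (\<lambda>(i, j). M $$ ((xs @ a # b # ys) ! i, js ! j))"
  let ?B = "mat ?n ?n (\<lambda>(i, j). M $$ ((xs @ b # a # ys) ! i, js ! j))"
  have "?B = swaprows (length xs) (Suc (length xs)) ?A"
  proof (rule eq_matI)
    fix i j assume "i < dim_row (swaprows (length xs) (Suc (length xs)) ?A)" "j < dim_col (swaprows (length xs) (Suc (length xs)) ?A)"
    then have ij: "i < ?n" "j < ?n" by auto
    have "(xs @ b # a # ys) ! i = (xs @ a # b # ys) ! i" if "i \<noteq> length xs" "i \<noteq> Suc (length xs)"
    proof (cases "i < length xs")
      case False
      then have "length xs + 2 \<le> i" using that by linarith
      then obtain k where "i = length xs + 2 + k" using le_Suc_ex by blast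
      then show ?thesis by (simp add: nth_append)
    qed (simp add: nth_append)
    then show "?B $$ (i, j) = swaprows (length xs) (Suc (length xs)) ?A $$ (i, j)"
      using ij by (auto simp: nth_append)
  qed auto
  then have "det ?B = - det ?A"
    using det_swaprows[of "length xs" ?n "Suc (length xs)" ?A] by simp
  then show ?thesis by (simp add: rc_det_def)
qed

lemma rc_det_not_distinct:
  assumes "\<not> distinct is"
  shows "rc_det M is js = 0"
proof -
  from assms obtain i j where ij: "i < length is" "j < length is" "i \<noteq> j" "is ! i = is ! j"
    by (auto simp: distinct_conv_nth)
  show ?thesis unfolding rc_det_def
    by (rule det_identical_rows[OF _ ij(3,1,2)]) (use ij in \<open>auto intro!: eq_vecI\<close>)
qed

section \<open>Sorting index sequences: inversions and signs\<close>

fun inversions_rec :: "nat list \<Rightarrow> nat" where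
  "inversions_rec [] = 0"
| "inversions_rec (a # l) = length (filter (\<lambda>b. b < a) l) + inversions_rec l"

lemma finite_inversions: "finite (inversions l)"
  by (rule finite_subset[of _ "{..<length l} \<times> {..<length l}"]) (auto simp: inversions_def)

text \<open>With the recursive count, the effect of an adjacent swap becomes a plain induction on
  the prefix before it.\<close>

lemma card_inversions: "card (inversions l) = inversions_rec l"
proof (induction l)
  case Nil then show ?case by (simp add: inversions_def)
next
  case (Cons a l)
  let ?A = "Pair 0 ` Suc ` {i. i < length l \<and> l ! i < a}"
  let ?B = "map_prod Suc Suc ` inversions l"
  have "inversions (a # l) = ?A \<union> ?B"
  proof (rule Set.set_eqI, rule iffI)
    fix q assume "q \<in> inversions (a # l)"
    then obtain i j where q: "q = (i, j)" "i < j" "j < Suc (length l)" "(a # l) ! i > (a # l) ! j"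
      by (auto simp: inversions_def)
    then obtain j' where j: "j = Suc j'" by (cases j) auto
    show "q \<in> ?A \<union> ?B"
      using q j by (cases i) (auto simp: inversions_def image_iff)
  qed (auto simp: inversions_def)
  moreover have "card ?A = length (filter (\<lambda>b. b < a) l)"
    by (simp add: card_image inj_on_def length_filter_conv_card)
  moreover have "card ?B = card (inversions l)"
    by (intro card_image) (auto simp: inj_on_def)
  moreover have "finite ?A" "finite ?B" "?A \<inter> ?B = {}"
    by (auto simp: finite_inversions)
  ultimately show ?case using Cons by (simp add: card_Un_disjoint)
qed

lemma inversions_rec_swap:
  "a < b \<Longrightarrow> inversions_rec (xs @ b # a # ys) = Suc (inversions_rec (xs @ a # b # ys))"
  by (induction xs) auto

lemma inversions_strict_sorted:
  "sorted_wrt (<) l \<Longrightarrow> inversions l = {}"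
  by (force simp: inversions_def sorted_wrt_iff_nth_less)

text \<open>Bubble sort. A distinct unsorted list has an adjacent descent; swapping it removes
  exactly one inversion and flips the sign on both sides, so induction on the number of inversions
  reaches the increasing list.\<close>

lemma alternating_eq_antisym_ext:
  fixes F :: "nat list \<Rightarrow> 'a::ring_1"
  assumes swap: "\<And>xs a b ys. F (xs @ b # a # ys) = - F (xs @ a # b # ys)"
    and dist: "\<And>js. \<not> distinct js \<Longrightarrow> F js = 0"
  shows "F js = antisym_ext (\<lambda>I. F (sorted_list_of_set I)) js"
proof (induction "inversions_rec js" arbitrary: js rule: less_induct)
  case less
  show ?case
  proof (cases "sorted_wrt (<) js")
    case True
    then have "sorted_list_of_set (set js) = js" "distinct js"
      by (simp_all add: sorted_list_of_set.idem_if_sorted_distinct strict_sorted_iff)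
    with True show ?thesis by (simp add: antisym_ext_def inversions_strict_sorted)
  next
    case False
    show ?thesis
    proof (cases "distinct js")
      case True
      with False have "\<not> sorted js" by (simp add: strict_sorted_iff)
      then obtain i where i: "Suc i < length js" "js ! i > js ! Suc i"
        by (auto simp: sorted_iff_nth_Suc not_le)
      define xs ys where "xs = take i js" and "ys = drop (Suc (Suc i)) js"
      have js: "js = xs @ js ! i # js ! Suc i # ys"
        using i by (simp add: xs_def ys_def Cons_nth_drop_Suc)
      let ?l = "xs @ js ! Suc i # js ! i # ys"
      have inv: "inversions_rec js = Suc (inversions_rec ?l)"
        by (subst js) (rule inversions_rec_swap[OF i(2)])
      have set: "set ?l = set js" by (subst (3) js) auto
      have "mset ?l = mset js" by (subst (3) js) auto
      then have d: "distinct ?l" using True by (metis mset_eq_imp_distinct_iff)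
      have "F js = - F ?l" by (subst js) (rule swap)
      also have "F ?l = antisym_ext (\<lambda>I. F (sorted_list_of_set I)) ?l"
        by (rule less) (simp add: inv)
      finally show ?thesis
        unfolding antisym_ext_def card_inversions inv set using d True by simp
    qed (simp add: antisym_ext_def dist)
  qed
qed

lemma antisym_ext_cong:
  "x (set js) = y (set js) \<Longrightarrow> antisym_ext x js = antisym_ext y js"
  by (simp add: antisym_ext_def)

text \<open>A determinant alternates in its rows, so it is the antisymmetric extension of its values
  on increasing lists. The columns are always an initial segment, as in the Pluecker
  coordinates.\<close>

lemma antisym_ext_minor:
  assumes "set js \<subseteq> {..<dim_row M}" "length js \<le> dim_col M"
  shows "antisym_ext (\<lambda>I. minor M I {..<card I}) js = rc_det M js [0..<length js]"
proof (cases "distinct js")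
  case True
  let ?d = "length js"
  have "rc_det M js [0..<?d] = antisym_ext (\<lambda>I. rc_det M (sorted_list_of_set I) [0..<?d]) js"
    by (rule alternating_eq_antisym_ext[where F = "\<lambda>l. rc_det M l [0..<?d]"])
      (rule rc_det_swap, rule rc_det_not_distinct)
  also have "\<dots> = antisym_ext (\<lambda>I. minor M I {..<card I}) js"
    by (rule antisym_ext_cong) (use assms True in \<open>simp add: minor_rc_det distinct_card\<close>)
  finally show ?thesis by simp
next
  case False
  then show ?thesis by (simp add: rc_det_not_distinct antisym_ext_def)
qed

section \<open>The Cauchy-Binet formula\<close>

lemma rc_det_permute_rows:
  assumes p: "p permutes {0..<d}" and "length s = d"
  shows "det (mat d d (\<lambda>(i, j). B $$ (s ! p i, ks ! j))) = signof p * rc_det B s ks"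
proof -
  have "det (mat d d (\<lambda>(i, j). mat d d (\<lambda>(i, j). B $$ (s ! i, ks ! j)) $$ (p i, j)))
      = signof p * det (mat d d (\<lambda>(i, j). B $$ (s ! i, ks ! j)))"
    by (rule det_permute_rows) (use p in auto)
  moreover have "mat d d (\<lambda>(i, j). mat d d (\<lambda>(i, j). B $$ (s ! i, ks ! j)) $$ (p i, j))
     = mat d d (\<lambda>(i, j). B $$ (s ! p i, ks ! j))"
    using permutes_in_image[OF p] by (intro eq_matI) auto
  ultimately show ?thesis using assms(2) by (simp add: rc_det_def)
qed

text \<open>Expanding the entries of the product gives a sum over all maps \<open>f\<close> from row
  positions to middle indices. A map that is not injective repeats a row of \<open>B\<close> and
  contributes 0; the injective ones are grouped by their image \<open>J\<close>.\<close>

lemma cauchy_binet_rc: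
  assumes A: "A \<in> carrier_mat m n" and B: "B \<in> carrier_mat n k"
    and rs: "set is \<subseteq> {..<m}" "length is = d" and ks: "set ks \<subseteq> {..<k}" "length ks = d"
  shows "rc_det (A * B) is ks = (\<Sum>J\<in>subsets_of_size n d.
     rc_det A is (sorted_list_of_set J) * rc_det B (sorted_list_of_set J) ks)"
proof -
  let ?F = "{0..<d} \<rightarrow>\<^sub>E {..<n}"
  let ?s = sorted_list_of_set
  let ?D = "\<lambda>f. (\<Prod>i = 0..<d. A $$ (is ! i, f i)) * det (mat d d (\<lambda>(i, j). B $$ (f i, ks ! j)))"
  have ent: "(A * B) $$ (is ! i, ks ! j) = (\<Sum>l<n. A $$ (is ! i, l) * B $$ (l, ks ! j))"
    if "i < d" "j < d" for i j
  proof -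
    have "is ! i < m" "ks ! j < k" using that rs ks by (auto dest!: subsetD simp: subset_iff)
    then show ?thesis using A B by (simp add: scalar_prod_def lessThan_atLeast0)
  qed
  have "rc_det (A * B) is ks = (\<Sum>p | p permutes {0..<d}. signof p *
      (\<Prod>i = 0..<d. \<Sum>l<n. A $$ (is ! i, l) * B $$ (l, ks ! p i)))"
    unfolding rc_det_def rs(2) det_mat_leibniz
    by (auto intro!: sum.cong prod.cong arg_cong2[of _ _ _ _ "(*)"] simp: ent permutes_in_image)
  also have "\<dots> = (\<Sum>p | p permutes {0..<d}. \<Sum>f\<in>?F. signof p *
      (\<Prod>i = 0..<d. A $$ (is ! i, f i) * B $$ (f i, ks ! p i)))"
    by (subst prod_sum_PiE) (simp_all add: sum_distrib_left)
  also have "\<dots> = (\<Sum>f\<in>?F. ?D f)"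
    unfolding det_mat_leibniz
    by (subst sum.swap) (simp add: sum_distrib_left prod.distrib mult_ac)
  also have "\<dots> = (\<Sum>f\<in>{f \<in> ?F. inj_on f {0..<d}}. ?D f)"
  proof (rule sum.mono_neutral_right)
    show "\<forall>f\<in>?F - {f \<in> ?F. inj_on f {0..<d}}. ?D f = 0"
    proof
      fix f assume "f \<in> ?F - {f \<in> ?F. inj_on f {0..<d}}"
      then obtain i j where "i < d" "j < d" "i \<noteq> j" "f i = f j" by (auto simp: inj_on_def)
      then have "det (mat d d (\<lambda>(i, j). B $$ (f i, ks ! j))) = 0"
        by (intro det_identical_rows[of _ _ i j]) (auto intro!: eq_vecI)
      then show "?D f = 0" by simp
    qed
  qed (auto simp: finite_PiE)
  also have "\<dots> = (\<Sum>J\<in>subsets_of_size n d.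
      \<Sum>f\<in>{f \<in> {f \<in> ?F. inj_on f {0..<d}}. f ` {0..<d} = J}. ?D f)"
    by (rule sum.group[symmetric])
      (auto simp: finite_PiE subsets_of_size_def card_image intro: finite_subset[of _ "Pow {..<n}"])
  also have "\<dots> = (\<Sum>J\<in>subsets_of_size n d. rc_det A is (?s J) * rc_det B (?s J) ks)"
  proof (rule sum.cong[OF refl])
    fix J assume "J \<in> subsets_of_size n d"
    then have J: "J \<subseteq> {..<n}" "card J = d" "finite J"
      by (auto simp: subsets_of_size_def intro: finite_subset)
    let ?P = "{p. p permutes {0..<d}}"
    let ?G = "{f \<in> {f \<in> ?F. inj_on f {0..<d}}. f ` {0..<d} = J}"
    let ?h = "\<lambda>p. restrict (\<lambda>i. ?s J ! p i) {0..<d}"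
    have sJ: "length (?s J) = d" "set (?s J) = J" "distinct (?s J)" using J by auto
    have bs: "bij_betw (\<lambda>i. ?s J ! i) {0..<d} J"
      using bij_betw_nth[of "?s J" "{0..<d}" J] sJ by (simp add: lessThan_atLeast0)
    \<comment> \<open>A map with image \<open>J\<close> is the increasing enumeration of
      \<open>J\<close> composed with a permutation of the positions, whose sign then comes out of
      the determinant of \<open>B\<close>.\<close>
    have "bij_betw ?h ?P ?G"
    proof (rule bij_betw_byWitness[where f' = "\<lambda>f i. if i < d then the_inv_into {0..<d} (\<lambda>i. ?s J ! i) (f i) else i"])
      have inj: "inj_on (\<lambda>i. ?s J ! i) {0..<d}" using bs by (rule bij_betw_imp_inj_on)
      show "\<forall>p\<in>?P. (\<lambda>i. if i < d then the_inv_into {0..<d} (\<lambda>i. ?s J ! i) (?h p i) else i) = p"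
      proof
        fix p assume "p \<in> ?P"
        then show "(\<lambda>i. if i < d then the_inv_into {0..<d} (\<lambda>i. ?s J ! i) (?h p i) else i) = p"
          using inj permutes_in_image[of p "{0..<d}"]
          by (auto simp: fun_eq_iff the_inv_into_f_f permutes_not_in)
      qed
      show "\<forall>f\<in>?G. ?h (\<lambda>i. if i < d then the_inv_into {0..<d} (\<lambda>i. ?s J ! i) (f i) else i) = f"
      proof
        fix f assume f: "f \<in> ?G"
        then have "f i \<in> (\<lambda>i. ?s J ! i) ` {0..<d}" if "i < d" for i
          using that bs by (auto simp: bij_betw_def)
        with f show "?h (\<lambda>i. if i < d then the_inv_into {0..<d} (\<lambda>i. ?s J ! i) (f i) else i) = f"
          by (auto simp: fun_eq_iff f_the_inv_into_f[OF inj] PiE_def extensional_def)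
      qed
      show "?h ` ?P \<subseteq> ?G"
      proof
        fix f assume "f \<in> ?h ` ?P"
        then obtain p where p: "p permutes {0..<d}" "f = ?h p" by auto
        have "bij_betw (\<lambda>i. ?s J ! p i) {0..<d} J"
          using bij_betw_trans[OF permutes_imp_bij[OF p(1)] bs] by (simp add: o_def)
        then have "bij_betw f {0..<d} J"
          unfolding p(2) by (simp add: bij_betw_restrict_eq)
        then show "f \<in> ?G" using J p(2) by (auto simp: bij_betw_def)
      qed
      show "(\<lambda>f i. if i < d then the_inv_into {0..<d} (\<lambda>i. ?s J ! i) (f i) else i) ` ?G \<subseteq> ?P"
      proof clarify
        fix f assume f: "inj_on f {0..<d}" "J = f ` {0..<d}"
        let ?g = "\<lambda>i. if i < d then the_inv_into {0..<d} (\<lambda>i. ?s J ! i) (f i) else i"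
        have "bij_betw (the_inv_into {0..<d} (\<lambda>i. ?s J ! i) \<circ> f) {0..<d} {0..<d}"
          by (rule bij_betw_trans[OF _ bij_betw_the_inv_into[OF bs]])
            (use f in \<open>simp add: bij_betw_def\<close>)
        then have "bij_betw ?g {0..<d} {0..<d}"
          by (rule bij_betw_cong[THEN iffD1, rotated]) auto
        then have "?g permutes {0..<d}" by (rule bij_imp_permutes) auto
        then show "(\<lambda>i. if i < d then the_inv_into {0..<d} (\<lambda>i. ?s (f ` {0..<d}) ! i) (f i) else i) permutes {0..<d}"
          unfolding f(2) .
      qed
    qed
    then have "(\<Sum>f\<in>?G. ?D f) = (\<Sum>p\<in>?P. ?D (?h p))"
      by (rule sum.reindex_bij_betw[symmetric])
    also have "\<dots> = (\<Sum>p\<in>?P. (\<Prod>i = 0..<d. A $$ (is ! i, ?s J ! p i)) * (signof p * rc_det B (?s J) ks))"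
    proof (rule sum.cong[OF refl])
      fix p assume "p \<in> ?P"
      then have p: "p permutes {0..<d}" by simp
      have "det (mat d d (\<lambda>(i, j). B $$ (?h p i, ks ! j))) = det (mat d d (\<lambda>(i, j). B $$ (?s J ! p i, ks ! j)))"
        by (rule arg_cong[of _ _ det]) (rule eq_matI, auto)
      then show "?D (?h p) = (\<Prod>i = 0..<d. A $$ (is ! i, ?s J ! p i)) * (signof p * rc_det B (?s J) ks)"
        by (simp add: rc_det_permute_rows[OF p sJ(1)])
    qed
    also have "\<dots> = rc_det A is (?s J) * rc_det B (?s J) ks"
      unfolding rc_det_def[of A] rs(2) det_mat_leibniz sum_distrib_right
      by (simp add: mult_ac)
    finally show "(\<Sum>f\<in>?G. ?D f) = rc_det A is (?s J) * rc_det B (?s J) ks" .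
  qed
  finally show ?thesis .
qed

lemma cauchy_binet:
  assumes "A \<in> carrier_mat m n" "B \<in> carrier_mat n k"
    and "I \<in> subsets_of_size m d" "K \<in> subsets_of_size k d"
  shows "minor (A * B) I K = (\<Sum>J\<in>subsets_of_size n d. minor A I J * minor B J K)"
proof -
  have fin: "finite I" "finite K" using assms(3,4) by (auto simp: subsets_of_size_def intro: finite_subset)
  have "minor (A * B) I K = rc_det (A * B) (sorted_list_of_set I) (sorted_list_of_set K)"
    using assms by (intro minor_rc_det) (auto simp: subsets_of_size_def)
  also have "\<dots> = (\<Sum>J\<in>subsets_of_size n d. rc_det A (sorted_list_of_set I) (sorted_list_of_set J)
      * rc_det B (sorted_list_of_set J) (sorted_list_of_set K))"
    using assms fin by (intro cauchy_binet_rc) (auto simp: subsets_of_size_def)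
  also have "\<dots> = (\<Sum>J\<in>subsets_of_size n d. minor A I J * minor B J K)"
    using assms by (intro sum.cong[OF refl]) (auto simp: subsets_of_size_def minor_rc_det)
  finally show ?thesis .
qed

section \<open>Exchange relations modulo an ideal\<close>

text \<open>Ideals of a whole type, so that congruences combine with type-class algebra. The
  instances used are \<open>{0}\<close>, the polynomials with all coefficients in a given ideal, and
  the pullback of the ideal generated inside \<open>mpol_ring n\<close>.\<close>

locale ring_ideal =
  fixes J :: "'r::comm_ring_1 set"
  assumes zero_mem: "0 \<in> J"
    and add_mem: "a \<in> J \<Longrightarrow> b \<in> J \<Longrightarrow> a + b \<in> J"
    and mult_mem: "a \<in> J \<Longrightarrow> r * a \<in> J"
begin

definition eqv :: "'r \<Rightarrow> 'r \<Rightarrow> bool" (infix "\<bumpeq>" 50) where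
  "a \<bumpeq> b \<longleftrightarrow> a - b \<in> J"

lemma uminus_mem: "a \<in> J \<Longrightarrow> - a \<in> J"
  using mult_mem[of a "-1"] by simp

lemma eqv_0_iff: "a \<bumpeq> 0 \<longleftrightarrow> a \<in> J"
  by (simp add: eqv_def)

lemma eqv_refl [simp]: "a \<bumpeq> a"
  by (simp add: eqv_def zero_mem)

lemma eqv_sym: "a \<bumpeq> b \<Longrightarrow> b \<bumpeq> a"
  using uminus_mem[of "a - b"] by (simp add: eqv_def)

lemma eqv_trans [trans]: "a \<bumpeq> b \<Longrightarrow> b \<bumpeq> c \<Longrightarrow> a \<bumpeq> c"
  using add_mem[of "a - b" "b - c"] by (simp add: eqv_def)

lemma eqv_add: "a \<bumpeq> b \<Longrightarrow> c \<bumpeq> d \<Longrightarrow> a + c \<bumpeq> b + d"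
  using add_mem[of "a - b" "c - d"] by (simp add: eqv_def algebra_simps)

lemma eqv_uminus: "a \<bumpeq> b \<Longrightarrow> - a \<bumpeq> - b"
  using uminus_mem[of "a - b"] by (simp add: eqv_def)

lemma eqv_diff: "a \<bumpeq> b \<Longrightarrow> c \<bumpeq> d \<Longrightarrow> a - c \<bumpeq> b - d"
  using eqv_add[of a b "- c" "- d"] eqv_uminus by simp

lemma eqv_mult:
  assumes "a \<bumpeq> b" "c \<bumpeq> d"
  shows "a * c \<bumpeq> b * d"
proof -
  have "c * (a - b) + b * (c - d) \<in> J"
    using assms by (intro add_mem mult_mem) (simp_all add: eqv_def)
  then show ?thesis by (simp add: eqv_def algebra_simps)
qed

lemma eqv_sum: "(\<And>i. i \<in> A \<Longrightarrow> f i \<bumpeq> g i) \<Longrightarrow> sum f A \<bumpeq> sum g A"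
  by (induction A rule: infinite_finite_induct) (simp_all add: eqv_add)

lemma eqv_prod: "(\<And>i. i \<in> A \<Longrightarrow> f i \<bumpeq> g i) \<Longrightarrow> prod f A \<bumpeq> prod g A"
  by (induction A rule: infinite_finite_induct) (simp_all add: eqv_mult)

lemma eqv_power: "a \<bumpeq> b \<Longrightarrow> a ^ k \<bumpeq> b ^ k"
  by (induction k) (simp_all add: eqv_mult)

lemma eqv_mat_mult:
  assumes "A \<in> carrier_mat l m" "A' \<in> carrier_mat l m" "B \<in> carrier_mat m k" "B' \<in> carrier_mat m k"
    and "\<And>i j. i < l \<Longrightarrow> j < m \<Longrightarrow> A $$ (i, j) \<bumpeq> A' $$ (i, j)"
    and "\<And>i j. i < m \<Longrightarrow> j < k \<Longrightarrow> B $$ (i, j) \<bumpeq> B' $$ (i, j)"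
    and "i < l" "j < k"
  shows "(A * B) $$ (i, j) \<bumpeq> (A' * B') $$ (i, j)"
  using assms by (auto simp: scalar_prod_def intro!: eqv_sum eqv_mult)

lemma eqv_antisym_ext: "x (set js) \<bumpeq> y (set js) \<Longrightarrow> antisym_ext x js \<bumpeq> antisym_ext y js"
  by (auto simp: antisym_ext_def intro: eqv_mult)

end

section \<open>Exchange relations of flag minors\<close>

definition exchange_sum :: "(nat set \<Rightarrow> 'a::comm_ring_1) \<Rightarrow> nat list \<Rightarrow> nat list \<Rightarrow> 'a" where
  "exchange_sum x rs js =
     (\<Sum>m<length js. (- 1) ^ Suc m * antisym_ext x (rs @ [js ! m]) * antisym_ext x (omit m js))"

lemma length_omit: "m < length js \<Longrightarrow> length (omit m js) = length js - 1"
  by (simp add: omit_def)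

lemma nth_omit:
  "m < length js \<Longrightarrow> i < length js - 1 \<Longrightarrow> omit m js ! i = js ! (if i < m then i else Suc i)"
  by (auto simp: omit_def nth_append)

lemma set_omit_subset: "set (omit m js) \<subseteq> set js"
  by (auto simp: omit_def dest: in_set_takeD in_set_dropD)

lemma set_omit:
  assumes "distinct js" "m < length js"
  shows "set (omit m js) = set js - {js ! m}" "distinct (omit m js)"
proof -
  have "js = take m js @ js ! m # drop (Suc m) js"
    using assms(2) by (simp add: Cons_nth_drop_Suc)
  then have "distinct (take m js @ js ! m # drop (Suc m) js)"
    and s: "set js = set (take m js @ js ! m # drop (Suc m) js)" using assms(1) by simp_all
  then show "set (omit m js) = set js - {js ! m}" "distinct (omit m js)"
    unfolding s by (auto simp: omit_def)
qed

abbreviation flag_minor :: "'a::comm_ring_1 mat \<Rightarrow> nat set \<Rightarrow> 'a" where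
  "flag_minor g I \<equiv> minor g I {..<card I}"

text \<open>Expand the first factor along the row of the exchanged index. The coefficient of each
  cofactor is then the Laplace expansion of a determinant with column \<open>c\<close> occurring
  twice. The length condition puts \<open>c\<close> among the columns of the second factor; it
  covers the Pluecker and the incidence relations at once.\<close>

lemma exchange_sum_minor:
  fixes g :: "'a::comm_ring_1 mat"
  assumes g: "g \<in> carrier_mat n n" and i: "set rs \<subseteq> {..<n}" and j: "set js \<subseteq> {..<n}"
    and len: "length rs + 2 \<le> length js" "length js \<le> Suc n"
  shows "exchange_sum (flag_minor g) rs js = 0"
proof -
  define d where "d = Suc (length rs)"
  define e where "e = length js - 1"
  have de: "d \<le> e" "length js = Suc e" "e \<le> n" using len by (auto simp: d_def e_def)
  define A where "A = (\<lambda>k. mat d d (\<lambda>(r, c). g $$ ((rs @ [k]) ! r, c)))"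
  \<comment> \<open>A cofactor along the last row ignores that row, so the index 0 stands for any
    exchanged index.\<close>
  define L where "L = (\<lambda>c. cofactor (A 0) (length rs) c)"
  have L: "cofactor (A k) (length rs) c = L c" if "c < d" for k c
    unfolding L_def cofactor_def mat_delete_def using that
    by (auto intro!: arg_cong[of _ _ det] arg_cong2[of _ _ _ _ "(*)"] eq_matI simp: A_def d_def nth_append)
  have row: "antisym_ext (flag_minor g) (rs @ [k]) = (\<Sum>c<d. g $$ (k, c) * L c)" if "k < n" for k
  proof -
    have "antisym_ext (flag_minor g) (rs @ [k]) = det (A k)"
      using g i that de by (subst antisym_ext_minor)
        (auto simp: rc_det_def A_def d_def simp del: upt_Suc intro!: arg_cong[of _ _ det] eq_matI)
    also have "\<dots> = (\<Sum>c<d. A k $$ (length rs, c) * cofactor (A k) (length rs) c)"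
      by (rule laplace_expansion_row) (auto simp: A_def d_def)
    also have "\<dots> = (\<Sum>c<d. g $$ (k, c) * L c)"
      by (rule sum.cong[OF refl]) (simp add: L, simp add: A_def d_def)
    finally show ?thesis .
  qed
  have col: "(\<Sum>m<Suc e. (- 1) ^ m * g $$ (js ! m, c) * antisym_ext (flag_minor g) (omit m js)) = 0"
    if c: "c < d" for c
  proof -
    \<comment> \<open>Column \<open>c\<close> is put in front of the first \<open>e\<close> columns,
      which contain it already because \<open>c < d\<close> and \<open>d \<le> e\<close>.\<close>
    define B where "B = mat (Suc e) (Suc e) (\<lambda>(r, k). g $$ (js ! r, case k of 0 \<Rightarrow> c | Suc k' \<Rightarrow> k'))"
    have "det B = (\<Sum>m<Suc e. B $$ (m, 0) * cofactor B m 0)"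
      by (rule laplace_expansion_column) (auto simp: B_def)
    also have "\<dots> = (\<Sum>m<Suc e. (- 1) ^ m * g $$ (js ! m, c) * antisym_ext (flag_minor g) (omit m js))"
    proof (rule sum.cong[OF refl])
      fix m assume "m \<in> {..<Suc e}"
      then have m: "m < length js" using de by simp
      have "antisym_ext (flag_minor g) (omit m js) = det (mat_delete B m 0)"
        using g j de m set_omit_subset[of m js] by (subst antisym_ext_minor)
          (auto simp: rc_det_def B_def mat_delete_def length_omit nth_omit intro!: arg_cong[of _ _ det] eq_matI)
      then show "B $$ (m, 0) * cofactor B m 0
          = (- 1) ^ m * g $$ (js ! m, c) * antisym_ext (flag_minor g) (omit m js)"
        using m de by (simp add: cofactor_def, simp add: B_def)
    qed
    finally have "(\<Sum>m<Suc e. (- 1) ^ m * g $$ (js ! m, c) * antisym_ext (flag_minor g) (omit m js)) = det B"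
      by simp
    also have "det B = 0"
      by (rule det_identical_columns[of B "Suc e" 0 "Suc c"]) (use c de in \<open>auto simp: B_def intro!: eq_vecI\<close>)
    finally show ?thesis .
  qed
  have "exchange_sum (flag_minor g) rs js
      = (\<Sum>m<Suc e. \<Sum>c<d. - L c * ((- 1) ^ m * g $$ (js ! m, c) * antisym_ext (flag_minor g) (omit m js)))"
    unfolding exchange_sum_def de(2)
  proof (rule sum.cong[OF refl])
    fix m assume "m \<in> {..<Suc e}"
    then have "js ! m \<in> set js" using de by auto
    then have "js ! m < n" using j by auto
    then show "(- 1) ^ Suc m * antisym_ext (flag_minor g) (rs @ [js ! m]) * antisym_ext (flag_minor g) (omit m js)
       = (\<Sum>c<d. - L c * ((- 1) ^ m * g $$ (js ! m, c) * antisym_ext (flag_minor g) (omit m js)))"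
      by (simp add: row sum_distrib_left sum_distrib_right sum_negf mult_ac)
  qed
  also have "\<dots> = (\<Sum>c<d. - L c * (\<Sum>m<Suc e. (- 1) ^ m * g $$ (js ! m, c) * antisym_ext (flag_minor g) (omit m js)))"
    unfolding sum_distrib_left by (rule sum.swap)
  also have "\<dots> = 0"
    by (rule sum.neutral) (simp add: col del: sum.lessThan_Suc)
  finally show ?thesis .
qed

section \<open>Uniqueness of solutions of the exchange relations\<close>

context ring_ideal begin

text \<open>The term exchanging \<open>a\<close> is, up to sign,
  \<open>x (insert a (set rs)) * x (set js - {a})\<close>. Its first factor is congruent to
  \<open>e\<close>, which is its own inverse, so the other terms determine the second factor. Terms
  exchanging an index of \<open>rs\<close> vanish by antisymmetry.\<close>

lemma exchange_solve:
  assumes ex: "exchange_sum x rs js \<bumpeq> 0" "exchange_sum x' rs js \<bumpeq> 0"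
    and d: "distinct js" "distinct rs" and a: "a \<in> set js" "a \<notin> set rs"
    and e: "x (insert a (set rs)) \<bumpeq> e" "x' (insert a (set rs)) \<bumpeq> e" "e * e = 1"
    and oth: "\<And>b. b \<in> set js \<Longrightarrow> b \<noteq> a \<Longrightarrow> b \<notin> set rs \<Longrightarrow>
       x (insert b (set rs)) \<bumpeq> x' (insert b (set rs)) \<and> x (set js - {b}) \<bumpeq> x' (set js - {b})"
  shows "x (set js - {a}) \<bumpeq> x' (set js - {a})"
proof -
  obtain m0 where m0: "m0 < length js" "js ! m0 = a" using a by (auto simp: in_set_conv_nth)
  let ?t = "\<lambda>x m. (- 1) ^ Suc m * antisym_ext x (rs @ [js ! m]) * antisym_ext x (omit m js)"
  let ?s = "(- 1) ^ Suc m0 * (- 1) ^ card (inversions (rs @ [a])) * (- 1) ^ card (inversions (omit m0 js)) :: 'r"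
  have s: "?s * ?s = 1" by (simp add: power2_eq_square[symmetric] power_mult_distrib power_mult[symmetric] mult.commute)
  have sum: "exchange_sum y rs js = ?t y m0 + (\<Sum>m\<in>{..<length js} - {m0}. ?t y m)" for y
    unfolding exchange_sum_def using m0 by (subst sum.remove[of _ m0]) auto
  have t: "?t y m0 = ?s * y (insert a (set rs)) * y (set js - {a})" for y
    using set_omit[OF d(1) m0(1)] m0 a d by (simp add: antisym_ext_def mult_ac)
  have "?t x m \<bumpeq> ?t x' m" if m: "m \<in> {..<length js} - {m0}" for m
  proof (cases "js ! m \<in> set rs")
    case True
    then show ?thesis by (simp add: antisym_ext_def)
  next
    case False
    have "js ! m \<noteq> a" using m m0 d(1) by (auto simp: nth_eq_iff_index_eq)
    then have "x (insert (js ! m) (set rs)) \<bumpeq> x' (insert (js ! m) (set rs))"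
      "x (set js - {js ! m}) \<bumpeq> x' (set js - {js ! m})"
      using oth[of "js ! m"] False m by auto
    then show ?thesis using m set_omit[OF d(1), of m]
      by (intro eqv_mult eqv_antisym_ext) auto
  qed
  then have "(\<Sum>m\<in>{..<length js} - {m0}. ?t x m) \<bumpeq> (\<Sum>m\<in>{..<length js} - {m0}. ?t x' m)"
    by (rule eqv_sum)
  then have "exchange_sum x rs js - (\<Sum>m\<in>{..<length js} - {m0}. ?t x m)
       \<bumpeq> exchange_sum x' rs js - (\<Sum>m\<in>{..<length js} - {m0}. ?t x' m)"
    using ex by (intro eqv_diff) (blast intro: eqv_trans eqv_sym)+
  then have tt: "?s * x (insert a (set rs)) * x (set js - {a}) \<bumpeq> ?s * x' (insert a (set rs)) * x' (set js - {a})"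
    unfolding sum t by simp
  have r: "(?s * e) * (?s * e * c) = c" for c
  proof -
    have "(t * e) * (t * e * c) = (t * t) * (e * e) * c" for t by (simp only: mult_ac)
    then show ?thesis by (simp only: s e(3) mult_1_left)
  qed
  have "x (set js - {a}) = (?s * e) * (?s * e * x (set js - {a}))" by (rule r[symmetric])
  also have "\<dots> \<bumpeq> (?s * e) * (?s * x (insert a (set rs)) * x (set js - {a}))"
    by (intro eqv_mult eqv_refl eqv_sym[OF e(1)])
  also have "\<dots> \<bumpeq> (?s * e) * (?s * x' (insert a (set rs)) * x' (set js - {a}))"
    by (intro eqv_mult[OF eqv_refl tt])
  also have "\<dots> \<bumpeq> (?s * e) * (?s * e * x' (set js - {a}))"
    by (intro eqv_mult eqv_refl e(2))
  also have "\<dots> = x' (set js - {a})" by (rule r)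
  finally show ?thesis .
qed

definition exchange_mod :: "nat \<Rightarrow> (nat set \<Rightarrow> 'r) \<Rightarrow> bool" where
  "exchange_mod n x \<longleftrightarrow>
    (\<forall>d rs js. d \<in> {1..<n} \<longrightarrow> rs \<in> incr_seqs n (d - 1) \<longrightarrow>
       js \<in> incr_seqs n (d + 1) \<or> d + 2 \<le> n \<and> js \<in> incr_seqs n (d + 2) \<longrightarrow> exchange_sum x rs js \<bumpeq> 0)"

text \<open>A coordinate with two or more indices outside \<open>w ` {..<d}\<close> is reduced by a Pluecker
  relation to coordinates with fewer; one with a single such index is reduced by an incidence
  relation to dimension \<open>d - 1\<close>.\<close>
lemma exchange_mod_unique:
  assumes w: "w permutes {..<n}"
    and ex: "exchange_mod n x" "exchange_mod n x'"
    and norm: "\<And>d. d \<in> {1..<n} \<Longrightarrow> antisym_ext x (map w [0..<d]) \<bumpeq> 1"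
      "\<And>d. d \<in> {1..<n} \<Longrightarrow> antisym_ext x' (map w [0..<d]) \<bumpeq> 1"
    and base: "\<And>k b. Suc k < n \<Longrightarrow> b < n \<Longrightarrow> b \<notin> w ` {..<Suc k} \<Longrightarrow>
      x (insert b (w ` {..<k})) \<bumpeq> x' (insert b (w ` {..<k}))"
    and I: "d \<in> {1..<n}" "I \<in> subsets_of_size n d"
  shows "x I \<bumpeq> x' I"
proof -
  have inj: "inj w" using w by (rule permutes_inj)
  have wlt: "w i < n \<longleftrightarrow> i < n" for i using permutes_in_image[OF w] by simp
  let ?W = "\<lambda>d. w ` {..<d}"
  have W: "finite (?W d)" "card (?W d) = d" for d
    by (simp_all add: card_image inj_on_subset[OF inj])
  have Wn: "?W d \<subseteq> {..<n}" if "d \<le> n" for d using that wlt by fastforce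
  have incr: "sorted_list_of_set S \<in> incr_seqs n d" if "S \<subseteq> {..<n}" "card S = d" for S d
    using that finite_subset[OF that(1)] by (simp add: incr_seqs_def)
  have dist: "distinct (map w [0..<d])" for d
    using inj by (simp add: distinct_map inj_on_subset[OF inj])
  have sw: "set (map w [0..<d]) = ?W d" for d by (simp add: lessThan_atLeast0)
  \<comment> \<open>The normalisation concerns the sequence \<open>w 0, ..., w (d - 1)\<close>,
    whereas \<open>x\<close> takes sets; the two differ by this sign.\<close>
  define e where "e = (\<lambda>d. (- 1) ^ card (inversions (map w [0..<d])) :: 'r)"
  have e1: "e d * e d = 1" for d
    by (simp add: e_def power_mult_distrib[symmetric])
  have unit: "y (?W d) \<bumpeq> e d" if "antisym_ext y (map w [0..<d]) \<bumpeq> 1" for y d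
  proof -
    have "y (?W d) = e d * (e d * y (?W d))" using e1[of d] by (simp add: mult.assoc[symmetric])
    also have "e d * y (?W d) = antisym_ext y (map w [0..<d])"
      using dist[of d] sw[of d] by (simp add: antisym_ext_def e_def)
    also have "e d * antisym_ext y (map w [0..<d]) \<bumpeq> e d * 1"
      by (rule eqv_mult[OF eqv_refl that])
    finally show ?thesis by simp
  qed
  have u: "x (?W d) \<bumpeq> e d" "x' (?W d) \<bumpeq> e d" if "d \<in> {1..<n}" for d
    using unit norm that by blast+
  have top: "x (?W d) \<bumpeq> x' (?W d)" if "d \<in> {1..<n}" for d
    using u[OF that] by (blast intro: eqv_trans eqv_sym)
  \<comment> \<open>Exactly one index lies outside \<open>?W d\<close>: \<open>w k\<close> is
    replaced by \<open>b\<close>. The induction on \<open>d\<close> starts effectively at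
    \<open>d = k + 1\<close>, where the claim is the hypothesis \<open>base\<close>.\<close>
  have one: "x (insert b (?W d - {w k})) \<bumpeq> x' (insert b (?W d - {w k}))"
    if "d \<in> {1..<n}" "k < d" "b < n" "b \<notin> ?W d" for d k b
    using that
  proof (induction d arbitrary: b)
    case (Suc d)
    show ?case
    proof (cases "k = d")
      case True
      then have "?W (Suc d) - {w k} = ?W d"
        using inj by (auto simp: lessThan_Suc inj_eq)
      then show ?thesis using base[of d b] Suc.prems by simp
    next
      case False
      then have k: "k < d" and d: "d \<in> {1..<n}" and Sd: "Suc d \<in> {1..<n}" using Suc.prems by auto
      have b: "b \<notin> ?W d" "b \<noteq> w d" using Suc.prems by auto
      define S where "S = ?W d - {w k}"
      define T where "T = insert b (?W (Suc d))"
      have S: "S \<subseteq> {..<n}" "card S = d - 1" "finite S"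
        using Wn[of d] d k W by (auto simp: S_def)
      have wd: "w d \<notin> ?W d" using inj by (auto simp: inj_eq)
      have T: "T \<subseteq> {..<n}" "card T = d + 2" "finite T"
        using Wn[of "Suc d"] Suc.prems W[of "Suc d"] by (auto simp: T_def)
      have insS: "insert (w k) S = ?W d" using k by (auto simp: S_def)
      have wk: "w k \<in> T" "w k \<notin> S" using Suc.prems by (auto simp: S_def T_def)
      have Tw: "T - {w k} = insert b (?W (Suc d) - {w k})" using Suc.prems by (auto simp: T_def)
      \<comment> \<open>The incidence relation for \<open>S\<close> and \<open>T\<close>, solved for
        the exchange of \<open>w k\<close>. Only \<open>w d\<close> and \<open>b\<close> remain to
        be exchanged: the former leaves a coordinate from \<open>base\<close>, the latter the
        normalised one of \<open>?W (Suc d)\<close>; the induction hypothesis covers their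
        partners.\<close>
      have "x (set (sorted_list_of_set T) - {w k}) \<bumpeq> x' (set (sorted_list_of_set T) - {w k})"
      proof (rule exchange_solve[where e = "e d" and rs = "sorted_list_of_set S"])
        have "d + 2 \<le> n" using Suc.prems by auto
        then show "exchange_sum x (sorted_list_of_set S) (sorted_list_of_set T) \<bumpeq> 0"
          "exchange_sum x' (sorted_list_of_set S) (sorted_list_of_set T) \<bumpeq> 0"
          using ex d incr[OF S(1,2)] incr[OF T(1,2)] unfolding exchange_mod_def by blast+
      next
        fix c assume "c \<in> set (sorted_list_of_set T)" "c \<noteq> w k" "c \<notin> set (sorted_list_of_set S)"
        then have "c \<in> T" "c \<notin> S" "c \<noteq> w k" using T(3) S(3) by simp_all
        then have "c = w d \<or> c = b" by (auto simp: T_def S_def lessThan_Suc)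
        then have "x (insert c S) \<bumpeq> x' (insert c S) \<and> x (T - {c}) \<bumpeq> x' (T - {c})"
        proof
          assume c: "c = w d"
          have "T - {w d} = insert b (?W d)" 
            using b wd unfolding T_def lessThan_Suc image_insert by blast
          moreover have "w d < n" using wlt d by simp
          ultimately show ?thesis
            unfolding c S_def using Suc.IH[OF d k _ wd] base[of d b] Suc.prems by simp
        next
          assume c: "c = b"
          have "T - {b} = ?W (Suc d)" using Suc.prems by (auto simp: T_def)
          then show ?thesis
            unfolding c S_def using Suc.IH[OF d k _ b(1)] top[OF Sd] Suc.prems(3) by simp
        qed
        then show "x (insert c (set (sorted_list_of_set S))) \<bumpeq> x' (insert c (set (sorted_list_of_set S))) \<and>
          x (set (sorted_list_of_set T) - {c}) \<bumpeq> x' (set (sorted_list_of_set T) - {c})"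
          using S T by simp
      qed (use S T wk insS u[OF d] e1 in auto)
      then show ?thesis using T Tw by simp
    qed
  qed simp
  show ?thesis
    using I(2)
  proof (induction "card (I - ?W d)" arbitrary: I rule: less_induct)
    case less
    then have I': "I \<subseteq> {..<n}" "card I = d" "finite I"
      by (auto simp: subsets_of_size_def intro: finite_subset)
    have cc: "card (?W d - I) = card (I - ?W d)"
      using card_Diff_subset_Int[of "?W d" I] card_Diff_subset_Int[of I "?W d"] I' W[of d]
      by (simp add: Int_commute)
    show ?case
    proof (cases "I = ?W d")
      case False
      then have "\<not> I \<subseteq> ?W d" using card_subset_eq[OF W(1), of I d] I' W(2) by auto
      then obtain b where b: "b \<in> I" "b \<notin> ?W d" by blast
      then have "card (I - ?W d) > 0" using I' by (auto simp: card_gt_0_iff)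
      then have "?W d - I \<noteq> {}" using cc by (metis card.empty less_numeral_extra(3))
      then obtain k where k: "k < d" "w k \<notin> I" by auto
      show ?thesis
      proof (cases "I - ?W d = {b}")
        case True
        then have "card (?W d - I) = 1" using cc by simp
        then obtain a where "?W d - I = {a}" by (auto simp: card_1_singleton_iff)
        then have "?W d - I = {w k}" using k by auto
        then have "I = insert b (?W d - {w k})" using True b by auto
        then show ?thesis using one[OF I(1) k(1)] b I' by auto
      next
        case two: False
        define S where "S = ?W d - {w k}"
        define T where "T = insert (w k) I"
        have S: "S \<subseteq> {..<n}" "card S = d - 1" "finite S"
          using Wn[of d] I k W by (auto simp: S_def)
        have T: "T \<subseteq> {..<n}" "card T = d + 1" "finite T"
          using Wn[of d] I(1) k I' by (auto simp: T_def)
        have insS: "insert (w k) S = ?W d" using k by (auto simp: S_def)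
        have Tw: "T - {w k} = I" using k by (auto simp: T_def)
        have wk: "w k \<in> T" "w k \<notin> S" by (auto simp: T_def S_def)
        \<comment> \<open>The Pluecker relation for \<open>S\<close> and \<open>T\<close>, solved
          for the exchange of \<open>w k\<close>. Any other \<open>c\<close> that counts lies in
          \<open>I\<close> but outside \<open>?W d\<close>; it gives one coordinate with a single
          index outside and one with fewer indices outside than \<open>I\<close>.\<close>
        have "x (set (sorted_list_of_set T) - {w k}) \<bumpeq> x' (set (sorted_list_of_set T) - {w k})"
        proof (rule exchange_solve[where e = "e d" and rs = "sorted_list_of_set S"])
          show "exchange_sum x (sorted_list_of_set S) (sorted_list_of_set T) \<bumpeq> 0"
            "exchange_sum x' (sorted_list_of_set S) (sorted_list_of_set T) \<bumpeq> 0"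
            using ex I(1) incr[OF S(1,2)] incr[OF T(1,2)] unfolding exchange_mod_def by blast+
        next
          fix c assume c: "c \<in> set (sorted_list_of_set T)" "c \<noteq> w k" "c \<notin> set (sorted_list_of_set S)"
          then have "c \<in> T" "c \<notin> S" using T(3) S(3) by simp_all
          with c(2) have cI: "c \<in> I" "c \<notin> ?W d" by (auto simp: T_def S_def)
          have 1: "x (insert c S) \<bumpeq> x' (insert c S)"
            unfolding S_def using one[OF I(1) k(1)] cI I' by auto
          have "T - {c} \<in> subsets_of_size n d"
            using T cI I' by (auto simp: subsets_of_size_def T_def)
          moreover have "T - {c} - ?W d = (I - ?W d) - {c}" using k by (auto simp: T_def)
          then have "card (T - {c} - ?W d) < card (I - ?W d)"
            using cI I' by (simp only:) (intro card_Diff1_less, auto)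
          ultimately have "x (T - {c}) \<bumpeq> x' (T - {c})" using less.hyps by blast
          with 1 show "x (insert c (set (sorted_list_of_set S))) \<bumpeq> x' (insert c (set (sorted_list_of_set S))) \<and>
            x (set (sorted_list_of_set T) - {c}) \<bumpeq> x' (set (sorted_list_of_set T) - {c})"
            using S T by simp
        qed (use S T wk insS u[OF I(1)] e1 in auto)
        then show ?thesis using T Tw by simp
      qed
    qed (use top[OF I(1)] in simp)
  qed
qed

end

section \<open>The polynomials P\<close>

lemma coeff_prod_linear:
  fixes f :: "'i \<Rightarrow> 'r::comm_ring_1 poly"
  assumes "finite A" "\<And>i. i \<in> A \<Longrightarrow> degree (f i) \<le> 1"
  shows "degree (prod f A) \<le> card A \<and> coeff (prod f A) (card A) = (\<Prod>i\<in>A. coeff (f i) 1)"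
  using assms
proof (induction A rule: finite_induct)
  case (insert a A)
  then have IH: "degree (prod f A) \<le> card A" "coeff (prod f A) (card A) = (\<Prod>i\<in>A. coeff (f i) 1)"
    and da: "degree (f a) \<le> 1" by auto
  have "degree (f a * prod f A) \<le> degree (f a) + degree (prod f A)" by (rule degree_mult_le)
  also have "\<dots> \<le> Suc (card A)" using IH(1) da by simp
  finally have d: "degree (f a * prod f A) \<le> Suc (card A)" .
  have fa: "f a = [:coeff (f a) 0, coeff (f a) 1:]"
    using da by (intro poly_eqI) (auto simp: coeff_pCons coeff_eq_0 split: nat.split)
  have "coeff (f a * prod f A) (Suc (card A)) = coeff (f a) 1 * coeff (prod f A) (card A)"
    by (subst fa) (use IH(1) in \<open>simp add: coeff_eq_0\<close>)
  with d show ?case using insert.hyps IH(2) by simp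
qed simp

text \<open>Each Leibniz term is a product of \<open>d\<close> factors of degree at most 1, whose
  coefficient at lambda^d is the product of their coefficients at lambda.\<close>

lemma det_linear_poly:
  assumes M: "M \<in> carrier_mat d d" and deg: "\<And>i j. i < d \<Longrightarrow> j < d \<Longrightarrow> degree (M $$ (i, j)) \<le> 1"
  shows "degree (det M) \<le> d" "coeff (det M) d = det (map_mat (\<lambda>p. coeff p 1) M)"
proof -
  let ?P = "{p. p permutes {0..<d}}"
  have p: "degree (\<Prod>i = 0..<d. M $$ (i, p i)) \<le> d \<and>
      coeff (\<Prod>i = 0..<d. M $$ (i, p i)) d = (\<Prod>i = 0..<d. coeff (M $$ (i, p i)) 1)" if "p \<in> ?P" for p
    using coeff_prod_linear[of "{0..<d}" "\<lambda>i. M $$ (i, p i)"] that deg permutes_in_image[of p "{0..<d}"] by auto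
  have D: "det M = (\<Sum>p\<in>?P. smult (signof p) (\<Prod>i = 0..<d. M $$ (i, p i)))"
    unfolding det_def'[OF M] by (intro sum.cong refl) (simp add: sign_def)
  show "degree (det M) \<le> d"
    unfolding D by (intro degree_sum_le) (use p degree_smult_le order_trans in \<open>blast intro: finite_permutations\<close>)+
  have "coeff (det M) d = (\<Sum>p\<in>?P. signof p * (\<Prod>i = 0..<d. coeff (M $$ (i, p i)) 1))"
    unfolding D coeff_sum by (intro sum.cong refl) (simp add: p)
  also have "\<dots> = det (map_mat (\<lambda>p. coeff p 1) M)"
    using M permutes_in_image by (subst det_def'[of _ d])
      (auto intro!: sum.cong prod.cong arg_cong2[of _ _ _ _ "(*)"])
  finally show "coeff (det M) d = det (map_mat (\<lambda>p. coeff p 1) M)" .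
qed

text \<open>Exterior powers of the identity are identities. If \<open>I\<close> and \<open>J\<close>
  differ, some row has its 1 in a column outside \<open>J\<close>, so every Leibniz term
  vanishes.\<close>

lemma minor_one:
  assumes "I \<in> subsets_of_size n d" "J \<in> subsets_of_size n d"
  shows "minor (1\<^sub>m n) I J = (if I = J then 1 else (0::'a::comm_ring_1))"
proof -
  have f: "finite I" "finite J" and c: "card I = d" "card J = d" and s: "I \<subseteq> {..<n}" "J \<subseteq> {..<n}"
    using assms by (auto simp: subsets_of_size_def intro: finite_subset)
  let ?s = "sorted_list_of_set I" and ?t = "sorted_list_of_set J"
  have lt: "?s ! i < n" "?t ! i < n" if "i < d" for i
    using that f c s nth_mem[of i ?s] nth_mem[of i ?t] by auto
  have m: "minor (1\<^sub>m n :: 'a mat) I J = det (mat d d (\<lambda>(i, j). if ?s ! i = ?t ! j then 1 else 0))"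
    using f c s lt by (subst minor_rc_det)
      (auto simp: rc_det_def intro!: arg_cong[of _ _ det] eq_matI)
  show ?thesis
  proof (cases "I = J")
    case True
    have "mat d d (\<lambda>(i, j). if ?s ! i = ?s ! j then 1 else 0) = (1\<^sub>m d :: 'a mat)"
      using f c by (intro eq_matI) (auto simp: nth_eq_iff_index_eq)
    then show ?thesis using m True by simp
  next
    case False
    then have "\<not> I \<subseteq> J" using f c card_subset_eq[of J I] by auto
    then obtain a where "a \<in> I" "a \<notin> J" by blast
    then obtain i where i: "i < d" "?s ! i \<notin> J"
      using f c by (metis distinct_sorted_list_of_set in_set_conv_nth set_sorted_list_of_set sorted_list_of_set.length_sorted_key_list_of_set)
    have "?s ! i \<noteq> ?t ! j" if "j < d" for j
      using i that f c nth_mem[of j ?t] by auto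
    then have "(\<Prod>k = 0..<d. if ?s ! k = ?t ! p k then 1 else 0) = (0::'a)" if "p permutes {0..<d}" for p
      using i(1) permutes_in_image[OF that, of i] by (intro prod_zero bexI[of _ i]) auto
    then have "det (mat d d (\<lambda>(i, j). if ?s ! i = ?t ! j then 1 else 0)) = (0::'a)"
      unfolding det_mat_leibniz by (intro sum.neutral) auto
    then show ?thesis using m False by simp
  qed
qed

section \<open>The polynomials P over an arbitrary commutative ring\<close>

definition shift_mat :: "nat \<Rightarrow> 'r::comm_ring_1 mat \<Rightarrow> 'r poly mat" where
  "shift_mat n \<psi> = map_mat (\<lambda>c. [:c:]) \<psi> + [:0, 1:] \<cdot>\<^sub>m 1\<^sub>m n"

text \<open>\<open>P_poly\<close> with values in place of the variables, so that ring homomorphisms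
  and congruences can be applied to it.\<close>

definition P_val :: "nat \<Rightarrow> (nat \<Rightarrow> nat) \<Rightarrow> (nat set \<Rightarrow> 'r::comm_ring_1) \<Rightarrow> 'r mat \<Rightarrow> nat set \<Rightarrow> 'r poly" where
  "P_val n w x \<psi> I =
     (\<Sum>J\<in>subsets_of_size n (card I). minor (shift_mat n \<psi>) I J * [:x J:])
     - (\<Prod>k<card I. [:\<psi> $$ (w k, w k):] + [:0, 1:]) * [:x I:]"

lemma shift_mat_carrier [simp]: "\<psi> \<in> carrier_mat n n \<Longrightarrow> shift_mat n \<psi> \<in> carrier_mat n n"
  by (simp add: shift_mat_def)

lemma finite_subsets_of_size: "finite (subsets_of_size n d)"
  by (rule finite_subset[of _ "Pow {..<n}"]) (auto simp: subsets_of_size_def)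

text \<open>The coefficients of lambda in psi + lambda form the identity matrix, so the top
  coefficient of a minor is a minor of the identity.\<close>

lemma minor_shift_mat:
  assumes \<psi>: "\<psi> \<in> carrier_mat n n" and IJ: "I \<in> subsets_of_size n d" "J \<in> subsets_of_size n d"
  shows "degree (minor (shift_mat n \<psi>) I J) \<le> d"
    "coeff (minor (shift_mat n \<psi>) I J) d = (if I = J then 1 else 0)"
proof -
  let ?S = "submatrix (shift_mat n \<psi>) I J"
  have f: "finite I" "finite J" and c: "card I = d" "card J = d" and s: "I \<subseteq> {..<n}" "J \<subseteq> {..<n}"
    using IJ by (auto simp: subsets_of_size_def intro: finite_subset)
  have cc: "{i. i < n \<and> i \<in> I} = I" "{i. i < n \<and> i \<in> J} = J" using s by auto
  have S: "?S \<in> carrier_mat d d" using \<psi> c by (auto simp: submatrix_def shift_mat_def cc)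
  have pk: "pick I i < n" "pick J i < n" if "i < d" for i
    using that c s pick_in_set_le[of i I] pick_in_set_le[of i J] by auto
  have deg: "degree (?S $$ (i, j)) \<le> 1" "coeff (?S $$ (i, j)) 1 = 1\<^sub>m n $$ (pick I i, pick J j)" if "i < d" "j < d" for i j
    using \<psi> c that pk by (auto simp: submatrix_def shift_mat_def cc)
  show "degree (minor (shift_mat n \<psi>) I J) \<le> d"
    unfolding minor_def by (rule det_linear_poly[OF S deg(1)])
  have "map_mat (\<lambda>p. coeff p 1) ?S = submatrix (1\<^sub>m n) I J"
  proof (rule eq_matI)
    fix i j assume "i < dim_row (submatrix (1\<^sub>m n) I J)" "j < dim_col (submatrix (1\<^sub>m n) I J)"
    then have ij: "i < d" "j < d" using c by (simp_all add: dim_submatrix cc)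
    then show "map_mat (\<lambda>p. coeff p 1) ?S $$ (i, j) = submatrix (1\<^sub>m n) I J $$ (i, j)"
      using S c deg(2)[OF ij] by (simp add: submatrix_index cc)
  qed (use carrier_matD[OF S] c in \<open>simp_all add: dim_submatrix[of "1\<^sub>m n"] cc\<close>)
  then show "coeff (minor (shift_mat n \<psi>) I J) d = (if I = J then 1 else 0)"
    unfolding minor_one[OF IJ, symmetric] minor_def
    using det_linear_poly(2)[OF S deg(1)] by simp
qed

text \<open>The sum and the product term both have \<open>x I\<close> as coefficient of lambda^d,
  the latter because the product is monic. Hence only exponents below \<open>d\<close> carry
  conditions.\<close>

lemma coeff_P_val_eq_0:
  assumes \<psi>: "\<psi> \<in> carrier_mat n n" and I: "I \<in> subsets_of_size n d" and s: "s \<ge> d"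
  shows "coeff (P_val n w x \<psi> I) s = 0"
proof -
  let ?Q = "\<Prod>k<d. [:\<psi> $$ (w k, w k):] + [:0, 1:]"
  have c: "card I = d" using I by (simp add: subsets_of_size_def)
  have Q: "degree ?Q \<le> d" "coeff ?Q d = 1"
    using coeff_prod_linear[of "{..<d}" "\<lambda>k. [:\<psi> $$ (w k, w k):] + [:0, 1:]"] by auto
  show ?thesis
  proof (cases "s = d")
    case True
    have "(\<Sum>J\<in>subsets_of_size n d. coeff (minor (shift_mat n \<psi>) I J) d * x J)
       = (\<Sum>J\<in>subsets_of_size n d. if I = J then x J else 0)"
      by (intro sum.cong refl) (simp add: minor_shift_mat[OF \<psi> I])
    also have "\<dots> = x I" using I finite_subsets_of_size by simp
    finally show ?thesis
      using Q True by (simp add: P_val_def c coeff_sum mult.commute[of _ "pCons _ _"], simp add: mult.commute)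
  next
    case False
    then have "s > d" using s by simp
    then have "coeff (minor (shift_mat n \<psi>) I J) s = 0" if "J \<in> subsets_of_size n d" for J
      using minor_shift_mat(1)[OF \<psi> I that] by (intro coeff_eq_0) simp
    moreover have "coeff ?Q s = 0" using Q \<open>s > d\<close> by (intro coeff_eq_0) simp
    ultimately show ?thesis by (simp add: P_val_def c coeff_sum mult.commute[of _ "pCons _ _"])
  qed
qed

lemma smult_sum_right: "smult c (\<Sum>i\<in>A. f i) = (\<Sum>i\<in>A. smult c (f i))"
  by (induction A rule: infinite_finite_induct) (simp_all add: smult_add_right)

lemma P_val_smult:
  assumes "I \<in> subsets_of_size n d" and "\<And>J. J \<in> subsets_of_size n d \<Longrightarrow> y J = c * x J"
  shows "P_val n w y \<psi> I = smult c (P_val n w x \<psi> I)"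
proof -
  have "card I = d" using assms by (simp add: subsets_of_size_def)
  moreover have "[:c * a:] = smult c [:a:]" for a by simp
  ultimately show ?thesis
    unfolding P_val_def using assms by (simp add: smult_diff_right smult_sum_right)
qed

lemma (in comm_ring_hom) hom_minor: "hom (minor M I J) = minor (map_mat hom M) I J"
proof -
  have "I' < card I" if "I' < card {i. i < dim_row M \<and> i \<in> I}" "finite I" for I' I
    by (rule less_le_trans[OF that(1) card_mono[OF that(2)]]) auto
  have "map_mat hom (submatrix M I J) = submatrix (map_mat hom M) I J"
    by (rule eq_matI) (auto simp: submatrix_def pick_le)
  then show ?thesis by (simp add: minor_def flip: hom_det)
qed

lemma (in comm_ring_hom) map_poly_P_val:
  assumes "\<psi> \<in> carrier_mat n n" and "\<And>k. k < card I \<Longrightarrow> w k < n"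
  shows "map_poly hom (P_val n w x \<psi> I) = P_val n w (hom \<circ> x) (map_mat hom \<psi>) I"
proof -
  interpret mp: map_poly_comm_ring_hom hom ..
  have "map_mat (map_poly hom) (shift_mat n \<psi>) = shift_mat n (map_mat hom \<psi>)"
    using assms(1) by (intro eq_matI) (auto simp: shift_mat_def hom_distribs)
  then show ?thesis using assms
    by (simp add: P_val_def hom_distribs mp.hom_minor)
qed

section \<open>Evaluation of polynomials\<close>

definition mono_eval :: "(coord \<Rightarrow> 'a::comm_ring_1) \<Rightarrow> (coord \<Rightarrow>\<^sub>0 nat) \<Rightarrow> 'a" where
  "mono_eval p m = (\<Prod>v\<in>Poly_Mapping.keys m. p v ^ Poly_Mapping.lookup m v)"

definition const :: "'a::comm_ring_1 \<Rightarrow> 'a mpol" where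
  "const = Poly_Mapping.single 0"

lemma mono_eval_superset:
  "finite A \<Longrightarrow> Poly_Mapping.keys m \<subseteq> A \<Longrightarrow> mono_eval p m = (\<Prod>v\<in>A. p v ^ Poly_Mapping.lookup m v)"
  unfolding mono_eval_def
  by (rule prod.mono_neutral_left) (auto simp: in_keys_iff)

lemma mono_eval_add: "mono_eval p (m + m') = mono_eval p m * mono_eval p m'"
proof -
  let ?A = "Poly_Mapping.keys m \<union> Poly_Mapping.keys m'"
  have "Poly_Mapping.keys (m + m') \<subseteq> ?A" by (rule keys_add)
  then show ?thesis
    by (simp add: mono_eval_superset[of ?A] lookup_add power_add prod.distrib)
qed

lemma mono_eval_0 [simp]: "mono_eval p 0 = 1"
  by (simp add: mono_eval_def)

lemma mono_eval_single [simp]: "mono_eval p (Poly_Mapping.single v (Suc 0)) = p v"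
  by (simp add: mono_eval_def)

lemma mono_eval_mult: "mono_eval (\<lambda>v. p v * q v) m = mono_eval p m * mono_eval q m"
  by (simp add: mono_eval_def power_mult_distrib prod.distrib)

lemma meval_superset:
  assumes "finite A" "Poly_Mapping.keys f \<subseteq> A" "h 0 = 0"
  shows "meval h p f = (\<Sum>m\<in>A. h (Poly_Mapping.lookup f m) * mono_eval p m)"
  unfolding meval_def mono_eval_def[symmetric]
  by (rule sum.mono_neutral_left) (use assms in \<open>auto simp: in_keys_iff\<close>)

lemma meval_single: "h 0 = 0 \<Longrightarrow> meval h p (Poly_Mapping.single m a) = h a * mono_eval p m"
  by (subst meval_superset[of "{m}"]) auto

lemma poly_mapping_eq_sum_single:
  "f = (\<Sum>m\<in>Poly_Mapping.keys f. Poly_Mapping.single m (Poly_Mapping.lookup f m))"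
  by (rule poly_mapping_eqI)
    (auto simp: lookup_sum lookup_single when_def in_keys_iff sum.delta)

lemma comm_ring_hom_meval:
  assumes "comm_ring_hom h"
  shows "comm_ring_hom (meval h p)"
proof -
  interpret comm_ring_hom h by fact
  have add: "meval h p (f + g) = meval h p f + meval h p g" for f g
  proof -
    let ?A = "Poly_Mapping.keys f \<union> Poly_Mapping.keys g"
    have "Poly_Mapping.keys (f + g) \<subseteq> ?A" by (rule keys_add)
    then show ?thesis
      by (simp add: meval_superset[of ?A] lookup_add hom_add distrib_right sum.distrib)
  qed
  have zero: "meval h p 0 = 0" by (simp add: meval_def)
  have sum: "meval h p (sum F A) = (\<Sum>i\<in>A. meval h p (F i))" for F :: "'i \<Rightarrow> _" and A
    by (induction A rule: infinite_finite_induct) (simp_all add: add zero)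
  have mult: "meval h p (f * g) = meval h p f * meval h p g" for f g
  proof -
    let ?s = "\<lambda>f m. Poly_Mapping.single m (Poly_Mapping.lookup f m)"
    have "f * g = (\<Sum>m\<in>Poly_Mapping.keys f. ?s f m) * (\<Sum>m\<in>Poly_Mapping.keys g. ?s g m)"
      by (simp flip: poly_mapping_eq_sum_single)
    also have "\<dots> = (\<Sum>m\<in>Poly_Mapping.keys f. \<Sum>m'\<in>Poly_Mapping.keys g. ?s f m * ?s g m')"
      by (rule sum_product)
    finally have "meval h p (f * g) =
        (\<Sum>m\<in>Poly_Mapping.keys f. \<Sum>m'\<in>Poly_Mapping.keys g. meval h p (?s f m) * meval h p (?s g m'))"
      by (simp add: sum mult_single meval_single mono_eval_add hom_mult mult_ac)
    also have "\<dots> = meval h p (\<Sum>m\<in>Poly_Mapping.keys f. ?s f m) * meval h p (\<Sum>m\<in>Poly_Mapping.keys g. ?s g m)"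
      by (simp add: sum sum_product)
    finally show ?thesis by (simp flip: poly_mapping_eq_sum_single)
  qed
  have one: "meval h p 1 = 1"
    using meval_single[of h p 0 1] by simp
  show ?thesis by unfold_locales (rule add mult one zero)+
qed

lemma meval_mvar: "h 0 = 0 \<Longrightarrow> h 1 = 1 \<Longrightarrow> meval h p (mvar v) = p v"
  by (simp add: mvar_def meval_single)

lemma (in comm_ring_hom) hom_meval: "hom (meval h p f) = meval (hom \<circ> h) (hom \<circ> p) f"
  by (simp add: meval_def hom_distribs)

lemma meval_cong:
  assumes "\<And>m v. m \<in> Poly_Mapping.keys f \<Longrightarrow> v \<in> Poly_Mapping.keys m \<Longrightarrow> p v = q v"
  shows "meval h p f = meval h q f"
  unfolding meval_def by (auto intro!: sum.cong prod.cong arg_cong2[of _ _ _ _ "(*)"] simp: assms)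

lemma comm_ring_hom_const: "comm_ring_hom const"
  by unfold_locales (simp_all add: const_def single_add mult_single)

lemma mono_eval_mvar: "mono_eval mvar m = Poly_Mapping.single m (1::'a::comm_ring_1)"
proof -
  have pow: "mvar v ^ e = Poly_Mapping.single (Poly_Mapping.single v e) (1::'a)" for v e
    by (induction e) (simp_all add: mvar_def mult_single single_add[symmetric])
  have "(\<Prod>v\<in>A. Poly_Mapping.single (g v) (1::'a)) = Poly_Mapping.single (\<Sum>v\<in>A. g v) 1"
    if "finite A" for A :: "coord set" and g :: "coord \<Rightarrow> coord \<Rightarrow>\<^sub>0 nat"
    using that by (induction A rule: finite_induct) (simp_all add: mult_single)
  then show ?thesis
    by (simp add: mono_eval_def pow flip: poly_mapping_eq_sum_single)
qed

text \<open>Each polynomial is its own value at the generic point, so comparing it with the result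
  of a substitution reduces to comparing variables.\<close>

lemma meval_const_mvar: "meval const mvar f = f"
proof -
  have "meval const mvar f = (\<Sum>m\<in>Poly_Mapping.keys f. Poly_Mapping.single m (Poly_Mapping.lookup f m))"
    unfolding meval_def mono_eval_def[symmetric] mono_eval_mvar by (simp add: const_def mult_single)
  then show ?thesis by (simp flip: poly_mapping_eq_sum_single)
qed

lemma meval_base_change:
  assumes "comm_ring_hom h"
  shows "meval h p (base_change f) = meval of_int p f"
proof -
  interpret comm_ring_hom h by fact
  have "Poly_Mapping.keys (base_change f :: 'a mpol) \<subseteq> Poly_Mapping.keys f"
    by (auto simp: base_change_def in_keys_iff map.rep_eq when_def)
  then have "meval h p (base_change f :: 'a mpol) = (\<Sum>m\<in>Poly_Mapping.keys f.
      h (Poly_Mapping.lookup (base_change f) m) * mono_eval p m)"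
    by (intro meval_superset) auto
  also have "\<dots> = meval of_int p f"
    unfolding meval_def mono_eval_def[symmetric]
    by (intro sum.cong refl) (simp add: base_change_def map.rep_eq when_def hom_of_int)
  finally show ?thesis .
qed

lemma base_change_eq_meval: "base_change f = meval of_int mvar f"
  using meval_base_change[OF comm_ring_hom_const, of mvar f] by (simp add: meval_const_mvar)

section \<open>Polynomials with only zero values\<close>

text \<open>Take 2 at a variable where the exponents differ and 1 elsewhere.\<close>

lemma mono_eval_separates:
  assumes "m \<noteq> m'" and "inj (\<lambda>k. (2::'a::field) ^ k)"
  shows "\<exists>p :: coord \<Rightarrow> 'a. mono_eval p m \<noteq> mono_eval p m'"
proof -
  obtain v where v: "Poly_Mapping.lookup m v \<noteq> Poly_Mapping.lookup m' v"
    using assms(1) by (meson poly_mapping_eqI)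
  let ?p = "\<lambda>u. if u = v then 2 else 1 :: 'a"
  have "mono_eval ?p l = 2 ^ Poly_Mapping.lookup l v" for l
  proof -
    have "mono_eval ?p l = (\<Prod>u\<in>insert v (Poly_Mapping.keys l). ?p u ^ Poly_Mapping.lookup l u)"
      by (rule mono_eval_superset) auto
    also have "\<dots> = 2 ^ Poly_Mapping.lookup l v * (\<Prod>u\<in>insert v (Poly_Mapping.keys l) - {v}. ?p u ^ Poly_Mapping.lookup l u)"
      by (subst prod.remove[of _ v]) auto
    also have "(\<Prod>u\<in>insert v (Poly_Mapping.keys l) - {v}. ?p u ^ Poly_Mapping.lookup l u) = 1"
      by (rule prod.neutral) auto
    finally show ?thesis by simp
  qed
  then have "mono_eval ?p m \<noteq> mono_eval ?p m'" using v assms(2) by (auto dest: injD)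
  then show ?thesis by blast
qed

text \<open>Dedekind's independence of characters.\<close>
lemma mono_eval_independent:
  fixes c :: "(coord \<Rightarrow>\<^sub>0 nat) \<Rightarrow> 'a::field"
  assumes "finite M" and inj: "inj (\<lambda>k. (2::'a) ^ k)"
    and "\<And>p. (\<Sum>m\<in>M. c m * mono_eval p m) = 0"
  shows "\<forall>m\<in>M. c m = 0"
  using assms(1,3)
proof (induction M arbitrary: c rule: finite_induct)
  case (insert m0 M)
  have "c m = 0" if m: "m \<in> M" for m
  proof -
    have "m \<noteq> m0" using m insert.hyps by auto
    then obtain q :: "coord \<Rightarrow> 'a" where q: "mono_eval q m \<noteq> mono_eval q m0"
      using mono_eval_separates[OF _ inj] by blast
    \<comment> \<open>Evaluate at the product of \<open>p\<close> and \<open>q\<close> and subtract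
      \<open>mono_eval q m0\<close> times the relation at \<open>p\<close>: the term of
      \<open>m0\<close> cancels and a shorter relation remains.\<close>
    have "(\<Sum>m\<in>M. c m * (mono_eval q m - mono_eval q m0) * mono_eval p m) = 0" for p
    proof -
      have "(\<Sum>m\<in>insert m0 M. c m * mono_eval (\<lambda>v. p v * q v) m)
          - mono_eval q m0 * (\<Sum>m\<in>insert m0 M. c m * mono_eval p m) = 0"
        by (simp only: insert.prems) simp
      then show ?thesis using insert.hyps
        by (simp add: mono_eval_mult sum_distrib_left sum_subtractf[symmetric] algebra_simps)
    qed
    then have "\<forall>m\<in>M. c m * (mono_eval q m - mono_eval q m0) = 0" by (rule insert.IH)
    then show ?thesis using q m by auto
  qed
  moreover have "c m0 * mono_eval (\<lambda>_. 1) m0 = 0"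
    using insert.prems[of "\<lambda>_. 1"] insert.hyps calculation by simp
  then have "c m0 = 0" by (simp add: mono_eval_def)
  ultimately show ?case by auto
qed simp

lemma meval_zero_imp_zero:
  fixes h :: "'k::field_char_0 \<Rightarrow> 'a::field"
  assumes "field_hom h" and "\<And>p. meval h p f = 0"
  shows "f = 0"
proof -
  interpret field_hom h by fact
  \<comment> \<open>Characteristic 0 of the coefficient field makes the powers of 2 distinct there,
    and the embedding \<open>h\<close> preserves this.\<close>
  have "inj (\<lambda>k. (2::'a) ^ k)"
  proof (rule injI)
    fix i j assume "(2::'a) ^ i = 2 ^ j"
    then have "h (2 ^ i) = h (2 ^ j)" by (simp add: hom_distribs)
    then have "real_of_rat (of_nat (2 ^ i)) = real_of_rat (of_nat (2 ^ j))"
      by (metis injectivity of_nat_eq_iff of_nat_numeral of_nat_power)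
    then show "i = j" by simp
  qed
  then have "\<forall>m\<in>Poly_Mapping.keys f. h (Poly_Mapping.lookup f m) = 0"
    by (rule mono_eval_independent[rotated])
      (use assms(2) in \<open>simp_all add: meval_def mono_eval_def\<close>)
  then show ?thesis by (intro poly_mapping_eqI) (auto simp: in_keys_iff)
qed

section \<open>Values of the equations at a point\<close>

lemma comm_ring_hom_of_int: "comm_ring_hom (of_int :: int \<Rightarrow> 'a::comm_ring_1)"
  by unfold_locales simp_all

lemma comm_ring_hom_meval_int: "comm_ring_hom (meval (of_int :: int \<Rightarrow> 'a::comm_ring_1) p)"
  by (rule comm_ring_hom_meval[OF comm_ring_hom_of_int])

lemma (in comm_ring_hom) hom_antisym_ext: "hom (antisym_ext x js) = antisym_ext (hom \<circ> x) js"
  by (simp add: antisym_ext_def hom_distribs)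

lemma (in comm_ring_hom) hom_exchange_sum:
  "hom (exchange_sum x rs js) = exchange_sum (hom \<circ> x) rs js"
  by (simp add: exchange_sum_def hom_distribs hom_antisym_ext del: power_Suc)

lemma meval_xs_sym: "meval of_int p (xs_sym js) = antisym_ext (\<lambda>I. p (XC I)) js"
proof -
  interpret comm_ring_hom "meval of_int p" by (rule comm_ring_hom_meval_int)
  show ?thesis by (simp add: hom_antisym_ext comp_def meval_mvar)
qed

lemma meval_exchange_rel: "meval of_int p (exchange_rel rs js) = exchange_sum (\<lambda>I. p (XC I)) rs js"
proof -
  interpret comm_ring_hom "meval of_int p" by (rule comm_ring_hom_meval_int)
  have "exchange_rel rs js = exchange_sum (\<lambda>I. mvar (XC I)) rs js"
    by (simp add: exchange_rel_def exchange_sum_def)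
  then show ?thesis by (simp add: hom_exchange_sum comp_def meval_mvar)
qed

definition generic_mat :: "nat \<Rightarrow> 'a::comm_ring_1 mpol mat" where
  "generic_mat n = mat n n (\<lambda>(k, l). if k < l then mvar (UC k l) else if k = l then mvar (TC k) else 0)"

lemma u_plus_lambda_eq: "u_plus_lambda n = shift_mat n (generic_mat n)"
  unfolding u_plus_lambda_def shift_mat_def generic_mat_def
  by (rule arg_cong2[of _ _ _ _ "(+)"]) (auto intro!: eq_matI)

lemma P_poly_eq:
  assumes "\<And>k. k < card I \<Longrightarrow> w k < n"
  shows "P_poly n w I = P_val n w (\<lambda>I. mvar (XC I)) (generic_mat n) I"
  using assms by (simp add: P_poly_def P_val_def u_plus_lambda_eq generic_mat_def)

lemma meval_P_poly:
  assumes I: "\<And>k. k < card I \<Longrightarrow> w k < n"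
    and \<psi>: "\<psi> \<in> carrier_mat n n" "upper_triangular \<psi>"
    and p: "\<And>k l. k < l \<Longrightarrow> l < n \<Longrightarrow> p (UC k l) = \<psi> $$ (k, l)" "\<And>m. m < n \<Longrightarrow> p (TC m) = \<psi> $$ (m, m)"
  shows "meval of_int p (coeff (P_poly n w I) s) = coeff (P_val n w (\<lambda>I. p (XC I)) \<psi> I) s"
proof -
  interpret comm_ring_hom "meval of_int p" by (rule comm_ring_hom_meval_int)
  have "map_mat (meval of_int p) (generic_mat n) = \<psi>"
    using \<psi> by (intro eq_matI) (auto simp: generic_mat_def meval_mvar p upper_triangular_def)
  moreover have "generic_mat n \<in> carrier_mat n n" by (simp add: generic_mat_def)
  ultimately have "map_poly (meval of_int p) (P_poly n w I) = P_val n w (\<lambda>I. p (XC I)) \<psi> I"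
    using map_poly_P_val[of "generic_mat n" n I w "\<lambda>I. mvar (XC I)"] I
    by (simp add: P_poly_eq comp_def meval_mvar)
  then show ?thesis by (metis coeff_map_poly_hom)
qed

lemma P_poly_expansion:
  assumes "w permutes {..<n}" "d \<in> {1..<n}" "I \<in> subsets_of_size n d"
  shows "P_poly n w I = (\<Sum>s<d. monom (coeff (P_poly n w I) s) s)"
proof -
  have w: "w k < n" if "k < card I" for k
    using that assms permutes_in_image[OF assms(1), of k] by (simp add: subsets_of_size_def)
  have eq: "P_poly n w I = P_val n w (\<lambda>I. mvar (XC I)) (generic_mat n) I"
    by (rule P_poly_eq) (rule w)
  have "coeff (P_poly n w I) s = 0" if "s \<ge> d" for s
    unfolding eq by (rule coeff_P_val_eq_0[OF _ assms(3) that]) (simp add: generic_mat_def)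
  then show ?thesis
    by (intro poly_eqI) (auto simp: coeff_sum coeff_monom sum.delta)
qed

section \<open>Coordinates of the Schubert cell\<close>

lemma det_lower_unit_last:
  assumes M: "M \<in> carrier_mat (Suc k) (Suc k)"
    and "\<And>i j. i < j \<Longrightarrow> j \<le> k \<Longrightarrow> M $$ (i, j) = 0" and "\<And>i. i < k \<Longrightarrow> M $$ (i, i) = 1"
  shows "det M = (M $$ (k, k) :: 'r::comm_ring_1)"
proof -
  have "det M = prod_list (diag_mat M)"
    by (rule det_lower_triangular[OF _ M]) (use assms in auto)
  also have "\<dots> = (\<Prod>i = 0..<Suc k. M $$ (i, i))"
    using M by (simp add: prod_list_diag_prod)
  also have "\<dots> = M $$ (k, k)" using assms(3) by simp
  finally show ?thesis .
qed

text \<open>The case distinction keeps the positions \<open>(i, w k)\<close> with \<open>i < w k\<close> and \<open>i\<close> not among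
  \<open>w 0, \<dots>, w k\<close>; these coordinatise the cell, as the remaining coordinates of this shape
  vanish by the Schubert conditions.\<close>
definition cell_unip :: "nat \<Rightarrow> (nat \<Rightarrow> nat) \<Rightarrow> (nat set \<Rightarrow> 'r::comm_ring_1) \<Rightarrow> 'r mat" where
  "cell_unip n w x = mat n n (\<lambda>(i, j). if i = j then 1
     else if i < j \<and> inv_into UNIV w j < inv_into UNIV w i
       then antisym_ext x (map w [0..<inv_into UNIV w j] @ [i]) else 0)"

text \<open>This is U w, written entrywise because \<open>perm_mat\<close> is defined over fields
  only, while the matrix is also used over polynomial rings.\<close>

definition cell_mat :: "nat \<Rightarrow> (nat \<Rightarrow> nat) \<Rightarrow> (nat set \<Rightarrow> 'r::comm_ring_1) \<Rightarrow> 'r mat" where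
  "cell_mat n w x = mat n n (\<lambda>(i, j). cell_unip n w x $$ (i, w j))"

text \<open>U has determinant 1, so the adjugate is its inverse over any commutative ring.\<close>

definition cell_unip_inv :: "nat \<Rightarrow> (nat \<Rightarrow> nat) \<Rightarrow> (nat set \<Rightarrow> 'r::comm_ring_1) \<Rightarrow> 'r mat" where
  "cell_unip_inv n w x = adj_mat (cell_unip n w x)"

lemma cell_mat_carrier [simp]:
  "cell_unip n w x \<in> carrier_mat n n" "cell_mat n w x \<in> carrier_mat n n"
  by (simp_all add: cell_unip_def cell_mat_def)

text \<open>Once the rows below \<open>i\<close> are known, the entry of \<open>M * M'\<close> at
  (i, j) with \<open>j < i\<close> has only the term \<open>k = i\<close>, so downward induction
  applies. Regular diagonal entries cover both unitriangular matrices over rings and the Borel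
  subgroup over a field.\<close>

lemma upper_triangular_inverse:
  fixes M :: "'r::comm_ring_1 mat"
  assumes M: "M \<in> carrier_mat n n" "upper_triangular M" and M': "M' \<in> carrier_mat n n" "M * M' = 1\<^sub>m n"
    and reg: "\<And>i c. i < n \<Longrightarrow> M $$ (i, i) * c = 0 \<Longrightarrow> c = 0"
  shows "upper_triangular M'"
proof -
  have "M' $$ (i, j) = 0" if "j < i" "i < n" for i j
    using that
  proof (induction "n - i" arbitrary: i rule: less_induct)
    case less
    have "0 = (M * M') $$ (i, j)" using M'(2) less.prems by simp
    also have "\<dots> = (\<Sum>k = 0..<n. M $$ (i, k) * M' $$ (k, j))"
      using M(1) M'(1) less.prems by (simp add: scalar_prod_def)
    also have "\<dots> = (\<Sum>k\<in>{i}. M $$ (i, k) * M' $$ (k, j))"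
    proof (rule sum.mono_neutral_right)
      show "\<forall>k\<in>{0..<n} - {i}. M $$ (i, k) * M' $$ (k, j) = 0"
      proof
        fix k assume k: "k \<in> {0..<n} - {i}"
        show "M $$ (i, k) * M' $$ (k, j) = 0"
        proof (cases "k < i")
          case True
          then show ?thesis using M less.prems by (simp add: upper_triangular_def)
        next
          case False
          then have "M' $$ (k, j) = 0" using k less.prems by (intro less.hyps) auto
          then show ?thesis by simp
        qed
      qed
    qed (use less.prems in auto)
    finally show ?case using reg[OF less.prems(2), of "M' $$ (i, j)"] by simp
  qed
  then show ?thesis using M'(1) by (auto simp: upper_triangular_def)
qed

lemma cell_unip_upper: "upper_triangular (cell_unip n w x)"
  by (auto simp: upper_triangular_def cell_unip_def)

lemma cell_unip_diag: "i < n \<Longrightarrow> cell_unip n w x $$ (i, i) = 1"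
  by (simp add: cell_unip_def)

lemma det_cell_unip: "det (cell_unip n w x) = 1"
proof -
  have "det (cell_unip n w x) = prod_list (diag_mat (cell_unip n w x))"
    by (rule det_upper_triangular[OF cell_unip_upper]) (rule cell_mat_carrier)
  also have "\<dots> = 1" by (simp add: prod_list_diag_prod cell_unip_diag cell_unip_def)
  finally show ?thesis .
qed

lemma cell_unip_inv:
  "cell_unip_inv n w x \<in> carrier_mat n n"
  "cell_unip n w x * cell_unip_inv n w x = 1\<^sub>m n"
  "cell_unip_inv n w x * cell_unip n w x = 1\<^sub>m n"
  using adj_mat[OF cell_mat_carrier(1)[of n w x]] by (auto simp: cell_unip_inv_def det_cell_unip)

lemma cell_unip_inv_upper: "upper_triangular (cell_unip_inv n w x)"
  by (rule upper_triangular_inverse[OF _ cell_unip_upper cell_unip_inv(1,2)])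
    (simp_all add: cell_unip_diag)

lemma exchange_sum_flag_minor:
  assumes "d \<in> {1..<n}" "rs \<in> incr_seqs n (d - 1)"
    and "js \<in> incr_seqs n (d + 1) \<or> d + 2 \<le> n \<and> js \<in> incr_seqs n (d + 2)" and "g \<in> carrier_mat n n"
  shows "exchange_sum (flag_minor g) rs js = 0"
  using assms by (intro exchange_sum_minor[OF assms(4)]) (auto simp: incr_seqs_def)

text \<open>Comparability would bound the sum of the elements of \<open>insert b S\<close> by that
  of \<open>insert a S\<close>, but it is larger by \<open>b - a\<close>.\<close>

lemma not_index_le_insert:
  assumes "finite S" "a \<notin> S" "b \<notin> S" "a < b"
  shows "\<not> index_le (insert b S) (insert a S)"
proof
  assume "index_le (insert b S) (insert a S)"
  then have "sum_list (sorted_list_of_set (insert b S)) \<le> sum_list (sorted_list_of_set (insert a S))"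
    unfolding index_le_def by (induction rule: list_all2_induct) auto
  moreover have sl: "sum_list (sorted_list_of_set T) = \<Sum>T" if "finite T" for T :: "nat set"
    using that by (metis distinct_sorted_list_of_set map_ident set_sorted_list_of_set sum_list_distinct_conv_sum_set)
  ultimately show False
    using assms sl[of "insert a S"] sl[of "insert b S"] by (simp del: sorted_list_of_set_insert_remove sorted_list_of_set.sorted_key_list_of_set_insert)
qed

context
  fixes n :: nat and w :: "nat \<Rightarrow> nat"
  assumes w: "w permutes {..<n}"
begin

private lemma w_lt: "w i < n \<longleftrightarrow> i < n"
  using permutes_in_image[OF w] by simp

private lemma w_inv: "inv_into UNIV w (w i) = i" "w (inv_into UNIV w i) = i"
  using w by (simp_all add: permutes_inverses)

private lemma w_eq: "w i = w j \<longleftrightarrow> i = j"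
  using permutes_inj[OF w] by (simp add: inj_eq)

text \<open>The condition on \<open>inv_into UNIV w\<close> in \<open>cell_unip\<close> places U in
  the intersection of the upper unipotent group with the conjugate by \<open>w\<close> of the lower
  one. Hence the rows \<open>w 0, w 1, ...\<close> of U w form a lower unitriangular matrix.\<close>

lemma cell_mat_lower:
  assumes "i < n" "j < n" "i \<le> j"
  shows "cell_mat n w x $$ (w i, j) = (if i = j then 1 else 0)"
  using assms by (auto simp: cell_mat_def cell_unip_def w_lt w_inv w_eq)

lemma rc_det_cell_mat:
  assumes "k < n" "b < n"
  shows "rc_det (cell_mat n w x) (map w [0..<k] @ [b]) [0..<Suc k] = cell_mat n w x $$ (b, k)"
proof -
  let ?M = "mat (Suc k) (Suc k) (\<lambda>(i, j). cell_mat n w x $$ ((map w [0..<k] @ [b]) ! i, [0..<Suc k] ! j))"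
  have "det ?M = ?M $$ (k, k)"
    by (rule det_lower_unit_last)
      (use assms in \<open>auto simp: nth_append cell_mat_lower simp del: upt_Suc\<close>)
  then show ?thesis by (simp add: rc_det_def nth_append del: upt_Suc)
qed

text \<open>The submatrix on rows \<open>w 0, ..., w (k - 1), b\<close> is lower triangular with
  diagonal entries 1 except in the corner, so the entries of U w can be read off from its flag
  minors.\<close>

lemma antisym_ext_cell_mat:
  assumes "k < n" "b < n"
  shows "antisym_ext (flag_minor (cell_mat n w x)) (map w [0..<k] @ [b]) = cell_mat n w x $$ (b, k)"
proof -
  have "antisym_ext (flag_minor (cell_mat n w x)) (map w [0..<k] @ [b])
     = rc_det (cell_mat n w x) (map w [0..<k] @ [b]) [0..<length (map w [0..<k] @ [b])]"
    by (rule antisym_ext_minor) (use assms in \<open>auto simp: w_lt cell_mat_def\<close>)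
  then show ?thesis using rc_det_cell_mat[OF assms] by simp
qed

lemma antisym_ext_cell_mat_norm:
  assumes "d \<in> {1..<n}"
  shows "antisym_ext (flag_minor (cell_mat n w x)) (map w [0..<d]) = 1"
proof -
  obtain k where d: "d = Suc k" "k < n" using assms by (cases d) auto
  then show ?thesis using antisym_ext_cell_mat[of k "w k" x] cell_mat_lower[of k k x] by (simp add: w_lt)
qed

end

section \<open>The coordinates modulo the relations\<close>

context ring_ideal begin

text \<open>By uniqueness only the coordinates at \<open>w 0, ..., w (k - 1), b\<close> with
  \<open>b\<close> not among \<open>w 0, ..., w k\<close> need comparing. For \<open>b < w k\<close>
  they agree because the matrix was built from them; for \<open>b > w k\<close> the matrix entry is
  0 and a Schubert condition kills the coordinate of \<open>x\<close>.\<close>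

lemma eqv_flag_minor_cell_mat:
  assumes w: "w permutes {..<n}" and ex: "exchange_mod n x"
    and norm: "\<And>d. d \<in> {1..<n} \<Longrightarrow> antisym_ext x (map w [0..<d]) \<bumpeq> 1"
    and schubert: "\<And>d I. d \<in> {1..<n} \<Longrightarrow> I \<in> subsets_of_size n d \<Longrightarrow>
      \<not> index_le I (w ` {..<d}) \<Longrightarrow> x I \<bumpeq> 0"
    and I: "d \<in> {1..<n}" "I \<in> subsets_of_size n d"
  shows "x I \<bumpeq> flag_minor (cell_mat n w x) I"
proof (rule exchange_mod_unique[OF w ex _ norm _ _ I])
  let ?g = "cell_mat n w x"
  show "exchange_mod n (flag_minor ?g)"
    unfolding exchange_mod_def by (simp add: exchange_sum_flag_minor[of _ n])
  show "antisym_ext (flag_minor ?g) (map w [0..<d]) \<bumpeq> 1" if "d \<in> {1..<n}" for d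
    by (simp add: antisym_ext_cell_mat_norm[OF w that])
  fix k b assume k: "Suc k < n" and b: "b < n" "b \<notin> w ` {..<Suc k}"
  have inj: "inj w" using w by (rule permutes_inj)
  have wk: "w k < n" "w k \<notin> w ` {..<k}" using permutes_in_image[OF w, of k] k inj by (auto simp: inj_eq)
  let ?l = "map w [0..<k] @ [b]" and ?S = "insert b (w ` {..<k})"
  have l: "distinct ?l" "set ?l = ?S"
    using b inj by (auto simp: distinct_map inj_on_subset[OF inj] lessThan_atLeast0)
  have b': "b \<noteq> w k" "b \<notin> w ` {..<k}" using b by auto
  have conv: "y ?S = (- 1) ^ card (inversions ?l) * antisym_ext y ?l" for y :: "nat set \<Rightarrow> 'r"
    using l by (simp add: antisym_ext_def mult.assoc[symmetric] power_mult_distrib[symmetric])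
  have g: "antisym_ext (flag_minor ?g) ?l = ?g $$ (b, k)"
    by (rule antisym_ext_cell_mat[OF w]) (use k b in auto)
  have "k < inv_into UNIV w b"
  proof (rule ccontr)
    assume "\<not> k < inv_into UNIV w b"
    then have "inv_into UNIV w b \<in> {..<Suc k}" by simp
    moreover have "w (inv_into UNIV w b) = b" by (rule permutes_inverses(1)[OF w])
    ultimately show False using b(2) by (metis image_eqI)
  qed
  moreover have "inv_into UNIV w (w k) = k" by (rule permutes_inverses(2)[OF w])
  ultimately have gbk: "?g $$ (b, k) = (if b < w k then antisym_ext x ?l else 0)"
    using k b b' wk by (simp add: cell_mat_def cell_unip_def)
  show "x ?S \<bumpeq> flag_minor ?g ?S"
  proof (cases "b < w k")
    case True
    then have "antisym_ext (flag_minor ?g) ?l = antisym_ext x ?l" using g gbk by simp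
    then have "x ?S = flag_minor ?g ?S"
      using conv[of x] conv[of "flag_minor ?g"] by metis
    then show ?thesis by simp
  next
    case False
    have "card ?S = Suc k" using b' inj by (simp add: card_image inj_on_subset[OF inj])
    moreover have "w ` {..<k} \<subseteq> {..<n}" using k permutes_in_image[OF w] by fastforce
    ultimately have "?S \<in> subsets_of_size n (Suc k)" using b by (simp add: subsets_of_size_def)
    moreover have "\<not> index_le ?S (w ` {..<Suc k})"
      using not_index_le_insert[of "w ` {..<k}" "w k" b] False b' wk by (simp add: lessThan_Suc)
    ultimately have "x ?S \<bumpeq> 0" using k by (intro schubert[of "Suc k"]) auto
    moreover have "flag_minor ?g ?S = 0" using g gbk False by (subst conv) simp
    ultimately show ?thesis by simp
  qed
qed

lemma sum_mem: "(\<And>i. i \<in> A \<Longrightarrow> f i \<in> J) \<Longrightarrow> sum f A \<in> J"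
  by (induction A rule: infinite_finite_induct) (simp_all add: zero_mem add_mem)

text \<open>With this ideal of polynomials in lambda, the conditions on all coefficients of P become
  a single congruence.\<close>

lemma ring_ideal_poly: "ring_ideal {p. \<forall>i. coeff p i \<in> J}"
  by unfold_locales (auto simp: zero_mem add_mem coeff_mult intro!: sum_mem mult_mem) 

end

section \<open>From P to triangularity of the conjugate\<close>

lemma comm_ring_hom_coeff_lift: "comm_ring_hom (\<lambda>c :: 'r::comm_ring_1. [:c:])"
  by unfold_locales (simp_all add: one_pCons)

text \<open>As \<open>b > k\<close>, the last row of the minor is free of lambda. The power lambda^k
  therefore needs the diagonal entry of each of the first \<open>k\<close> rows, which leaves the
  corner entry.\<close>

lemma coeff_minor_shift_mat:
  fixes A :: "'r::comm_ring_1 mat"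
  assumes A: "A \<in> carrier_mat n n" and kb: "k < b" "b < n"
  shows "coeff (minor (shift_mat n A) (insert b {..<k}) {..<Suc k}) k = A $$ (b, k)"
proof -
  let ?M = "shift_mat n A"
  have srt: "sorted_list_of_set (insert b {..<k}) = [0..<k] @ [b]"
  proof -
    have "sorted_list_of_set (set ([0..<k] @ [b])) = [0..<k] @ [b]"
      by (rule sorted_list_of_set.idem_if_sorted_distinct) (use kb in \<open>auto simp: sorted_append\<close>)
    then show ?thesis by (simp add: lessThan_atLeast0)
  qed
  define D where "D = mat (Suc k) (Suc k) (\<lambda>(i, j). ?M $$ (([0..<k] @ [b]) ! i, [0..<Suc k] ! j))"
  have minor: "minor ?M (insert b {..<k}) {..<Suc k} = det D"
    using kb A by (subst minor_rc_det) (auto simp: srt rc_det_def D_def shift_mat_def simp del: upt_Suc)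
  \<comment> \<open>Multiplying the last row by lambda turns the wanted coefficient into the one of
    degree \<open>k + 1\<close>, the top degree of a determinant with linear entries.\<close>
  let ?E = "multrow k [:0, 1:] D"
  have "det ?E = [:0, 1:] * det D"
    by (rule det_multrow[of _ "Suc k"]) (auto simp: D_def)
  then have "coeff (det D) k = coeff (det ?E) (Suc k)" by simp
  also have "\<dots> = det (map_mat (\<lambda>p. coeff p 1) ?E)"
    by (rule det_linear_poly(2)) (use A kb in \<open>auto simp: D_def shift_mat_def nth_append simp del: upt_Suc\<close>)
  also have "\<dots> = map_mat (\<lambda>p. coeff p 1) ?E $$ (k, k)"
    by (rule det_lower_unit_last) (use A kb in \<open>auto simp: D_def shift_mat_def nth_append simp del: upt_Suc\<close>)
  also have "\<dots> = A $$ (b, k)"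
    using A kb by (auto simp: D_def shift_mat_def nth_append simp del: upt_Suc)
  finally show ?thesis unfolding minor .
qed

text \<open>Cauchy-Binet with a matrix of constants. When \<open>x\<close> consists of the flag
  minors of \<open>g\<close>, it identifies the sum in P with a minor of (psi + lambda) g.\<close>

lemma sum_minor_mult_const:
  assumes "g \<in> carrier_mat n n" "I \<in> subsets_of_size n d" "M \<in> carrier_mat n n" "d \<le> n"
  shows "(\<Sum>J\<in>subsets_of_size n d. minor M I J * [:flag_minor g J:])
     = minor (M * map_mat (\<lambda>c. [:c:]) g) I {..<d}"
proof -
  interpret comm_ring_hom "\<lambda>c. [:c:]" by (rule comm_ring_hom_coeff_lift)
  have "{..<d} \<in> subsets_of_size n d" using assms by (simp add: subsets_of_size_def)
  then have "minor (M * map_mat (\<lambda>c. [:c:]) g) I {..<d}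
     = (\<Sum>J\<in>subsets_of_size n d. minor M I J * minor (map_mat (\<lambda>c. [:c:]) g) J {..<d})"
    using assms by (intro cauchy_binet[of _ n n _ n]) auto
  also have "\<dots> = (\<Sum>J\<in>subsets_of_size n d. minor M I J * [:flag_minor g J:])"
    by (intro sum.cong refl) (simp add: hom_minor subsets_of_size_def)
  finally show ?thesis by simp
qed

lemma shift_mat_conj:
  assumes "G \<in> carrier_mat n n" "H \<in> carrier_mat n n" "H * G = 1\<^sub>m n" "\<psi> \<in> carrier_mat n n"
  shows "map_mat (\<lambda>c. [:c:]) H * (shift_mat n \<psi> * map_mat (\<lambda>c. [:c:]) G) = shift_mat n (H * (\<psi> * G))"
proof -
  interpret comm_ring_hom "\<lambda>c::'a. [:c:]" by (rule comm_ring_hom_coeff_lift)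
  let ?c = "map_mat (\<lambda>c::'a. [:c:])"
  have c: "?c G \<in> carrier_mat n n" "?c H \<in> carrier_mat n n" "?c \<psi> \<in> carrier_mat n n" using assms by auto
  have "?c H * (shift_mat n \<psi> * ?c G) = ?c H * (?c \<psi> * ?c G + [:0, 1:] \<cdot>\<^sub>m ?c G)"
    unfolding shift_mat_def using c by (simp add: add_mult_distrib_mat[of _ n n] mult_smult_assoc_mat[of _ n n])
  also have "\<dots> = ?c H * (?c \<psi> * ?c G) + [:0, 1:] \<cdot>\<^sub>m (?c H * ?c G)"
    using c by (subst mult_add_distrib_mat[of _ n n _ n]) (auto simp: mult_smult_distrib[of _ n n])
  also have "\<dots> = shift_mat n (H * (\<psi> * G))"
    using assms mat_hom_mult[of H n n "\<psi> * G" n] mat_hom_mult[of \<psi> n n G n] mat_hom_mult[of H n n G n]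
    by (simp add: shift_mat_def mat_hom_one)
  finally show ?thesis .
qed

text \<open>Conjugation by U alone, without \<open>w\<close>: the entry (w i, w j) is the entry (i,
  j) of A, and the matrix is upper triangular whenever psi is.\<close>

definition cell_conj :: "nat \<Rightarrow> (nat \<Rightarrow> nat) \<Rightarrow> (nat set \<Rightarrow> 'r::comm_ring_1) \<Rightarrow> 'r mat \<Rightarrow> 'r mat" where
  "cell_conj n w x \<psi> = cell_unip_inv n w x * (\<psi> * cell_unip n w x)"

context ring_ideal begin

text \<open>Modulo the ideal, P gives the minors of (psi + lambda) G in the first \<open>d\<close>
  columns as a polynomial \<open>?Q\<close> times those of G. Multiplying by the minors of H turns
  the former into minors of A + lambda and the latter into minors of the identity, which vanish away
  from the first \<open>d\<close> rows.\<close>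

lemma P_val_imp_conj_mem:
  assumes G: "G \<in> carrier_mat n n" and H: "H \<in> carrier_mat n n" and HG: "H * G = 1\<^sub>m n"
    and \<psi>: "\<psi> \<in> carrier_mat n n"
    and minors: "\<And>d I. d \<in> {1..<n} \<Longrightarrow> I \<in> subsets_of_size n d \<Longrightarrow> x I \<bumpeq> flag_minor G I"
    and P: "\<And>d I s. d \<in> {1..<n} \<Longrightarrow> I \<in> subsets_of_size n d \<Longrightarrow> s < d \<Longrightarrow> coeff (P_val n w x \<psi> I) s \<bumpeq> 0"
    and kb: "k < b" "b < n"
  shows "(H * (\<psi> * G)) $$ (b, k) \<bumpeq> 0"
proof -
  interpret P: ring_ideal "{p. \<forall>i. coeff p i \<in> J}" by (rule ring_ideal_poly)
  let ?c = "map_mat (\<lambda>c::'r. [:c:])"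
  let ?M = "shift_mat n \<psi>"
  \<comment> \<open>Columns \<open>0, ..., k\<close> are needed to see the entry (b, k), hence
    dimension \<open>k + 1\<close>; it is below \<open>n\<close> because
    \<open>k < b\<close>.\<close>
  define d where "d = Suc k"
  have d: "d \<in> {1..<n}" "d \<le> n" using kb by (auto simp: d_def)
  let ?S = "subsets_of_size n d"
  let ?Q = "\<Prod>k<d. [:\<psi> $$ (w k, w k):] + [:0, 1:]"
  have dS: "{..<d} \<in> ?S" using d by (simp add: subsets_of_size_def)
  have lift: "P.eqv [:a:] [:b:]" if "a \<bumpeq> b" for a b
    using that by (auto simp: eqv_def P.eqv_def coeff_pCons zero_mem split: nat.split)
  have MG: "P.eqv (minor (?M * ?c G) I {..<d}) (?Q * [:flag_minor G I:])" if I: "I \<in> ?S" for I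
  proof -
    have cI: "card I = d" using I by (simp add: subsets_of_size_def)
    have "coeff (P_val n w x \<psi> I) s \<in> J" for s
      using P[OF d(1) I, of s] coeff_P_val_eq_0[OF \<psi> I, of s w x] zero_mem
      by (cases "s < d") (auto simp: eqv_0_iff)
    then have P0: "P.eqv (P_val n w x \<psi> I) 0" by (simp add: P.eqv_0_iff)
    have "P.eqv (\<Sum>J\<in>?S. minor ?M I J * [:flag_minor G J:]) (\<Sum>J\<in>?S. minor ?M I J * [:x J:])"
      by (intro P.eqv_sum P.eqv_mult P.eqv_refl lift eqv_sym[OF minors[OF d(1)]])
    also have "P.eqv (\<Sum>J\<in>?S. minor ?M I J * [:x J:]) (?Q * [:x I:])"
      using P0 by (simp add: P_val_def cI P.eqv_def)
    also have "P.eqv (?Q * [:x I:]) (?Q * [:flag_minor G I:])"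
      by (intro P.eqv_mult P.eqv_refl lift minors[OF d(1) I])
    finally show ?thesis using sum_minor_mult_const[OF G I shift_mat_carrier[OF \<psi>] d(2)] by simp
  qed
  let ?K = "insert b {..<k}"
  have K: "?K \<in> ?S" using kb by (auto simp: subsets_of_size_def d_def)
  have "b \<notin> {..<d}" using kb by (simp add: d_def)
  then have KD: "?K \<noteq> {..<d}" by blast
  have "shift_mat n (H * (\<psi> * G)) = ?c H * (?M * ?c G)"
    by (rule shift_mat_conj[symmetric]) fact+
  also have "minor \<dots> ?K {..<d} = (\<Sum>I\<in>?S. minor (?c H) ?K I * minor (?M * ?c G) I {..<d})"
    by (rule cauchy_binet[of _ n n _ n]) (use G H \<psi> K dS in \<open>auto intro!: mult_carrier_mat[of _ n n]\<close>)
  also have "P.eqv \<dots> (\<Sum>I\<in>?S. minor (?c H) ?K I * (?Q * [:flag_minor G I:]))"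
    by (intro P.eqv_sum P.eqv_mult P.eqv_refl MG)
  also have "(\<Sum>I\<in>?S. minor (?c H) ?K I * (?Q * [:flag_minor G I:]))
      = ?Q * (\<Sum>I\<in>?S. minor (?c H) ?K I * [:flag_minor G I:])"
    by (simp only: sum_distrib_left mult_ac)
  also have "(\<Sum>I\<in>?S. minor (?c H) ?K I * [:flag_minor G I:]) = minor (?c H * ?c G) ?K {..<d}"
    by (rule sum_minor_mult_const[OF G K _ d(2)]) (use H in simp)
  also have "?c H * ?c G = 1\<^sub>m n"
  proof -
    interpret comm_ring_hom "\<lambda>c::'r. [:c:]" by (rule comm_ring_hom_coeff_lift)
    show ?thesis using G H HG mat_hom_mult[of H n n G n] by (simp add: mat_hom_one)
  qed
  also have "?Q * minor (1\<^sub>m n) ?K {..<d} = 0"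
    by (simp add: minor_one[OF K dS] KD)
  finally have "coeff (minor (shift_mat n (H * (\<psi> * G))) ?K {..<d}) k \<in> J"
    by (simp add: P.eqv_0_iff)
  then show ?thesis
    using coeff_minor_shift_mat[OF _ kb, of "H * (\<psi> * G)"] G H \<psi> by (simp add: eqv_0_iff d_def)
qed

lemma cell_conj_mem:
  assumes w: "w permutes {..<n}" and \<psi>: "\<psi> \<in> carrier_mat n n"
    and minors: "\<And>d I. d \<in> {1..<n} \<Longrightarrow> I \<in> subsets_of_size n d \<Longrightarrow> x I \<bumpeq> flag_minor (cell_mat n w y) I"
    and P: "\<And>d I s. d \<in> {1..<n} \<Longrightarrow> I \<in> subsets_of_size n d \<Longrightarrow> s < d \<Longrightarrow> coeff (P_val n w x \<psi> I) s \<bumpeq> 0"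
    and ij: "j < i" "i < n"
  shows "cell_conj n w y \<psi> $$ (w i, w j) \<bumpeq> 0"
proof -
  let ?U = "cell_unip n w y" and ?V = "cell_unip_inv n w y" and ?G = "cell_mat n w y"
  \<comment> \<open>This is w^-1 U^-1, the inverse of U w.\<close>
  let ?H = "mat n n (\<lambda>(i, j). ?V $$ (w i, j))"
  have wn: "w i < n" if "i < n" for i using permutes_in_image[OF w] that by simp
  have cU: "?U \<in> carrier_mat n n" "?V \<in> carrier_mat n n" by (simp_all add: cell_unip_inv)
  have "?H * ?G = 1\<^sub>m n"
  proof (rule eq_matI)
    fix i j assume "i < dim_row (1\<^sub>m n :: 'r mat)" "j < dim_col (1\<^sub>m n :: 'r mat)"
    then have ij: "i < n" "j < n" by simp_all
    have "(?H * ?G) $$ (i, j) = (?V * ?U) $$ (w i, w j)"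
      using ij wn carrier_matD[OF cU(1)] carrier_matD[OF cU(2)] by (simp add: scalar_prod_def cell_mat_def)
    then show "(?H * ?G) $$ (i, j) = 1\<^sub>m n $$ (i, j)"
      using ij wn permutes_inj[OF w] by (simp add: cell_unip_inv inj_eq)
  qed (simp_all add: cell_mat_def)
  then have "(?H * (\<psi> * ?G)) $$ (i, j) \<bumpeq> 0"
    by (intro P_val_imp_conj_mem[OF cell_mat_carrier(2) _ _ \<psi> minors P ij]) auto
  moreover have "(?H * (\<psi> * ?G)) $$ (i, j) = cell_conj n w y \<psi> $$ (w i, w j)"
    using ij wn carrier_matD[OF cU(1)] carrier_matD[OF cU(2)] carrier_matD[OF \<psi>]
    by (simp add: cell_conj_def scalar_prod_def cell_mat_def)
  ultimately show ?thesis by simp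
qed

end

section \<open>The equations as conditions on values\<close>

context ring_ideal begin

text \<open>The normalisation is left out, so that the condition is homogeneous in each dimension
  and can be moved between homogeneous coordinates of one point.\<close>

definition solution :: "nat \<Rightarrow> (nat \<Rightarrow> nat) \<Rightarrow> (nat set \<Rightarrow> 'r) \<Rightarrow> 'r mat \<Rightarrow> bool" where
  "solution n w x \<psi> \<longleftrightarrow> exchange_mod n x
     \<and> (\<forall>d I. d \<in> {1..<n} \<longrightarrow> I \<in> subsets_of_size n d \<longrightarrow> \<not> index_le I (w ` {..<d}) \<longrightarrow> x I \<bumpeq> 0)
     \<and> (\<forall>d I s. d \<in> {1..<n} \<longrightarrow> I \<in> subsets_of_size n d \<longrightarrow> s < d \<longrightarrow> coeff (P_val n w x \<psi> I) s \<bumpeq> 0)"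

lemma solution_iff_equations:
  assumes w: "w permutes {..<n}" and \<psi>: "\<psi> \<in> carrier_mat n n" "upper_triangular \<psi>"
    and p: "\<And>k l. k < l \<Longrightarrow> l < n \<Longrightarrow> p (UC k l) = \<psi> $$ (k, l)" "\<And>m. m < n \<Longrightarrow> p (TC m) = \<psi> $$ (m, m)"
  shows "solution n w (\<lambda>I. p (XC I)) \<psi> \<longleftrightarrow> (\<forall>f\<in>equations n w. meval of_int p f \<in> J)"
proof -
  have P: "meval of_int p (coeff (P_poly n w I) s) = coeff (P_val n w (\<lambda>I. p (XC I)) \<psi> I) s"
    if "d \<in> {1..<n}" "I \<in> subsets_of_size n d" for d I s
    by (rule meval_P_poly[OF _ \<psi> p]) (use that permutes_in_image[OF w] in \<open>auto simp: subsets_of_size_def\<close>)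
  have "(\<forall>f\<in>plucker_rels n \<union> incidence_rels n. meval of_int p f \<in> J) \<longleftrightarrow> exchange_mod n (\<lambda>I. p (XC I))"
  proof -
    have "(\<forall>f\<in>plucker_rels n. meval of_int p f \<in> J) \<longleftrightarrow> (\<forall>d rs js. d \<in> {1..<n} \<longrightarrow>
        rs \<in> incr_seqs n (d - 1) \<longrightarrow> js \<in> incr_seqs n (d + 1) \<longrightarrow> meval of_int p (exchange_rel rs js) \<in> J)"
      unfolding plucker_rels_def by blast
    moreover have "(\<forall>f\<in>incidence_rels n. meval of_int p f \<in> J) \<longleftrightarrow> (\<forall>d rs js. 1 \<le> d \<longrightarrow> d + 2 \<le> n \<longrightarrow>
        rs \<in> incr_seqs n (d - 1) \<longrightarrow> js \<in> incr_seqs n (d + 2) \<longrightarrow> meval of_int p (exchange_rel rs js) \<in> J)"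
      unfolding incidence_rels_def by blast
    ultimately show ?thesis
      unfolding exchange_mod_def ball_Un meval_exchange_rel eqv_0_iff
      by (simp only:) (auto simp del: One_nat_def)
  qed
  moreover have "(\<forall>f\<in>schubert_rels n w. meval of_int p f \<in> J) \<longleftrightarrow>
      (\<forall>d I. d \<in> {1..<n} \<longrightarrow> I \<in> subsets_of_size n d \<longrightarrow> \<not> index_le I (w ` {..<d}) \<longrightarrow> p (XC I) \<bumpeq> 0)"
    unfolding schubert_rels_def by (fastforce simp: meval_mvar eqv_0_iff)
  moreover have "(\<forall>f\<in>P_rels n w. meval of_int p f \<in> J) \<longleftrightarrow>
      (\<forall>d I s. d \<in> {1..<n} \<longrightarrow> I \<in> subsets_of_size n d \<longrightarrow> s < d \<longrightarrow>
        coeff (P_val n w (\<lambda>I. p (XC I)) \<psi> I) s \<bumpeq> 0)"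
  proof -
    have "(\<forall>f\<in>P_rels n w. meval of_int p f \<in> J) \<longleftrightarrow>
      (\<forall>d I s. d \<in> {1..<n} \<longrightarrow> I \<in> subsets_of_size n d \<longrightarrow> s < d \<longrightarrow>
        meval of_int p (coeff (P_poly n w I) s) \<in> J)"
      unfolding P_rels_def by blast
    also have "\<dots> \<longleftrightarrow> (\<forall>d I s. d \<in> {1..<n} \<longrightarrow> I \<in> subsets_of_size n d \<longrightarrow> s < d \<longrightarrow>
        coeff (P_val n w (\<lambda>I. p (XC I)) \<psi> I) s \<bumpeq> 0)"
      using P by (auto simp: eqv_0_iff)
    finally show ?thesis .
  qed
  ultimately show ?thesis
    unfolding solution_def equations_def by (simp only: ball_Un conj_assoc)
qed

end

section \<open>Changes of homogeneous coordinates\<close>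

definition rescaled :: "nat \<Rightarrow> (nat \<Rightarrow> 'a::comm_ring_1) \<Rightarrow> (nat set \<Rightarrow> 'a) \<Rightarrow> (nat set \<Rightarrow> 'a) \<Rightarrow> bool" where
  "rescaled n c y x \<longleftrightarrow> (\<forall>d\<in>{1..<n}. \<forall>I\<in>subsets_of_size n d. y I = c d * x I)"

lemma antisym_ext_rescaled:
  assumes "rescaled n c y x" "set l \<subseteq> {..<n}" "length l \<in> {1..<n}"
  shows "antisym_ext y l = c (length l) * antisym_ext x l"
proof (cases "distinct l")
  case True
  then have "set l \<in> subsets_of_size n (length l)" using assms by (simp add: subsets_of_size_def distinct_card)
  then have "y (set l) = c (length l) * x (set l)" using assms unfolding rescaled_def by blast
  then show ?thesis by (simp add: antisym_ext_def mult_ac)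
qed (simp add: antisym_ext_def)

text \<open>Bihomogeneity: all first factors have dimension \<open>length rs + 1\<close>, all second
  ones \<open>length js - 1\<close>.\<close>

lemma exchange_sum_rescaled:
  assumes "rescaled n c y x" "set rs \<subseteq> {..<n}" "set js \<subseteq> {..<n}"
    and "Suc (length rs) < n" "1 < length js" "length js \<le> n"
  shows "exchange_sum y rs js = c (Suc (length rs)) * c (length js - 1) * exchange_sum x rs js"
proof -
  have "antisym_ext y (rs @ [js ! m]) = c (Suc (length rs)) * antisym_ext x (rs @ [js ! m])"
    "antisym_ext y (omit m js) = c (length js - 1) * antisym_ext x (omit m js)" if "m < length js" for m
  proof -
    have "js ! m \<in> {..<n}" using nth_mem[OF that] assms(3) by blast
    then show "antisym_ext y (rs @ [js ! m]) = c (Suc (length rs)) * antisym_ext x (rs @ [js ! m])"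
      using antisym_ext_rescaled[OF assms(1), of "rs @ [js ! m]"] assms by simp
    show "antisym_ext y (omit m js) = c (length js - 1) * antisym_ext x (omit m js)"
      using antisym_ext_rescaled[OF assms(1) order_trans[OF set_omit_subset assms(3)], of m] length_omit[OF that] assms(5,6)
      by fastforce
  qed
  then show ?thesis
    unfolding exchange_sum_def sum_distrib_left by (intro sum.cong refl) (simp add: mult_ac del: power_Suc)
qed

lemma (in ring_ideal) solution_rescaled:
  assumes r: "rescaled n c y x" and s: "solution n w x \<psi>"
  shows "solution n w y \<psi>"
proof -
  have m: "a \<bumpeq> 0 \<Longrightarrow> r * a \<bumpeq> 0" for a r by (simp add: eqv_0_iff mult_mem)
  have "exchange_sum y rs js \<bumpeq> 0" if "d \<in> {1..<n}" "rs \<in> incr_seqs n (d - 1)"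
    "js \<in> incr_seqs n (d + 1) \<or> d + 2 \<le> n \<and> js \<in> incr_seqs n (d + 2)" for d rs js
  proof -
    have "exchange_sum x rs js \<bumpeq> 0" using s that unfolding solution_def exchange_mod_def by blast
    moreover have "exchange_sum y rs js = c (Suc (length rs)) * c (length js - 1) * exchange_sum x rs js"
      by (rule exchange_sum_rescaled[OF r]) (use that in \<open>auto simp: incr_seqs_def\<close>)
    ultimately show ?thesis by (simp add: m)
  qed
  moreover have "y I \<bumpeq> 0" if "d \<in> {1..<n}" "I \<in> subsets_of_size n d" "\<not> index_le I (w ` {..<d})" for d I
  proof -
    have "x I \<bumpeq> 0" using s that unfolding solution_def by blast
    then show ?thesis using r that by (simp add: rescaled_def m)
  qed
  moreover have "coeff (P_val n w y \<psi> I) s \<bumpeq> 0" if "d \<in> {1..<n}" "I \<in> subsets_of_size n d" "s < d" for d I s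
  proof -
    have "coeff (P_val n w x \<psi> I) s \<bumpeq> 0" using s that unfolding solution_def by blast
    moreover have "P_val n w y \<psi> I = smult (c d) (P_val n w x \<psi> I)"
      by (rule P_val_smult[OF that(2)]) (use r that in \<open>auto simp: rescaled_def\<close>)
    ultimately show ?thesis by (simp add: m)
  qed
  ultimately show ?thesis unfolding solution_def exchange_mod_def by blast
qed

text \<open>The scalars found in the first part may be zero a priori, which is harmless because
  \<open>solution_rescaled\<close> admits all scalars; the second part has to invert them.\<close>

lemma multiproj_eq_iff:
  fixes x y :: "nat set \<Rightarrow> 'a::field"
  shows "multiproj n y = multiproj n x \<Longrightarrow> \<exists>c. rescaled n c y x"
    and "rescaled n c y x \<Longrightarrow> (\<And>d. d \<in> {1..<n} \<Longrightarrow> c d \<noteq> 0) \<Longrightarrow> multiproj n y = multiproj n x"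
proof -
  assume eq: "multiproj n y = multiproj n x"
  have "\<exists>c. \<forall>I\<in>subsets_of_size n d. y I = c * x I" if d: "d \<in> {1..<n}" for d
  proof -
    let ?v = "\<lambda>I. if I \<in> subsets_of_size n d then 1 * y I else 0"
    have "ext_line n d y = ext_line n d x"
      using fun_cong[OF eq, of d] d by (simp add: multiproj_def)
    moreover have "?v \<in> ext_line n d y" unfolding ext_line_def by blast
    ultimately obtain c where c: "?v = (\<lambda>I. if I \<in> subsets_of_size n d then c * x I else 0)"
      unfolding ext_line_def by blast
    have "y I = c * x I" if "I \<in> subsets_of_size n d" for I using fun_cong[OF c, of I] that by simp
    then show ?thesis by blast
  qed
  then show "\<exists>c. rescaled n c y x" unfolding rescaled_def by metis
next
  assume r: "rescaled n c y x" and c: "\<And>d. d \<in> {1..<n} \<Longrightarrow> c d \<noteq> 0"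
  have "ext_line n d y = ext_line n d x" if d: "d \<in> {1..<n}" for d
  proof -
    have y: "y I = c d * x I" if "I \<in> subsets_of_size n d" for I using r d that by (simp add: rescaled_def)
    have "(\<lambda>I. if I \<in> subsets_of_size n d then a * y I else 0) \<in> ext_line n d x" for a
      unfolding ext_line_def by (rule CollectI, rule exI[of _ "a * c d"]) (auto simp: y mult_ac)
    moreover have "(\<lambda>I. if I \<in> subsets_of_size n d then a * x I else 0) \<in> ext_line n d y" for a
      unfolding ext_line_def by (rule CollectI, rule exI[of _ "a / c d"]) (use c[OF d] in \<open>auto simp: y\<close>)
    ultimately show ?thesis by (auto simp: ext_line_def[of _ _ y] ext_line_def[of _ _ x])
  qed
  then show "multiproj n y = multiproj n x" unfolding multiproj_def by (rule restrict_ext)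
qed

section \<open>Matrix groups\<close>

lemma carrier_GL:
  "g \<in> carrier (GL n) \<longleftrightarrow> g \<in> carrier_mat n n \<and> (\<exists>h\<in>carrier_mat n n. h * g = 1\<^sub>m n \<and> g * h = 1\<^sub>m n)"
  by (auto simp: GL_def units_of_carrier Units_def ring_mat_simps)

lemma GL_simps [simp]: "monoid.mult (GL n) = (*)" "one (GL n) = 1\<^sub>m n"
  by (simp_all add: GL_def units_of_mult units_of_one ring_mat_simps)

lemma group_GL: "group (GL n :: 'a::field mat monoid)"
proof -
  interpret ring "ring_mat TYPE('a) n ()" by (rule ring_mat)
  show ?thesis unfolding GL_def by (rule units_group)
qed

lemma upper_triangular_mult:
  fixes A B :: "'a::comm_ring_1 mat"
  assumes "A \<in> carrier_mat n n" "B \<in> carrier_mat n n" "upper_triangular A" "upper_triangular B"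
  shows "upper_triangular (A * B)" "i < n \<Longrightarrow> (A * B) $$ (i, i) = A $$ (i, i) * B $$ (i, i)"
proof -
  have z: "A $$ (i, k) * B $$ (k, j) = 0" if "i < n" "k < n" "k < i \<or> j < k" for i j k
    using that assms by (auto simp: upper_triangular_def)
  show "upper_triangular (A * B)"
  proof (rule upper_triangularI)
    fix i j assume ij: "j < i" "i < dim_row (A * B)"
    then have "i < n" using assms(1) by simp
    then have "A $$ (i, k) * B $$ (k, j) = 0" if "k < n" for k
      using z[of i k j] that ij by linarith
    then show "(A * B) $$ (i, j) = 0"
      using ij assms(1,2) by (simp add: scalar_prod_def)
  qed
  show "(A * B) $$ (i, i) = A $$ (i, i) * B $$ (i, i)" if "i < n"
  proof -
    have "(A * B) $$ (i, i) = (\<Sum>k = 0..<n. A $$ (i, k) * B $$ (k, i))"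
      using that assms by (simp add: scalar_prod_def)
    also have "\<dots> = (\<Sum>k\<in>{i}. A $$ (i, k) * B $$ (k, i))"
    proof (rule sum.mono_neutral_right)
      show "\<forall>k\<in>{0..<n} - {i}. A $$ (i, k) * B $$ (k, i) = 0"
        using z[OF that] by (metis DiffE atLeastLessThan_iff insertI1 nat_neq_iff)
    qed (use that in auto)
    finally show ?thesis by simp
  qed
qed

lemma Borel_diag:
  assumes "b \<in> Borel n" "i < n"
  shows "b $$ (i, i) \<noteq> (0::'a::field)"
proof -
  from assms obtain h where b: "b \<in> carrier_mat n n" "upper_triangular b" and h: "h \<in> carrier_mat n n" "b * h = 1\<^sub>m n"
    by (auto simp: Borel_def carrier_GL)
  have "det b * det h = 1" using det_mult[OF b(1) h(1)] h by simp
  moreover have "det b = (\<Prod>i = 0..<n. b $$ (i, i))"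
    using det_upper_triangular[OF b(2,1)] b by (simp add: prod_list_diag_prod)
  moreover have "(\<Prod>i = 0..<n. b $$ (i, i)) = 0" if "b $$ (i, i) = 0"
    using that assms(2) by (intro prod_zero) auto
  ultimately show ?thesis by (metis mult_zero_left zero_neq_one)
qed

lemma subgroup_Borel: "subgroup (Borel n) (GL n :: 'a::field mat monoid)"
proof -
  interpret group "GL n :: 'a mat monoid" by (rule group_GL)
  show ?thesis
  proof (rule subgroupI)
    have "upper_triangular (1\<^sub>m n :: 'a mat)" by (auto simp: upper_triangular_def)
    then show "Borel n \<noteq> ({} :: 'a mat set)" using one_closed by (auto simp: Borel_def)
    show "Borel n \<subseteq> carrier (GL n :: 'a mat monoid)" by (auto simp: Borel_def)
  next
    fix a :: "'a mat" assume a: "a \<in> Borel n"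
    then have ac: "a \<in> carrier (GL n)" by (simp add: Borel_def)
    have "upper_triangular (inv\<^bsub>GL n\<^esub> a)"
    proof (rule upper_triangular_inverse)
      show "a * inv\<^bsub>GL n\<^esub> a = 1\<^sub>m n" using r_inv[OF ac] by simp
      show "a \<in> carrier_mat n n" "inv\<^bsub>GL n\<^esub> a \<in> carrier_mat n n"
        using ac inv_closed[OF ac] by (simp_all add: carrier_GL)
    qed (use a Borel_diag[OF a] in \<open>auto simp: Borel_def\<close>)
    then show "inv\<^bsub>GL n\<^esub> a \<in> Borel n" using inv_closed[OF ac] by (simp add: Borel_def)
  next
    fix a b :: "'a mat" assume ab: "a \<in> Borel n" "b \<in> Borel n"
    then show "a \<otimes>\<^bsub>GL n\<^esub> b \<in> Borel n"
      using m_closed[of a b] by (auto simp: Borel_def carrier_GL intro: upper_triangular_mult)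
  qed
qed

lemma mult_perm_mat:
  fixes b :: "'a::field mat"
  assumes "w permutes {..<n}" "b \<in> carrier_mat n n" "i < n" "j < n"
  shows "(b * perm_mat n w) $$ (i, j) = b $$ (i, w j)"
  using assms permutes_in_image[OF assms(1), of j]
  by (simp add: perm_mat_def scalar_prod_def mult_delta_right)

lemma perm_mat_mult:
  fixes b :: "'a::field mat"
  assumes "w permutes {..<n}" "b \<in> carrier_mat n n" "i < n" "j < n"
  shows "(perm_mat n w * b) $$ (w i, j) = b $$ (i, j)"
  using assms permutes_in_image[OF assms(1), of i] permutes_inj[OF assms(1)]
  by (simp add: perm_mat_def scalar_prod_def inj_eq mult_delta_left)

lemma perm_mat_GL:
  assumes w: "w permutes {..<n}"
  shows "perm_mat n w \<in> carrier (GL n :: 'a::field mat monoid)"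
proof -
  let ?P = "perm_mat n w :: 'a mat" and ?T = "mat n n (\<lambda>(i, j). if j = w i then 1 else 0) :: 'a mat"
  have wn: "w i < n" if "i < n" for i using permutes_in_image[OF w] that by simp
  have TP: "?T * ?P = 1\<^sub>m n"
  proof (rule eq_matI)
    fix i j assume "i < dim_row (1\<^sub>m n :: 'a mat)" "j < dim_col (1\<^sub>m n :: 'a mat)"
    then have ij: "i < n" "j < n" by simp_all
    then have "(?T * ?P) $$ (i, j) = ?T $$ (i, w j)" by (intro mult_perm_mat[OF w]) simp_all
    then show "(?T * ?P) $$ (i, j) = 1\<^sub>m n $$ (i, j)"
      using ij wn permutes_inj[OF w] by (auto simp: inj_eq)
  qed (simp_all add: perm_mat_def)
  moreover have "?P * ?T = 1\<^sub>m n"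
    by (rule mat_mult_left_right_inverse[OF _ _ TP]) (simp_all add: perm_mat_def)
  ultimately show ?thesis
    unfolding carrier_GL by (auto simp: perm_mat_def intro!: bexI[of _ ?T])
qed

lemma cell_mat_eq:
  fixes x :: "nat set \<Rightarrow> 'a::field"
  assumes "w permutes {..<n}"
  shows "cell_mat n w x = cell_unip n w x * perm_mat n w"
proof (rule eq_matI)
  fix i j assume "i < dim_row (cell_unip n w x * perm_mat n w)" "j < dim_col (cell_unip n w x * perm_mat n w)"
  then have "i < n" "j < n" by (simp_all add: cell_unip_def perm_mat_def)
  then show "cell_mat n w x $$ (i, j) = (cell_unip n w x * perm_mat n w) $$ (i, j)"
    by (simp add: mult_perm_mat[OF assms cell_mat_carrier(1)], simp add: cell_mat_def)
qed (simp_all add: cell_mat_def cell_unip_def perm_mat_def)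

section \<open>Points of the variety\<close>

text \<open>If \<open>J\<close> is not the initial segment, it contains some
  \<open>a \<ge> d\<close>, and row \<open>a\<close> of \<open>T\<close> is zero in the first
  \<open>d\<close> columns.\<close>

lemma minor_upper_triangular:
  fixes T :: "'r::comm_ring_1 mat"
  assumes T: "T \<in> carrier_mat n n" "upper_triangular T" and J: "J \<in> subsets_of_size n d" and d: "d \<le> n"
  shows "minor T J {..<d} = (if J = {..<d} then \<Prod>k<d. T $$ (k, k) else 0)"
proof -
  have c: "card J = d" "J \<subseteq> {..<n}" "finite J" using J by (auto simp: subsets_of_size_def intro: finite_subset)
  let ?s = "sorted_list_of_set J"
  have m: "minor T J {..<d} = det (mat d d (\<lambda>(i, j). T $$ (?s ! i, [0..<d] ! j)))"
    using c T d by (subst minor_rc_det) (auto simp: rc_det_def)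
  show ?thesis
  proof (cases "J = {..<d}")
    case True
    have "det (mat d d (\<lambda>(i, j). T $$ (?s ! i, [0..<d] ! j)))
      = prod_list (diag_mat (mat d d (\<lambda>(i, j). T $$ (?s ! i, [0..<d] ! j))))"
      by (rule det_upper_triangular[of _ d]) (use T d True in \<open>auto simp: upper_triangular_def\<close>)
    then show ?thesis using True m by (simp add: prod_list_diag_prod lessThan_atLeast0)
  next
    case False
    then have "\<not> J \<subseteq> {..<d}" using c card_subset_eq[of "{..<d}" J] by auto
    then obtain a where a: "a \<in> J" "d \<le> a"
      by (meson lessThan_iff not_less subsetI)
    then obtain i where i: "i < d" "?s ! i = a"
      using c by (metis in_set_conv_nth set_sorted_list_of_set sorted_list_of_set.length_sorted_key_list_of_set)
    have "(\<Prod>k = 0..<d. T $$ (?s ! k, [0..<d] ! p k)) = 0" if "p permutes {0..<d}" for p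
    proof -
      have "p i < d" using permutes_in_image[OF that, of i] i by simp
      then have "T $$ (?s ! i, [0..<d] ! p i) = 0"
        using a i c T by (auto simp: upper_triangular_def)
      then show ?thesis using i by (intro prod_zero) auto
    qed
    then show ?thesis using False m by (simp add: det_mat_leibniz)
  qed
qed

text \<open>Cauchy-Binet has a single nonzero term. This is why the Pluecker coordinates of a coset
  of the Borel subgroup are determined up to one scalar per dimension.\<close>

lemma flag_minor_mult_upper:
  fixes T :: "'r::comm_ring_1 mat"
  assumes g: "g \<in> carrier_mat n n" and T: "T \<in> carrier_mat n n" "upper_triangular T"
    and I: "I \<in> subsets_of_size n d" and d: "d \<le> n"
  shows "minor (g * T) I {..<d} = minor g I {..<d} * (\<Prod>k<d. T $$ (k, k))"
proof -
  have dS: "{..<d} \<in> subsets_of_size n d" using d by (simp add: subsets_of_size_def)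
  have "minor (g * T) I {..<d} = (\<Sum>J\<in>subsets_of_size n d. minor g I J * minor T J {..<d})"
    by (rule cauchy_binet[OF g T(1) I dS])
  also have "\<dots> = (\<Sum>J\<in>subsets_of_size n d. if J = {..<d} then minor g I J * (\<Prod>k<d. T $$ (k, k)) else 0)"
    by (intro sum.cong refl) (simp add: minor_upper_triangular[OF T _ d])
  also have "\<dots> = minor g I {..<d} * (\<Prod>k<d. T $$ (k, k))"
    using dS finite_subsets_of_size[of n d] by simp
  finally show ?thesis .
qed

text \<open>A nonzero Leibniz term requires \<open>f i \<le> f (p i)\<close> for all
  \<open>i\<close>. Both sides have the same sum, so equality holds throughout and \<open>p\<close>
  is the identity.\<close>

lemma det_upper_triangular_relabel:
  fixes b :: "'r::comm_ring_1 mat"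
  assumes b: "b \<in> carrier_mat n n" "upper_triangular b"
    and f: "inj_on f {0..<d}" "\<And>i. i < d \<Longrightarrow> f i < n"
  shows "det (mat d d (\<lambda>(i, j). b $$ (f i, f j))) = (\<Prod>i = 0..<d. b $$ (f i, f i))"
proof -
  have "(\<Prod>i = 0..<d. b $$ (f i, f (p i))) = 0" if p: "p permutes {0..<d}" "p \<noteq> id" for p
  proof (rule ccontr)
    assume nz: "(\<Prod>i = 0..<d. b $$ (f i, f (p i))) \<noteq> 0"
    have le: "f i \<le> f (p i)" if "i \<in> {0..<d}" for i
    proof (rule ccontr)
      assume "\<not> f i \<le> f (p i)"
      then have "b $$ (f i, f (p i)) = 0"
        using b f(2) that by (auto simp: upper_triangular_def)
      then show False using nz that by (metis finite_atLeastLessThan prod_zero)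
    qed
    have "(\<Sum>i\<in>{0..<d}. f (p i)) = (\<Sum>i\<in>{0..<d}. f i)"
      using sum.permute[OF p(1), of f] by (simp add: o_def)
    then have eq: "f i = f (p i)" if "i \<in> {0..<d}" for i
      using le sum_mono_inv[of f "{0..<d}" "\<lambda>i. f (p i)" i] that by simp
    have "p i = i" for i
      using eq[of i] f(1) permutes_in_image[OF p(1), of i] permutes_not_in[OF p(1), of i]
      by (cases "i \<in> {0..<d}") (auto dest: inj_onD)
    then show False using p(2) by auto
  qed
  then have "det (mat d d (\<lambda>(i, j). b $$ (f i, f j)))
      = (\<Sum>p\<in>{p. p permutes {0..<d}}. if p = id then \<Prod>i = 0..<d. b $$ (f i, f i) else 0)"
    unfolding det_mat_leibniz by (intro sum.cong refl) auto
  also have "\<dots> = (\<Prod>i = 0..<d. b $$ (f i, f i))"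
    by (simp add: finite_permutations permutes_id)
  finally show ?thesis .
qed

text \<open>A vanishing block of \<open>d - k\<close> rows and \<open>k + 1\<close> columns kills the \<open>d\<close>-minor.\<close>
lemma flag_minor_not_index_le:
  fixes b :: "'r::comm_ring_1 mat"
  assumes w: "w permutes {..<n}" and b: "b \<in> carrier_mat n n" "upper_triangular b"
    and g: "g \<in> carrier_mat n n" "\<And>i j. i < n \<Longrightarrow> j < n \<Longrightarrow> g $$ (i, j) = b $$ (i, w j)"
    and I: "d \<le> n" "I \<in> subsets_of_size n d" "\<not> index_le I (w ` {..<d})"
  shows "flag_minor g I = 0"
proof -
  have c: "card I = d" "I \<subseteq> {..<n}" "finite I" using I by (auto simp: subsets_of_size_def intro: finite_subset)
  have inj: "inj w" using w by (rule permutes_inj)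
  let ?W = "w ` {..<d}"
  let ?s = "sorted_list_of_set I" and ?t = "sorted_list_of_set ?W"
  have len: "length ?s = d" "length ?t = d" using c by (simp_all add: card_image inj_on_subset[OF inj])
  have set: "set ?s = I" "set ?t = ?W" using c by simp_all
  have srt: "sorted ?s" "sorted ?t" by simp_all
  obtain k where k: "k < d" "?t ! k < ?s ! k"
    using I(3) len by (auto simp: index_le_def list_all2_conv_all_nth not_le)
  have sn: "?s ! i < n" if "i < d" for i using that len set c nth_mem[of i ?s] by auto
  have "flag_minor g I = det (mat d d (\<lambda>(i, j). g $$ (?s ! i, [0..<d] ! j)))"
    using c g I(1) by (subst minor_rc_det) (auto simp: rc_det_def)
  also have "\<dots> = (\<Sum>p | p permutes {0..<d}. signof p * (\<Prod>i = 0..<d. g $$ (?s ! i, [0..<d] ! p i)))"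
    by (rule det_mat_leibniz)
  also have "\<dots> = 0"
  proof (rule sum.neutral, rule ballI)
    fix p assume "p \<in> {p. p permutes {0..<d}}"
    then have p: "p permutes {0..<d}" by simp
    have pd: "p i < d" if "i < d" for i using permutes_in_image[OF p, of i] that by simp
    \<comment> \<open>Otherwise the \<open>d - k\<close> rows from position \<open>k\<close> on,
      whose indices all exceed \<open>?t ! k\<close>, would be matched injectively with the
      \<open>d - k - 1\<close> elements of \<open>?W\<close> above \<open>?t ! k\<close>.\<close>
    have "\<exists>i<d. w (p i) < ?s ! i"
    proof (rule ccontr)
      assume "\<not> ?thesis"
      then have ge: "?s ! i \<le> w (p i)" if "i < d" for i using that by (meson not_less)
      have "(\<lambda>i. w (p i)) ` {k..<d} \<subseteq> (!) ?t ` {Suc k..<d}"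
      proof
        fix y assume "y \<in> (\<lambda>i. w (p i)) ` {k..<d}"
        then obtain i where i: "k \<le> i" "i < d" "y = w (p i)" by auto
        have "y \<in> ?W" using i pd by auto
        then obtain q where q: "q < d" "?t ! q = y" using set(2) len(2) by (metis in_set_conv_nth)
        have "?t ! k < ?t ! q"
          using k(2) sorted_nth_mono[OF srt(1) i(1)] i(2) ge[OF i(2)] len i(3) q(2) by simp
        then have "k < q" using sorted_nth_mono[OF srt(2), of q k] k(1) len by (metis leD leI)
        then show "y \<in> (!) ?t ` {Suc k..<d}" using q by auto
      qed
      then have "card ((\<lambda>i. w (p i)) ` {k..<d}) \<le> card ((!) ?t ` {Suc k..<d})"
        by (intro card_mono) auto
      also have "\<dots> \<le> card {Suc k..<d}" by (rule card_image_le) simp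
      also have "card ((\<lambda>i. w (p i)) ` {k..<d}) = card {k..<d}"
        using inj permutes_inj[OF p] by (intro card_image inj_onI) (auto simp: inj_eq)
      finally show False using k(1) by simp
    qed
    then obtain i where i: "i < d" "w (p i) < ?s ! i" by blast
    have "g $$ (?s ! i, [0..<d] ! p i) = 0"
      using i pd[OF i(1)] sn[OF i(1)] I(1) g(2) b by (auto simp: upper_triangular_def)
    then have "(\<Prod>i = 0..<d. g $$ (?s ! i, [0..<d] ! p i)) = 0"
      using i(1) by (intro prod_zero) auto
    then show "signof p * (\<Prod>i = 0..<d. g $$ (?s ! i, [0..<d] ! p i)) = 0" by simp
  qed
  finally show ?thesis .
qed

lemma antisym_ext_flag_minor_cell:
  fixes b :: "'r::comm_ring_1 mat"
  assumes w: "w permutes {..<n}" and b: "b \<in> carrier_mat n n" "upper_triangular b"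
    and g: "g \<in> carrier_mat n n" "\<And>i j. i < n \<Longrightarrow> j < n \<Longrightarrow> g $$ (i, j) = b $$ (i, w j)" and d: "d \<le> n"
  shows "antisym_ext (flag_minor g) (map w [0..<d]) = (\<Prod>i = 0..<d. b $$ (w i, w i))"
proof -
  have wn: "w i < n" if "i < n" for i using permutes_in_image[OF w] that by simp
  have "antisym_ext (flag_minor g) (map w [0..<d]) = rc_det g (map w [0..<d]) [0..<length (map w [0..<d])]"
    by (rule antisym_ext_minor) (use wn d g in auto)
  also have "\<dots> = det (mat d d (\<lambda>(i, j). b $$ (w i, w j)))"
    unfolding rc_det_def using wn d g by (intro arg_cong[of _ _ det] eq_matI) auto
  also have "\<dots> = (\<Prod>i = 0..<d. b $$ (w i, w i))"
    by (rule det_upper_triangular_relabel[OF b]) (use wn d inj_on_subset[OF permutes_inj[OF w]] in auto)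
  finally show ?thesis .
qed

text \<open>From \<open>\<psi> * g = g * A\<close> follows (psi + lambda) g = g (A + lambda) with A
  + lambda upper triangular, so the flag minors are multiplied by the product of its first
  \<open>d\<close> diagonal entries.\<close>

lemma P_val_eq_0:
  fixes g :: "'r::comm_ring_1 mat"
  assumes g: "g \<in> carrier_mat n n" and \<psi>: "\<psi> \<in> carrier_mat n n"
    and A: "A \<in> carrier_mat n n" "upper_triangular A" "\<psi> * g = g * A"
      "\<And>k. k < n \<Longrightarrow> A $$ (k, k) = \<psi> $$ (w k, w k)"
    and I: "d \<in> {1..<n}" "I \<in> subsets_of_size n d"
  shows "P_val n w (flag_minor g) \<psi> I = 0"
proof -
  interpret comm_ring_hom "\<lambda>c::'r. [:c:]" by (rule comm_ring_hom_coeff_lift)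
  let ?c = "map_mat (\<lambda>c::'r. [:c:])"
  have d: "d \<le> n" and cI: "card I = d" using I by (auto simp: subsets_of_size_def)
  have cg: "?c g \<in> carrier_mat n n" "?c \<psi> \<in> carrier_mat n n" "?c A \<in> carrier_mat n n" using g \<psi> A by auto
  have "shift_mat n \<psi> * ?c g = ?c \<psi> * ?c g + [:0, 1:] \<cdot>\<^sub>m ?c g"
    unfolding shift_mat_def using cg by (simp add: add_mult_distrib_mat[of _ n n] mult_smult_assoc_mat[of _ n n])
  also have "?c \<psi> * ?c g = ?c g * ?c A"
    using mat_hom_mult[OF \<psi> g] mat_hom_mult[OF g A(1)] A(3) by simp
  also have "?c g * ?c A + [:0, 1:] \<cdot>\<^sub>m ?c g = ?c g * shift_mat n A"
    unfolding shift_mat_def using cg by (subst mult_add_distrib_mat[of _ n n _ n]) (auto simp: mult_smult_distrib[of _ n n])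
  finally have comm: "shift_mat n \<psi> * ?c g = ?c g * shift_mat n A" .
  have "(\<Sum>J\<in>subsets_of_size n d. minor (shift_mat n \<psi>) I J * [:flag_minor g J:])
     = minor (?c g * shift_mat n A) I {..<d}"
    using sum_minor_mult_const[OF g I(2) shift_mat_carrier[OF \<psi>] d] comm by simp
  also have "\<dots> = minor (?c g) I {..<d} * (\<Prod>k<d. shift_mat n A $$ (k, k))"
    by (rule flag_minor_mult_upper[OF _ _ _ I(2) d]) (use g A in \<open>auto simp: upper_triangular_def shift_mat_def\<close>)
  also have "minor (?c g) I {..<d} = [:flag_minor g I:]" by (simp add: hom_minor cI)
  also have "(\<Prod>k<d. shift_mat n A $$ (k, k)) = (\<Prod>k<d. [:\<psi> $$ (w k, w k):] + [:0, 1:])"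
    by (intro prod.cong refl) (use A d in \<open>simp add: shift_mat_def\<close>)
  finally show ?thesis by (simp add: P_val_def cI mult.commute)
qed

lemma ring_ideal_0: "ring_ideal {0}"
  by unfold_locales auto

lemma (in ring_ideal) solution_cell:
  assumes w: "w permutes {..<n}" and b: "b \<in> carrier_mat n n" "upper_triangular b"
    and g: "g \<in> carrier_mat n n" "\<And>i j. i < n \<Longrightarrow> j < n \<Longrightarrow> g $$ (i, j) = b $$ (i, w j)"
    and \<psi>: "\<psi> \<in> carrier_mat n n" and A: "A \<in> carrier_mat n n" "upper_triangular A" "\<psi> * g = g * A"
      "\<And>k. k < n \<Longrightarrow> A $$ (k, k) = \<psi> $$ (w k, w k)"
  shows "solution n w (flag_minor g) \<psi>"
  unfolding solution_def exchange_mod_def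
proof (intro conjI allI impI)
  fix d rs js assume "d \<in> {1..<n}" "rs \<in> incr_seqs n (d - 1)"
    "js \<in> incr_seqs n (d + 1) \<or> d + 2 \<le> n \<and> js \<in> incr_seqs n (d + 2)"
  then show "exchange_sum (flag_minor g) rs js \<bumpeq> 0"
    by (simp add: exchange_sum_flag_minor[OF _ _ _ g(1)])
next
  fix d I assume "d \<in> {1..<n}" "I \<in> subsets_of_size n d" "\<not> index_le I (w ` {..<d})"
  then show "flag_minor g I \<bumpeq> 0"
    using flag_minor_not_index_le[OF w b g, of d I] by simp
next
  fix d I and s :: nat assume "d \<in> {1..<n}" "I \<in> subsets_of_size n d"
  then show "coeff (P_val n w (flag_minor g) \<psi> I) s \<bumpeq> 0"
    by (simp add: P_val_eq_0[OF g(1) \<psi> A])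
qed

section \<open>Representatives of cosets in the Schubert cell\<close>

lemma GL_carrier_mat: "g \<in> carrier (GL n) \<Longrightarrow> g \<in> carrier_mat n n"
  by (simp add: carrier_GL)

lemma GL_inv:
  fixes g :: "'a::field mat"
  assumes "g \<in> carrier (GL n)"
  shows "inv\<^bsub>GL n\<^esub> g \<in> carrier (GL n)" "inv\<^bsub>GL n\<^esub> g \<in> carrier_mat n n"
    "inv\<^bsub>GL n\<^esub> g * g = 1\<^sub>m n" "g * inv\<^bsub>GL n\<^esub> g = 1\<^sub>m n" "inv\<^bsub>GL n\<^esub> (inv\<^bsub>GL n\<^esub> g) = g"
proof -
  interpret group "GL n :: 'a mat monoid" by (rule group_GL)
  show "inv\<^bsub>GL n\<^esub> g \<in> carrier (GL n)" "inv\<^bsub>GL n\<^esub> g \<in> carrier_mat n n"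
    using assms inv_closed by (auto simp: carrier_GL)
  show "inv\<^bsub>GL n\<^esub> g * g = 1\<^sub>m n" "g * inv\<^bsub>GL n\<^esub> g = 1\<^sub>m n" "inv\<^bsub>GL n\<^esub> (inv\<^bsub>GL n\<^esub> g) = g"
    using assms l_inv[OF assms] r_inv[OF assms] by simp_all
qed

lemma Ad_inv: "g \<in> carrier (GL n) \<Longrightarrow> Ad n (inv\<^bsub>GL n\<^esub> g) \<psi> = inv\<^bsub>GL n\<^esub> g * \<psi> * g"
  by (simp add: Ad_def GL_inv)

lemma BorelD:
  assumes "b \<in> Borel n"
  shows "b \<in> carrier (GL n)" "b \<in> carrier_mat n n" "upper_triangular b"
  using assms by (simp_all add: Borel_def GL_carrier_mat)

lemma mult_assoc_mat:
  "A \<in> carrier_mat n n \<Longrightarrow> B \<in> carrier_mat n n \<Longrightarrow> C \<in> carrier_mat n n \<Longrightarrow> A * B * C = A * (B * C)"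
  by (rule assoc_mult_mat)

text \<open>Conjugation by \<open>g\<close> is conjugation by \<open>b\<close> followed by
  conjugation by \<open>w\<close>, and the latter only relabels entries.\<close>

lemma conj_cell_entry:
  fixes b :: "'a::field mat"
  assumes w: "w permutes {..<n}" and b: "b \<in> carrier_mat n n" and h: "h \<in> carrier_mat n n" "h * b = 1\<^sub>m n"
    and g: "g \<in> carrier (GL n)" "g = b * perm_mat n w" and \<psi>: "\<psi> \<in> carrier_mat n n" and ij: "i < n" "j < n"
  shows "(inv\<^bsub>GL n\<^esub> g * \<psi> * g) $$ (i, j) = (h * (\<psi> * b)) $$ (w i, w j)"
proof -
  let ?P = "perm_mat n w :: 'a mat" and ?A = "inv\<^bsub>GL n\<^esub> g * \<psi> * g"
  note c = GL_carrier_mat[OF g(1)] GL_carrier_mat[OF perm_mat_GL[OF w]] GL_inv(2)[OF g(1)] \<psi> b h(1)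
  have A: "?A \<in> carrier_mat n n" by (intro mult_carrier_mat[of _ n n] c)
  have PA: "?P * ?A \<in> carrier_mat n n" by (rule mult_carrier_mat[OF c(2) A])
  have "?P * ?A = (h * b) * (?P * ?A)" unfolding h(2) left_mult_one_mat[OF PA] ..
  also have "\<dots> = h * (g * ?A)"
    using mult_assoc_mat[OF h(1) b PA] mult_assoc_mat[OF b c(2) A] by (simp only: g(2))
  also have "g * ?A = (g * inv\<^bsub>GL n\<^esub> g) * (\<psi> * g)"
    using c mult_assoc_mat[of "inv\<^bsub>GL n\<^esub> g" n \<psi> g] mult_assoc_mat[of g n "inv\<^bsub>GL n\<^esub> g" "\<psi> * g"] by simp
  also have "\<dots> = \<psi> * (b * ?P)"
    using c by (simp add: GL_inv(4)[OF g(1)] flip: g(2))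
  also have "h * (\<psi> * (b * ?P)) = (h * (\<psi> * b)) * ?P"
    unfolding mult_assoc_mat[OF \<psi> b c(2), symmetric]
    by (rule mult_assoc_mat[OF h(1) mult_carrier_mat[OF \<psi> b] c(2), symmetric])
  finally have eq: "?P * ?A = (h * (\<psi> * b)) * ?P" .
  have "?A $$ (i, j) = (?P * ?A) $$ (w i, j)"
    by (rule perm_mat_mult[OF w A ij, symmetric])
  also have "\<dots> = (h * (\<psi> * b)) $$ (w i, w j)"
    unfolding eq by (rule mult_perm_mat[OF w]) (use c ij permutes_in_image[OF w, of i] in auto)
  finally show ?thesis .
qed

lemma plucker_coord_eq: "plucker_coord g = flag_minor g"
  by (simp add: plucker_coord_def fun_eq_iff)

lemma cell_unip_Borel: "cell_unip n w x \<in> Borel n"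
  unfolding Borel_def carrier_GL using cell_unip_inv[of n w x] cell_unip_upper cell_mat_carrier(1) by blast

text \<open>The passage from parameters to points: U w represents a coset in the cell, and the
  hypothesis on \<open>cell_conj\<close> is triangularity of the conjugate of psi. It serves both
  solutions of the equations and the retraction.\<close>

lemma cell_plucker_image:
  fixes x :: "nat set \<Rightarrow> 'a::field"
  assumes w: "w permutes {..<n}" and \<psi>: "\<psi> \<in> borel_alg n"
    and conj: "\<And>i j. j < i \<Longrightarrow> i < n \<Longrightarrow> cell_conj n w x \<psi> $$ (w i, w j) = 0"
  shows "(multiproj n (flag_minor (cell_mat n w x)), \<psi>) \<in> plucker_image n (V_tilde n w)"
proof -
  interpret group "GL n :: 'a mat monoid" by (rule group_GL)
  let ?g = "cell_mat n w x" and ?U = "cell_unip n w x"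
  have one: "1\<^sub>m n \<in> Borel n" using subgroup.one_closed[OF subgroup_Borel] by simp
  have U: "?U \<in> Borel n" by (rule cell_unip_Borel)
  have g: "?g \<in> carrier (GL n)"
    using m_closed[of ?U "perm_mat n w"] U perm_mat_GL[OF w] by (simp add: cell_mat_eq[OF w] Borel_def)
  have "?g <#\<^bsub>GL n\<^esub> Borel n \<in> schubert_cell n w"
  proof -
    have "?g = ?U * perm_mat n w * 1\<^sub>m n"
      using right_mult_one_mat[OF GL_carrier_mat[OF g]] cell_mat_eq[OF w, of x] by simp
    then have "?g <#\<^bsub>GL n\<^esub> Borel n = (?U * perm_mat n w * 1\<^sub>m n) <#\<^bsub>GL n\<^esub> Borel n"
      by (rule arg_cong)
    then show ?thesis unfolding schubert_cell_def
      by (intro CollectI exI[of _ ?U] exI[of _ "1\<^sub>m n"] conjI U one)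
  qed
  moreover have "Ad n (inv\<^bsub>GL n\<^esub> ?g) \<psi> \<in> borel_alg n"
  proof -
    have cA: "inv\<^bsub>GL n\<^esub> ?g * \<psi> * ?g \<in> carrier_mat n n"
      using \<psi> by (intro mult_carrier_mat[of _ n n] GL_inv(2)[OF g] GL_carrier_mat[OF g]) (simp add: borel_alg_def)
    have "(inv\<^bsub>GL n\<^esub> ?g * \<psi> * ?g) $$ (i, j) = 0" if "j < i" "i < n" for i j
      using conj_cell_entry[OF w cell_mat_carrier(1) cell_unip_inv(1,3) g cell_mat_eq[OF w], of \<psi> i j]
        conj[OF that] \<psi> that by (simp add: cell_conj_def borel_alg_def)
    then show ?thesis using cA by (auto simp: Ad_inv[OF g] borel_alg_def upper_triangular_def)
  qed
  ultimately have "(?g <#\<^bsub>GL n\<^esub> Borel n, \<psi>) \<in> V_tilde n w"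
    unfolding V_tilde_def X_tilde_def using g \<psi> by blast
  then show ?thesis
    unfolding plucker_image_def plucker_coord_eq using g by blast
qed

lemma solution_plucker_image:
  fixes x :: "nat set \<Rightarrow> 'a::field"
  assumes w: "w permutes {..<n}" and \<psi>: "\<psi> \<in> borel_alg n"
    and norm: "\<And>d. d \<in> {1..<n} \<Longrightarrow> antisym_ext x (map w [0..<d]) \<noteq> 0"
    and sol: "ring_ideal.solution {0} n w x \<psi>"
  shows "(multiproj n x, \<psi>) \<in> plucker_image n (V_tilde n w)"
proof -
  interpret Z: ring_ideal "{0 :: 'a}" by (rule ring_ideal_0)
  have eqv0: "Z.eqv a b \<longleftrightarrow> a = b" for a b by (simp add: Z.eqv_def)
  \<comment> \<open>Dividing by the coordinate at \<open>w 0, ..., w (d - 1)\<close> in each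
    dimension moves the homogeneous coordinates into the normalised chart without changing the
    point.\<close>
  define c where "c = (\<lambda>d. 1 / antisym_ext x (map w [0..<d]))"
  define y where "y = (\<lambda>I. c (card I) * x I)"
  have r: "rescaled n c y x" by (auto simp: rescaled_def y_def subsets_of_size_def)
  have mp: "multiproj n y = multiproj n x"
    by (rule multiproj_eq_iff(2)[OF r]) (use norm in \<open>simp add: c_def\<close>)
  have sol': "Z.solution n w y \<psi>" by (rule Z.solution_rescaled[OF r sol])
  have norm': "antisym_ext y (map w [0..<d]) = 1" if "d \<in> {1..<n}" for d
  proof -
    have "set (map w [0..<d]) \<subseteq> {..<n}" using that permutes_in_image[OF w] by fastforce
    then have "antisym_ext y (map w [0..<d]) = c d * antisym_ext x (map w [0..<d])"
      using antisym_ext_rescaled[OF r, of "map w [0..<d]"] that by simp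
    then show ?thesis using norm[OF that] by (simp add: c_def)
  qed
  have eq: "y I = flag_minor (cell_mat n w y) I" if "d \<in> {1..<n}" "I \<in> subsets_of_size n d" for d I
    using Z.eqv_flag_minor_cell_mat[OF w, of y d I] sol' norm' that
    unfolding Z.solution_def by (simp add: eqv0)
  have "rescaled n (\<lambda>_. 1) y (flag_minor (cell_mat n w y))" using eq by (auto simp: rescaled_def)
  then have mp': "multiproj n y = multiproj n (flag_minor (cell_mat n w y))"
    by (rule multiproj_eq_iff(2)) simp
  have "cell_conj n w y \<psi> $$ (w i, w j) = 0" if "j < i" "i < n" for i j
  proof -
    have "Z.eqv (cell_conj n w y \<psi> $$ (w i, w j)) 0"
    proof (rule Z.cell_conj_mem[OF w _ _ _ that])
      show "\<psi> \<in> carrier_mat n n" using \<psi> by (simp add: borel_alg_def)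
      show "Z.eqv (y I) (flag_minor (cell_mat n w y) I)" if "d \<in> {1..<n}" "I \<in> subsets_of_size n d" for d I
        using eq[OF that] by (simp only: eqv0)
      show "Z.eqv (coeff (P_val n w y \<psi> I) s) 0" if "d \<in> {1..<n}" "I \<in> subsets_of_size n d" "s < d" for d I s
        using sol' that unfolding Z.solution_def by blast
    qed
    then show ?thesis by (simp add: eqv0)
  qed
  then show ?thesis
    unfolding mp[symmetric] mp' by (intro cell_plucker_image[OF w \<psi>]) auto
qed

lemma plucker_image_solution:
  fixes \<psi> :: "'a::field mat"
  assumes w: "w permutes {..<n}" and mem: "(m, \<psi>) \<in> plucker_image n (V_tilde n w)"
  obtains x where "m = multiproj n x" "\<psi> \<in> borel_alg n"
    "\<And>d. d \<in> {1..<n} \<Longrightarrow> antisym_ext x (map w [0..<d]) \<noteq> 0" "ring_ideal.solution {0} n w x \<psi>"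
proof -
  interpret Z: ring_ideal "{0 :: 'a}" by (rule ring_ideal_0)
  interpret group "GL n :: 'a mat monoid" by (rule group_GL)
  interpret B: subgroup "Borel n :: 'a mat set" "GL n :: 'a mat monoid" by (rule subgroup_Borel)
  let ?B = "Borel n :: 'a mat set" and ?P = "perm_mat n w :: 'a mat"
  from mem obtain g0 where m: "m = multiproj n (flag_minor g0)" and g0: "g0 \<in> carrier (GL n)"
    and V: "(g0 <#\<^bsub>GL n\<^esub> ?B, \<psi>) \<in> V_tilde n w"
    unfolding plucker_image_def plucker_coord_eq by blast
  from V obtain g1 where g1: "g1 \<in> carrier (GL n)" "g0 <#\<^bsub>GL n\<^esub> ?B = g1 <#\<^bsub>GL n\<^esub> ?B"
    and \<psi>: "\<psi> \<in> borel_alg n" and Ad: "Ad n (inv\<^bsub>GL n\<^esub> g1) \<psi> \<in> borel_alg n"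
    unfolding V_tilde_def X_tilde_def by blast
  from V obtain b b' where b: "b \<in> ?B" "b' \<in> ?B" and cell: "g0 <#\<^bsub>GL n\<^esub> ?B = (b * ?P * b') <#\<^bsub>GL n\<^esub> ?B"
    unfolding V_tilde_def schubert_cell_def by blast
  \<comment> \<open>Three representatives of one coset occur: \<open>g0\<close> carries the
    coordinates, \<open>g1\<close> the condition on psi, and \<open>g\<close>, with
    \<open>b'\<close> absorbed into the Borel subgroup, has the columns of \<open>b\<close> permuted
    by \<open>w\<close>.\<close>
  define g where "g = b * ?P"
  have bG: "b \<in> carrier (GL n)" "b' \<in> carrier (GL n)" using b by (simp_all only: BorelD)
  have PG: "?P \<in> carrier (GL n)" by (rule perm_mat_GL[OF w])
  have g: "g \<in> carrier (GL n)" using m_closed[OF bG(1) PG] by (simp add: g_def)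
  have "g * b' \<in> g <#\<^bsub>GL n\<^esub> ?B" using b(2) by (auto simp: l_coset_def)
  then have coset: "g0 <#\<^bsub>GL n\<^esub> ?B = g <#\<^bsub>GL n\<^esub> ?B"
    using l_repr_independence[OF _ g subgroup_Borel] cell by (simp add: g_def)
  have self: "h \<in> h <#\<^bsub>GL n\<^esub> ?B" if "h \<in> carrier (GL n)" for h :: "'a mat"
  proof -
    have "h \<otimes>\<^bsub>GL n\<^esub> \<one>\<^bsub>GL n\<^esub> \<in> h <#\<^bsub>GL n\<^esub> ?B"
      using B.one_closed unfolding l_coset_def by blast
    then show ?thesis by (simp only: r_one[OF that])
  qed
  obtain \<beta> where \<beta>: "\<beta> \<in> ?B" "g0 = g * \<beta>"
    using self[OF g0] coset by (auto simp: l_coset_def)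
  obtain \<gamma> where \<gamma>: "\<gamma> \<in> ?B" "g = g1 * \<gamma>"
    using self[OF g] coset g1(2) by (auto simp: l_coset_def)
  have cm: "g \<in> carrier_mat n n" "b \<in> carrier_mat n n" "\<beta> \<in> carrier_mat n n" "\<gamma> \<in> carrier_mat n n"
      "g1 \<in> carrier_mat n n" "\<psi> \<in> carrier_mat n n"
    and ut: "upper_triangular b" "upper_triangular \<beta>" "upper_triangular \<gamma>" "upper_triangular \<psi>"
    using GL_carrier_mat[OF g] GL_carrier_mat[OF g1(1)] BorelD[OF b(1)] BorelD[OF \<beta>(1)] BorelD[OF \<gamma>(1)] \<psi>
    by (simp_all add: borel_alg_def)
  let ?x = "flag_minor g"
  have "rescaled n (\<lambda>d. \<Prod>k<d. \<beta> $$ (k, k)) (flag_minor g0) ?x"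
    unfolding rescaled_def \<beta>(2)
  proof (intro ballI)
    fix d I assume "d \<in> {1..<n}" and I: "I \<in> subsets_of_size n d"
    then have "d \<le> n" "card I = d" by (auto simp: subsets_of_size_def)
    then show "flag_minor (g * \<beta>) I = (\<Prod>k<d. \<beta> $$ (k, k)) * flag_minor g I"
      using flag_minor_mult_upper[OF cm(1,3) ut(2) I] by simp
  qed
  then have m': "m = multiproj n ?x"
    unfolding m by (rule multiproj_eq_iff(2)) (use Borel_diag[OF \<beta>(1)] in auto)
  have ent: "g $$ (i, j) = b $$ (i, w j)" if "i < n" "j < n" for i j
    unfolding g_def by (rule mult_perm_mat[OF w cm(2) that])
  have wn: "w i < n" if "i < n" for i using permutes_in_image[OF w] that by simp
  have norm: "antisym_ext ?x (map w [0..<d]) \<noteq> 0" if "d \<in> {1..<n}" for d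
    using antisym_ext_flag_minor_cell[OF w cm(2) ut(1) cm(1) ent, of d] that Borel_diag[OF b(1)] wn by auto
  let ?A = "inv\<^bsub>GL n\<^esub> g * \<psi> * g" and ?b' = "inv\<^bsub>GL n\<^esub> b"
  note ic = GL_inv(2)[OF g] GL_inv(2)[OF bG(1)] GL_inv(2)[OF g1(1)]
  have \<gamma>G: "\<gamma> \<in> carrier (GL n)" using \<gamma>(1) by (rule BorelD)
  have cA: "?A \<in> carrier_mat n n" by (intro mult_carrier_mat[of _ n n] ic cm)
  \<comment> \<open>Triangularity is known for the conjugate by \<open>g1\<close>; it passes to
    \<open>g = g1 * \<gamma>\<close> because \<gamma> is upper triangular.\<close>
  have utA: "upper_triangular ?A"
  proof -
    let ?A1 = "inv\<^bsub>GL n\<^esub> g1 * \<psi> * g1"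
    have A1: "?A1 \<in> carrier_mat n n" "upper_triangular ?A1"
      using Ad by (auto simp: Ad_inv[OF g1(1)] borel_alg_def)
    have i\<gamma>: "inv\<^bsub>GL n\<^esub> \<gamma> \<in> carrier_mat n n" "upper_triangular (inv\<^bsub>GL n\<^esub> \<gamma>)"
      using BorelD[OF B.m_inv_closed[OF \<gamma>(1)]] by simp_all
    have "inv\<^bsub>GL n\<^esub> g = inv\<^bsub>GL n\<^esub> \<gamma> * inv\<^bsub>GL n\<^esub> g1"
      using inv_mult_group[OF g1(1) \<gamma>G] \<gamma>(2) by simp
    then have "?A = inv\<^bsub>GL n\<^esub> \<gamma> * (?A1 * \<gamma>)"
      unfolding \<gamma>(2) using ic cm i\<gamma>
      by (simp add: mult_assoc_mat[of _ n] mult_carrier_mat[of _ n n _ n])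
    moreover have "upper_triangular (?A1 * \<gamma>)"
      by (rule upper_triangular_mult[OF A1(1) cm(4) A1(2) ut(3)])
    ultimately show ?thesis
      using upper_triangular_mult(1)[OF i\<gamma>(1) _ i\<gamma>(2), of "?A1 * \<gamma>"] A1 cm by auto
  qed
  have \<psi>g: "\<psi> * g = g * ?A"
    using cm ic GL_inv(4)[OF g] mult_assoc_mat[of "inv\<^bsub>GL n\<^esub> g" n \<psi> g] mult_assoc_mat[of g n "inv\<^bsub>GL n\<^esub> g" "\<psi> * g"]
    by simp
  \<comment> \<open>Relabelling by \<open>w\<close> leads to b^-1 psi b, a product of upper
    triangular matrices whose diagonal is that of psi.\<close>
  have Akk: "?A $$ (k, k) = \<psi> $$ (w k, w k)" if "k < n" for k
  proof -
    have i: "upper_triangular ?b'"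
      by (rule BorelD(3)[OF B.m_inv_closed[OF b(1)]])
    have "?A $$ (k, k) = (?b' * (\<psi> * b)) $$ (w k, w k)"
      by (rule conj_cell_entry[OF w cm(2) ic(2) GL_inv(3)[OF bG(1)] g g_def cm(6) that that])
    also have "\<dots> = ?b' $$ (w k, w k) * (\<psi> $$ (w k, w k) * b $$ (w k, w k))"
      using upper_triangular_mult[OF cm(6,2) ut(4,1)] upper_triangular_mult(2)[OF ic(2) _ i, of "\<psi> * b" "w k"]
        wn[OF that] cm by simp
    also have "\<dots> = (?b' $$ (w k, w k) * b $$ (w k, w k)) * \<psi> $$ (w k, w k)" by simp
    also have "?b' $$ (w k, w k) * b $$ (w k, w k) = 1"
      using upper_triangular_mult(2)[OF ic(2) cm(2) i ut(1) wn[OF that]] GL_inv(3)[OF bG(1)] wn[OF that] by simp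
    finally show ?thesis by simp
  qed
  have "Z.solution n w ?x \<psi>"
    by (rule Z.solution_cell[OF w cm(2) ut(1) cm(1) ent cm(6) cA utA \<psi>g Akk])
  then show ?thesis using that m' \<psi> norm by blast
qed

lemma plucker_image_eq_locus:
  fixes \<iota> :: "'k::field \<Rightarrow> 'a::field"
  assumes w: "w permutes {..<n}" and hom: "comm_ring_hom \<iota>"
  shows "plucker_image n (V_tilde n w)
    = locus \<iota> n (base_change ` equations n w) (base_change ` nonvanishing n w)"
proof -
  interpret Z: ring_ideal "{0 :: 'a}" by (rule ring_ideal_0)
  have sol: "(\<forall>f\<in>base_change ` equations n w. meval \<iota> (coord_val x \<psi>) f = 0) \<longleftrightarrow> Z.solution n w x \<psi>"
    if "\<psi> \<in> borel_alg n" for x and \<psi> :: "'a mat"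
    using Z.solution_iff_equations[OF w, of \<psi> "coord_val x \<psi>"] that
    by (simp add: borel_alg_def meval_base_change[OF hom])
  have nv: "(\<forall>f\<in>base_change ` nonvanishing n w. meval \<iota> (coord_val x \<psi>) f \<noteq> 0) \<longleftrightarrow>
      (\<forall>d\<in>{1..<n}. antisym_ext x (map w [0..<d]) \<noteq> 0)" for x and \<psi> :: "'a mat"
  proof -
    have "nonvanishing n w = (\<lambda>d. xs_sym (map w [0..<d])) ` {1..<n}" by (auto simp: nonvanishing_def)
    then show ?thesis by (simp add: meval_base_change[OF hom] meval_xs_sym)
  qed
  have nz: "\<exists>I\<in>subsets_of_size n d. x I \<noteq> 0"
    if "antisym_ext x (map w [0..<d]) \<noteq> 0" "d \<in> {1..<n}" for d and x :: "nat set \<Rightarrow> 'a"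
  proof (rule bexI)
    show "x (w ` {..<d}) \<noteq> 0"
      using that by (auto simp: antisym_ext_def lessThan_atLeast0 split: if_splits)
    show "w ` {..<d} \<in> subsets_of_size n d"
      using that permutes_in_image[OF w] inj_on_subset[OF permutes_inj[OF w]]
      by (auto simp: subsets_of_size_def card_image)
  qed
  show ?thesis
  proof (intro equalityI subsetI)
    fix q assume "q \<in> plucker_image n (V_tilde n w :: ('a mat set \<times> 'a mat) set)"
    then obtain m \<psi> where q: "q = (m, \<psi>)" "(m, \<psi>) \<in> plucker_image n (V_tilde n w)" by (cases q) auto
    obtain x where x: "m = multiproj n x" "\<psi> \<in> borel_alg n"
      "\<And>d. d \<in> {1..<n} \<Longrightarrow> antisym_ext x (map w [0..<d]) \<noteq> 0" "Z.solution n w x \<psi>"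
      using plucker_image_solution[OF w q(2)] by blast
    have "\<forall>d\<in>{1..<n}. \<exists>I\<in>subsets_of_size n d. x I \<noteq> 0" using nz x(3) by blast
    moreover have "\<forall>f\<in>base_change ` equations n w. meval \<iota> (coord_val x \<psi>) f = 0"
      using sol[OF x(2)] x(4) by blast
    moreover have "\<forall>f\<in>base_change ` nonvanishing n w. meval \<iota> (coord_val x \<psi>) f \<noteq> 0"
      using nv x(3) by blast
    ultimately show "q \<in> locus \<iota> n (base_change ` equations n w) (base_change ` nonvanishing n w)"
      unfolding locus_def q(1) x(1) using x(2)
      by (intro CollectI exI[of _ x] exI[of _ \<psi>] conjI refl) (simp_all only:)
  next
    fix q assume "q \<in> locus \<iota> n (base_change ` equations n w) (base_change ` nonvanishing n w)"
    then obtain x \<psi> where q: "q = (multiproj n x, \<psi>)" "\<psi> \<in> borel_alg n"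
      "\<forall>f\<in>base_change ` equations n w. meval \<iota> (coord_val x \<psi>) f = 0"
      "\<forall>f\<in>base_change ` nonvanishing n w. meval \<iota> (coord_val x \<psi>) f \<noteq> 0"
      unfolding locus_def by blast
    have "Z.solution n w x \<psi>" using sol[OF q(2)] q(3) by (rule iffD1)
    moreover have "\<forall>d\<in>{1..<n}. antisym_ext x (map w [0..<d]) \<noteq> 0" using nv q(4) by (rule iffD1)
    ultimately show "q \<in> plucker_image n (V_tilde n w)"
      unfolding q(1) by (intro solution_plucker_image[OF w q(2)]) simp_all
  qed
qed

section \<open>The retraction\<close>

lemma (in comm_ring_hom) map_cell_unip:
  "map_mat hom (cell_unip n w x) = cell_unip n w (hom \<circ> x)"
  by (rule eq_matI) (auto simp: cell_unip_def hom_antisym_ext)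

lemma (in comm_ring_hom) map_cell_mat:
  assumes "w permutes {..<n}"
  shows "map_mat hom (cell_mat n w x) = cell_mat n w (hom \<circ> x)"
proof (rule eq_matI)
  fix i j assume "i < dim_row (cell_mat n w (hom \<circ> x))" "j < dim_col (cell_mat n w (hom \<circ> x))"
  then have "i < n" "w j < n" "j < n" using permutes_in_image[OF assms, of j] by (simp_all add: cell_mat_def)
  then show "map_mat hom (cell_mat n w x) $$ (i, j) = cell_mat n w (hom \<circ> x) $$ (i, j)"
    by (simp add: cell_mat_def flip: map_cell_unip) (simp add: cell_unip_def)
qed (simp_all add: cell_mat_def)

lemma (in comm_ring_hom) map_cell_unip_inv:
  "map_mat hom (cell_unip_inv n w x) = cell_unip_inv n w (hom \<circ> x)"
proof -
  let ?U = "cell_unip n w (hom \<circ> x)" and ?V = "cell_unip_inv n w (hom \<circ> x)"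
  let ?W = "map_mat hom (cell_unip_inv n w x)"
  have W: "?W \<in> carrier_mat n n" by (simp add: cell_unip_inv)
  have "?W * ?U = 1\<^sub>m n"
    using mat_hom_mult[OF cell_unip_inv(1)[of n w x] cell_mat_carrier(1)[of n w x]]
    by (simp add: cell_unip_inv mat_hom_one map_cell_unip)
  then have "?V = ?W * ?U * ?V" by (simp add: left_mult_one_mat[OF cell_unip_inv(1)])
  also have "\<dots> = ?W * (?U * ?V)" by (rule mult_assoc_mat[OF W cell_mat_carrier(1) cell_unip_inv(1)])
  also have "\<dots> = ?W" by (simp add: cell_unip_inv right_mult_one_mat[OF W])
  finally show ?thesis by simp
qed

text \<open>Zeros are put at the entries (w i, w j) with \<open>j < i\<close>, those which the
  equations force to vanish.\<close>

definition masked_conj :: "nat \<Rightarrow> (nat \<Rightarrow> nat) \<Rightarrow> (nat set \<Rightarrow> 'r::comm_ring_1) \<Rightarrow> 'r mat \<Rightarrow> 'r mat" where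
  "masked_conj n w x \<psi> = mat n n (\<lambda>(i, j). if inv_into UNIV w j < inv_into UNIV w i then 0 else cell_conj n w x \<psi> $$ (i, j))"

text \<open>For upper triangular psi, a projection onto the upper triangular matrices stabilising
  the flag of U w: mask in the frame of U, then conjugate back.\<close>

definition retract_mat :: "nat \<Rightarrow> (nat \<Rightarrow> nat) \<Rightarrow> (nat set \<Rightarrow> 'r::comm_ring_1) \<Rightarrow> 'r mat \<Rightarrow> 'r mat" where
  "retract_mat n w x \<psi> = cell_unip n w x * (masked_conj n w x \<psi> * cell_unip_inv n w x)"

lemma masked_conj_carrier [simp]: "masked_conj n w x \<psi> \<in> carrier_mat n n"
  by (simp add: masked_conj_def)

lemma retract_mat_carrier [simp]: "retract_mat n w x \<psi> \<in> carrier_mat n n"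
  unfolding retract_mat_def by (intro mult_carrier_mat[of _ n n] cell_mat_carrier masked_conj_carrier cell_unip_inv)

lemma cell_conj_carrier: "\<psi> \<in> carrier_mat n n \<Longrightarrow> cell_conj n w x \<psi> \<in> carrier_mat n n"
  unfolding cell_conj_def by (intro mult_carrier_mat[of _ n n] cell_mat_carrier cell_unip_inv)

lemma (in comm_ring_hom) map_retract_mat:
  assumes "\<psi> \<in> carrier_mat n n"
  shows "map_mat hom (retract_mat n w x \<psi>) = retract_mat n w (hom \<circ> x) (map_mat hom \<psi>)"
proof -
  have "map_mat hom (cell_conj n w x \<psi>) = cell_conj n w (hom \<circ> x) (map_mat hom \<psi>)"
    unfolding cell_conj_def
      mat_hom_mult[OF cell_unip_inv(1) mult_carrier_mat[OF assms cell_mat_carrier(1)]]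
      mat_hom_mult[OF assms cell_mat_carrier(1)] map_cell_unip map_cell_unip_inv ..
  then have "hom (cell_conj n w x \<psi> $$ (i, j)) = cell_conj n w (hom \<circ> x) (map_mat hom \<psi>) $$ (i, j)"
    if "i < n" "j < n" for i j
    using that carrier_matD[OF cell_conj_carrier[OF assms, of w x]] by (metis index_map_mat(1))
  then have "map_mat hom (masked_conj n w x \<psi>) = masked_conj n w (hom \<circ> x) (map_mat hom \<psi>)"
    by (intro eq_matI) (simp_all add: masked_conj_def)
  then show ?thesis
    unfolding retract_mat_def
      mat_hom_mult[OF cell_mat_carrier(1) mult_carrier_mat[OF masked_conj_carrier cell_unip_inv(1)]]
      mat_hom_mult[OF masked_conj_carrier cell_unip_inv(1)] map_cell_unip map_cell_unip_inv by simp
qed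

lemma cell_conj_retract_mat: "cell_conj n w x (retract_mat n w x \<psi>) = masked_conj n w x \<psi>"
proof -
  let ?U = "cell_unip n w x" and ?V = "cell_unip_inv n w x" and ?M = "masked_conj n w x \<psi>"
  note c = cell_mat_carrier(1)[of n w x] cell_unip_inv(1)[of n w x] masked_conj_carrier[of n w x \<psi>]
  have "(?U * (?M * ?V)) * ?U = ?U * (?M * (?V * ?U))"
    using mult_assoc_mat[OF c(1) mult_carrier_mat[OF c(3,2)] c(1)] mult_assoc_mat[OF c(3,2,1)] by simp
  also have "\<dots> = ?U * ?M" by (simp add: cell_unip_inv right_mult_one_mat[OF c(3)])
  finally have "cell_conj n w x (retract_mat n w x \<psi>) = ?V * (?U * ?M)"
    by (simp add: cell_conj_def retract_mat_def)
  also have "\<dots> = ?M"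
    unfolding mult_assoc_mat[OF c(2,1,3), symmetric] cell_unip_inv(3) by (rule left_mult_one_mat[OF c(3)])
  finally show ?thesis .
qed

lemma upper_triangular_retract_mat:
  assumes "\<psi> \<in> carrier_mat n n" "upper_triangular \<psi>"
  shows "upper_triangular (retract_mat n w x \<psi>)"
proof -
  note c = cell_mat_carrier(1)[of n w x] cell_unip_inv(1)[of n w x] masked_conj_carrier[of n w x \<psi>]
  note u = cell_unip_upper[of n w x] cell_unip_inv_upper[of n w x]
  have "upper_triangular (cell_conj n w x \<psi>)"
    unfolding cell_conj_def
    by (intro upper_triangular_mult(1)[of _ n] c u assms mult_carrier_mat[of _ n n])
  then have M: "upper_triangular (masked_conj n w x \<psi>)"
    using cell_conj_carrier[OF assms(1), of w x] by (auto simp: masked_conj_def upper_triangular_def)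
  show ?thesis
    unfolding retract_mat_def
    by (intro upper_triangular_mult(1)[of _ n] c u M mult_carrier_mat[of _ n n])
qed

text \<open>psi is U C U^-1 with C the matrix \<open>cell_conj\<close>, and masking changes C only
  in entries congruent to 0.\<close>

lemma (in ring_ideal) eqv_retract_mat:
  assumes w: "w permutes {..<n}" and \<psi>: "\<psi> \<in> carrier_mat n n"
    and conj: "\<And>i j. j < i \<Longrightarrow> i < n \<Longrightarrow> cell_conj n w x \<psi> $$ (w i, w j) \<bumpeq> 0"
    and ij: "i < n" "j < n"
  shows "\<psi> $$ (i, j) \<bumpeq> retract_mat n w x \<psi> $$ (i, j)"
proof -
  let ?U = "cell_unip n w x" and ?V = "cell_unip_inv n w x" and ?M = "masked_conj n w x \<psi>"
  let ?C = "cell_conj n w x \<psi>"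
  note c = cell_mat_carrier(1)[of n w x] cell_unip_inv(1)[of n w x] masked_conj_carrier[of n w x \<psi>]
  note cC = cell_conj_carrier[OF \<psi>, of w x]
  have "?C * ?V = ?V * (\<psi> * (?U * ?V))"
    unfolding cell_conj_def mult_assoc_mat[OF c(2) mult_carrier_mat[OF \<psi> c(1)] c(2)]
      mult_assoc_mat[OF \<psi> c(1,2)] ..
  also have "\<dots> = ?V * \<psi>" by (simp add: cell_unip_inv right_mult_one_mat[OF \<psi>])
  finally have "?U * (?C * ?V) = (?U * ?V) * \<psi>"
    using mult_assoc_mat[OF c(1,2) \<psi>] by simp
  then have \<psi>eq: "\<psi> = ?U * (?C * ?V)" by (simp add: cell_unip_inv left_mult_one_mat[OF \<psi>])
  have CM: "?C $$ (k, l) \<bumpeq> ?M $$ (k, l)" if "k < n" "l < n" for k l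
  proof (cases "inv_into UNIV w l < inv_into UNIV w k")
    case True
    have "inv_into UNIV w k < n" using permutes_in_image[OF permutes_inv[OF w], of k] that by simp
    then have "?C $$ (k, l) \<bumpeq> 0"
      using conj[OF True] permutes_inverses(1)[OF w] by simp
    then show ?thesis using True that by (simp add: masked_conj_def)
  next
    case False
    then show ?thesis using that by (simp add: masked_conj_def)
  qed
  have "(?U * (?C * ?V)) $$ (i, j) \<bumpeq> (?U * (?M * ?V)) $$ (i, j)"
  proof (rule eqv_mat_mult[OF c(1,1) mult_carrier_mat[OF cC c(2)] mult_carrier_mat[OF c(3,2)] eqv_refl _ ij])
    show "(?C * ?V) $$ (k, l) \<bumpeq> (?M * ?V) $$ (k, l)" if "k < n" "l < n" for k l
      by (rule eqv_mat_mult[OF cC c(3,2,2) CM eqv_refl that])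
  qed
  then show ?thesis using \<psi>eq by (simp add: retract_mat_def)
qed

text \<open>Here \<open>x\<close> is subject to no relation: the entries of U and the unmasked
  entries of the conjugate are free parameters of the variety.\<close>

lemma retract_plucker_image:
  fixes x :: "nat set \<Rightarrow> 'a::field"
  assumes w: "w permutes {..<n}" and \<psi>: "\<psi> \<in> borel_alg n"
  shows "(multiproj n (flag_minor (cell_mat n w x)), retract_mat n w x \<psi>) \<in> plucker_image n (V_tilde n w)"
proof (rule cell_plucker_image[OF w])
  show "retract_mat n w x \<psi> \<in> borel_alg n"
    using \<psi> upper_triangular_retract_mat[of \<psi> n w x] by (simp add: borel_alg_def)
  fix i j :: nat assume "j < i" "i < n"
  then show "cell_conj n w x (retract_mat n w x \<psi>) $$ (w i, w j) = 0"
    using permutes_in_image[OF w] permutes_inverses(2)[OF w]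
    by (simp add: cell_conj_retract_mat masked_conj_def)
qed

section \<open>The polynomial ring in the coordinates\<close>

lemma mpol_ring_simps:
  "monoid.mult (mpol_ring n) = (*)" "one (mpol_ring n) = 1" "zero (mpol_ring n) = 0" "add (mpol_ring n) = (+)"
  by (simp_all add: mpol_ring_def)

lemma carrier_mpol_ring:
  "f \<in> carrier (mpol_ring n) \<longleftrightarrow> (\<forall>m\<in>Poly_Mapping.keys f. Poly_Mapping.keys m \<subseteq> coords n)"
  by (simp add: mpol_ring_def)

lemma mpol_ring_add: "f \<in> carrier (mpol_ring n) \<Longrightarrow> g \<in> carrier (mpol_ring n) \<Longrightarrow> f + g \<in> carrier (mpol_ring n)"
  unfolding carrier_mpol_ring using keys_add[of f g] by blast

lemma mpol_ring_uminus: "f \<in> carrier (mpol_ring n) \<Longrightarrow> - f \<in> carrier (mpol_ring n)"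
  by (simp add: carrier_mpol_ring in_keys_iff)

lemma mpol_ring_mult:
  assumes "f \<in> carrier (mpol_ring n)" "g \<in> carrier (mpol_ring n)"
  shows "f * g \<in> carrier (mpol_ring n)"
  unfolding carrier_mpol_ring
proof
  fix m assume "m \<in> Poly_Mapping.keys (f * g)"
  then obtain a b where "m = a + b" "a \<in> Poly_Mapping.keys f" "b \<in> Poly_Mapping.keys g"
    using keys_mult[of f g] by blast
  then show "Poly_Mapping.keys m \<subseteq> coords n"
    using assms keys_add[of a b] unfolding carrier_mpol_ring by blast
qed

lemma mpol_ring_const: "const c \<in> carrier (mpol_ring n)"
  by (simp add: carrier_mpol_ring const_def)

lemma mpol_ring_0: "0 \<in> carrier (mpol_ring n)" and mpol_ring_1: "1 \<in> carrier (mpol_ring n)"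
  by (simp_all add: carrier_mpol_ring)

lemma mpol_ring_mvar: "v \<in> coords n \<Longrightarrow> mvar v \<in> carrier (mpol_ring n)"
  by (simp add: carrier_mpol_ring mvar_def)

lemma mpol_ring_sum: "(\<And>i. i \<in> A \<Longrightarrow> f i \<in> carrier (mpol_ring n)) \<Longrightarrow> sum f A \<in> carrier (mpol_ring n)"
  by (induction A rule: infinite_finite_induct) (simp_all add: mpol_ring_add mpol_ring_0)

lemma mpol_ring_prod: "(\<And>i. i \<in> A \<Longrightarrow> f i \<in> carrier (mpol_ring n)) \<Longrightarrow> prod f A \<in> carrier (mpol_ring n)"
  by (induction A rule: infinite_finite_induct) (simp_all add: mpol_ring_mult mpol_ring_1)

lemma mpol_ring_power: "f \<in> carrier (mpol_ring n) \<Longrightarrow> f ^ k \<in> carrier (mpol_ring n)"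
  by (induction k) (simp_all add: mpol_ring_mult mpol_ring_1)

lemma cring_mpol_ring: "cring (mpol_ring n :: 'a::comm_ring_1 mpol ring)"
proof (rule cringI)
  show "abelian_group (mpol_ring n :: 'a mpol ring)"
  proof (rule abelian_groupI)
    fix f :: "'a mpol" assume "f \<in> carrier (mpol_ring n)"
    then show "\<exists>g\<in>carrier (mpol_ring n). g \<oplus>\<^bsub>mpol_ring n\<^esub> f = \<zero>\<^bsub>mpol_ring n\<^esub>"
      by (intro bexI[of _ "- f"] mpol_ring_uminus) (simp_all add: mpol_ring_simps)
  qed (simp_all add: mpol_ring_simps mpol_ring_add mpol_ring_0 ac_simps)
  show "Group.comm_monoid (mpol_ring n :: 'a mpol ring)"
    by (rule comm_monoidI) (simp_all add: mpol_ring_simps mpol_ring_mult mpol_ring_1 ac_simps)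
qed (simp add: mpol_ring_simps distrib_right)

text \<open>The type of polynomials has variables outside \<open>coords n\<close>; setting them to zero pulls the
  ideal of \<open>mpol_ring n\<close> back to an ideal of the whole type.\<close>
definition restrict_var :: "nat \<Rightarrow> coord \<Rightarrow> 'a::comm_ring_1 mpol" where
  "restrict_var n c = (if c \<in> coords n then mvar c else 0)"

definition restrict_pol :: "nat \<Rightarrow> 'a::comm_ring_1 mpol \<Rightarrow> 'a mpol" where
  "restrict_pol n = meval const (restrict_var n)"

lemma comm_ring_hom_restrict_pol: "comm_ring_hom (restrict_pol n)"
  unfolding restrict_pol_def by (rule comm_ring_hom_meval[OF comm_ring_hom_const])

lemma restrict_pol_carrier: "restrict_pol n f \<in> carrier (mpol_ring n)"
  unfolding restrict_pol_def meval_def restrict_var_def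
  by (intro mpol_ring_sum mpol_ring_mult mpol_ring_prod mpol_ring_power mpol_ring_const)
    (simp add: mpol_ring_mvar mpol_ring_0)

lemma restrict_pol_ident:
  assumes "f \<in> carrier (mpol_ring n)"
  shows "restrict_pol n f = f"
proof -
  have "restrict_pol n f = meval const mvar f"
    unfolding restrict_pol_def
    by (rule meval_cong) (use assms in \<open>auto simp: carrier_mpol_ring restrict_var_def\<close>)
  then show ?thesis by (simp add: meval_const_mvar)
qed

lemma restrict_pol_base_change: "restrict_pol n (base_change f) = meval of_int (restrict_var n) f"
  unfolding restrict_pol_def by (rule meval_base_change[OF comm_ring_hom_const])

lemma generic_mat_upper: "generic_mat n \<in> carrier_mat n n" "upper_triangular (generic_mat n)"
  by (auto simp: generic_mat_def upper_triangular_def)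

text \<open>A polynomial unchanged by setting all variables outside \<open>coords n\<close> to zero
  lies in \<open>mpol_ring n\<close>. Each equation is unchanged, as it involves only coordinates in
  dimensions \<open>1, ..., n - 1\<close> and entries of an upper triangular matrix of size
  \<open>n\<close>.\<close>

lemma equations_carrier:
  assumes w: "w permutes {..<n}" and f: "f \<in> equations n w \<union> chart_eqs n w"
  shows "base_change f \<in> carrier (mpol_ring n :: 'a::comm_ring_1 mpol ring)"
proof -
  let ?x = "\<lambda>I. mvar (XC I) :: 'a mpol" and ?y = "\<lambda>I. restrict_var n (XC I) :: 'a mpol"
  have r: "rescaled n (\<lambda>_. 1) ?y ?x"
    by (auto simp: rescaled_def restrict_var_def coords_def)
  have XC: "?y I = ?x I" if "d \<in> {1..<n}" "I \<in> subsets_of_size n d" for d I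
    using r that by (auto simp: rescaled_def)
  interpret x: comm_ring_hom "meval of_int (mvar :: coord \<Rightarrow> 'a mpol)" by (rule comm_ring_hom_meval_int)
  interpret y: comm_ring_hom "meval of_int (restrict_var n :: coord \<Rightarrow> 'a mpol)" by (rule comm_ring_hom_meval_int)
  have "meval of_int (restrict_var n) f = (meval of_int mvar f :: 'a mpol)"
    using f unfolding equations_def
  proof (elim UnE)
    assume "f \<in> plucker_rels n"
    then obtain d rs js where *: "f = exchange_rel rs js" "d \<in> {1..<n}" "rs \<in> incr_seqs n (d - 1)" "js \<in> incr_seqs n (d + 1)"
      unfolding plucker_rels_def by blast
    have "exchange_sum ?y rs js = 1 * 1 * exchange_sum ?x rs js"
      by (rule exchange_sum_rescaled[OF r]) (use * in \<open>auto simp: incr_seqs_def\<close>)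
    then show ?thesis by (simp add: *(1) meval_exchange_rel)
  next
    assume "f \<in> incidence_rels n"
    then obtain d rs js where *: "f = exchange_rel rs js" "1 \<le> d" "d + 2 \<le> n" "rs \<in> incr_seqs n (d - 1)" "js \<in> incr_seqs n (d + 2)"
      unfolding incidence_rels_def by blast
    have "exchange_sum ?y rs js = 1 * 1 * exchange_sum ?x rs js"
      by (rule exchange_sum_rescaled[OF r]) (use * in \<open>auto simp: incr_seqs_def\<close>)
    then show ?thesis by (simp add: *(1) meval_exchange_rel)
  next
    assume "f \<in> schubert_rels n w"
    then show ?thesis unfolding schubert_rels_def using XC by (auto simp: meval_mvar)
  next
    assume "f \<in> P_rels n w"
    then obtain d I s where *: "f = coeff (P_poly n w I) s" "d \<in> {1..<n}" "I \<in> subsets_of_size n d"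
      unfolding P_rels_def by blast
    have wn: "w k < n" if "k < card I" for k
      using that * permutes_in_image[OF w, of k] by (simp add: subsets_of_size_def)
    have "P_val n w ?y (generic_mat n) I = smult 1 (P_val n w ?x (generic_mat n) I)"
      by (rule P_val_smult[OF *(3)]) (use XC[OF *(2)] in simp)
    moreover have "meval of_int (restrict_var n) f = (coeff (P_val n w ?y (generic_mat n) I) s :: 'a mpol)"
      unfolding *(1) by (rule meval_P_poly[OF wn generic_mat_upper])
        (auto simp: restrict_var_def coords_def generic_mat_def)
    moreover have "meval of_int mvar f = (coeff (P_val n w ?x (generic_mat n) I) s :: 'a mpol)"
      unfolding *(1) by (rule meval_P_poly[OF wn generic_mat_upper]) (auto simp: generic_mat_def)
    ultimately show ?thesis by simp
  next
    assume "f \<in> chart_eqs n w"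
    then obtain d where *: "f = xs_sym (map w [0..<d]) - 1" "d \<in> {1..<n}"
      unfolding chart_eqs_def nonvanishing_def by blast
    have "set (map w [0..<d]) \<subseteq> {..<n}" using *(2) permutes_in_image[OF w] by fastforce
    then have "antisym_ext ?y (map w [0..<d]) = 1 * antisym_ext ?x (map w [0..<d])"
      by (rule antisym_ext_rescaled[OF r]) (use * in simp)
    then show ?thesis by (simp add: *(1) x.hom_minus y.hom_minus meval_xs_sym)
  qed
  then have "restrict_pol n (base_change f :: 'a mpol) = base_change f"
    unfolding restrict_pol_base_change by (simp only: base_change_eq_meval)
  then show ?thesis by (metis restrict_pol_carrier)
qed

section \<open>The ideal of the variety\<close>

lemma field_hom_to_ac: "field_hom to_ac"
  by unfold_locales simp_all

lemma comm_ring_hom_to_ac: "comm_ring_hom to_ac"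
  by unfold_locales simp_all

lemma meval_chart_eqs:
  "(\<forall>f\<in>chart_eqs n w. meval of_int p f \<in> S) \<longleftrightarrow>
     (\<forall>d\<in>{1..<n}. antisym_ext (\<lambda>I. p (XC I)) (map w [0..<d]) - 1 \<in> S)"
proof -
  interpret comm_ring_hom "meval of_int p" by (rule comm_ring_hom_meval_int)
  have "chart_eqs n w = (\<lambda>d. xs_sym (map w [0..<d]) - 1) ` {1..<n}"
    unfolding chart_eqs_def nonvanishing_def by blast
  then show ?thesis by (simp add: hom_minus meval_xs_sym)
qed

lemma equations_subset_chart_ideal:
  assumes w: "w permutes {..<n}"
  shows "base_change ` (equations n w \<union> chart_eqs n w)
    \<subseteq> (chart_ideal n w (plucker_image n (V_tilde n w)) :: 'k::field_char_0 mpol set)"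
proof
  interpret Z: ring_ideal "{0 :: 'k alg_closure}" by (rule ring_ideal_0)
  fix g :: "'k mpol" assume "g \<in> base_change ` (equations n w \<union> chart_eqs n w)"
  then obtain f where g: "g = base_change f" and f: "f \<in> equations n w \<union> chart_eqs n w" by blast
  have "meval to_ac (coord_val x \<psi>) g = 0"
    if norm: "\<forall>d\<in>{1..<n}. antisym_ext x (map w [0..<d]) = 1"
      and mem: "(multiproj n x, \<psi>) \<in> plucker_image n (V_tilde n w)" for x and \<psi> :: "'k alg_closure mat"
  proof -
    \<comment> \<open>Membership in the image yields some homogeneous coordinates \<open>y\<close>
      of the point, whereas the chart ideal is about the given \<open>x\<close>; the two differ by a
      scalar in each dimension.\<close>
    obtain y where y: "multiproj n x = multiproj n y" "\<psi> \<in> borel_alg n" "Z.solution n w y \<psi>"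
      using plucker_image_solution[OF w mem] by metis
    obtain c where "rescaled n c x y" using multiproj_eq_iff(1)[OF y(1)] by blast
    then have "Z.solution n w x \<psi>" using y(3) by (rule Z.solution_rescaled)
    then have "\<forall>f\<in>equations n w. meval of_int (coord_val x \<psi>) f \<in> {0}"
      using Z.solution_iff_equations[OF w, of \<psi> "coord_val x \<psi>"] y(2) by (simp add: borel_alg_def)
    moreover have "\<forall>f\<in>chart_eqs n w. meval of_int (coord_val x \<psi>) f \<in> {0}"
      unfolding meval_chart_eqs using norm by simp
    ultimately show ?thesis
      unfolding g meval_base_change[OF comm_ring_hom_to_ac] using f by blast
  qed
  then show "g \<in> chart_ideal n w (plucker_image n (V_tilde n w))"
    unfolding chart_ideal_def using equations_carrier[OF w f] g by blast
qed

lemma ideal_chart_ideal: "ideal (chart_ideal n w Z) (mpol_ring n :: 'k::field_char_0 mpol ring)"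
proof -
  let ?R = "mpol_ring n :: 'k mpol ring"
  interpret R: cring ?R by (rule cring_mpol_ring)
  interpret ev: comm_ring_hom "meval to_ac p" for p :: "coord \<Rightarrow> 'k alg_closure"
    by (rule comm_ring_hom_meval[OF comm_ring_hom_to_ac])
  have inv: "\<ominus>\<^bsub>?R\<^esub> a = - a" if "a \<in> carrier ?R" for a
    by (rule R.minus_equality) (use that in \<open>simp_all add: mpol_ring_simps mpol_ring_uminus\<close>)
  show ?thesis
  proof (rule idealI)
    show "subgroup (chart_ideal n w Z) (add_monoid ?R)"
    proof (rule R.add.subgroupI)
      show "chart_ideal n w Z \<subseteq> carrier ?R" by (auto simp: chart_ideal_def)
      have "0 \<in> chart_ideal n w Z" by (simp add: chart_ideal_def mpol_ring_0)
      then show "chart_ideal n w Z \<noteq> {}" by blast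
    next
      fix a assume a: "a \<in> chart_ideal n w Z"
      then have "\<ominus>\<^bsub>?R\<^esub> a = - a" by (intro inv) (simp add: chart_ideal_def)
      moreover have "- a \<in> chart_ideal n w Z"
        using a by (simp add: chart_ideal_def mpol_ring_uminus ev.hom_uminus)
      ultimately show "\<ominus>\<^bsub>?R\<^esub> a \<in> chart_ideal n w Z" by simp
    next
      fix a b assume "a \<in> chart_ideal n w Z" "b \<in> chart_ideal n w Z"
      then show "a \<oplus>\<^bsub>?R\<^esub> b \<in> chart_ideal n w Z"
        by (simp add: chart_ideal_def mpol_ring_simps mpol_ring_add ev.hom_add)
    qed
    fix a x assume "a \<in> chart_ideal n w Z" "x \<in> carrier ?R"
    then show "x \<otimes>\<^bsub>?R\<^esub> a \<in> chart_ideal n w Z" "a \<otimes>\<^bsub>?R\<^esub> x \<in> chart_ideal n w Z"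
      by (simp_all add: chart_ideal_def mpol_ring_simps mpol_ring_mult ev.hom_mult)
  qed (rule R.ring_axioms)
qed

text \<open>The retraction of the generic point: the flag minors of its cell matrix and its masked
  matrix, as polynomials in the original variables.\<close>

definition retract_var :: "nat \<Rightarrow> (nat \<Rightarrow> nat) \<Rightarrow> coord \<Rightarrow> 'a::comm_ring_1 mpol" where
  "retract_var n w = coord_val (flag_minor (cell_mat n w (\<lambda>I. mvar (XC I))))
     (retract_mat n w (\<lambda>I. mvar (XC I)) (generic_mat n))"

text \<open>At every point, the substitution \<open>retract_var\<close> takes values in the variety, so it kills
  every polynomial of the chart ideal.\<close>
lemma meval_retract_var_eq_0:
  fixes f :: "'k::field_char_0 mpol"
  assumes w: "w permutes {..<n}" and f: "f \<in> chart_ideal n w (plucker_image n (V_tilde n w))"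
  shows "meval const (retract_var n w) f = 0"
proof (rule meval_zero_imp_zero[OF field_hom_to_ac])
  fix p :: "coord \<Rightarrow> 'k alg_closure"
  let ?h = "meval to_ac p"
  interpret h: comm_ring_hom ?h by (rule comm_ring_hom_meval[OF comm_ring_hom_to_ac])
  define x where "x = (\<lambda>I. p (XC I))"
  define \<psi> where "\<psi> = map_mat ?h (generic_mat n)"
  have hx: "?h \<circ> (\<lambda>I. mvar (XC I)) = x" by (auto simp: x_def meval_mvar)
  have hc: "?h \<circ> const = to_ac" by (auto simp: const_def meval_single)
  have \<psi>: "\<psi> \<in> borel_alg n"
    by (auto simp: \<psi>_def borel_alg_def generic_mat_def upper_triangular_def)
  let ?x = "flag_minor (cell_mat n w x)" and ?\<psi> = "retract_mat n w x \<psi>"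
  have X: "?h (retract_var n w (XC I)) = ?x I" for I
    by (simp add: retract_var_def h.hom_minor h.map_cell_mat[OF w] hx)
  let ?R = "retract_mat n w (\<lambda>I. mvar (XC I)) (generic_mat n) :: 'k mpol mat"
  have R: "map_mat ?h ?R = ?\<psi>"
    unfolding h.map_retract_mat[OF generic_mat_upper(1)] hx \<psi>_def ..
  have M: "?h (?R $$ (k, l)) = ?\<psi> $$ (k, l)" if "k < n" "l < n" for k l
  proof -
    have "dim_row ?R = n" "dim_col ?R = n" using carrier_matD[OF retract_mat_carrier] by blast+
    then show ?thesis unfolding R[symmetric] using that by simp
  qed
  have "?h (meval const (retract_var n w) f) = meval to_ac (?h \<circ> retract_var n w) f"
    by (simp add: h.hom_meval hc)
  also have "\<dots> = meval to_ac (coord_val ?x ?\<psi>) f"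
  proof (rule meval_cong)
    fix m c assume "m \<in> Poly_Mapping.keys f" "c \<in> Poly_Mapping.keys m"
    \<comment> \<open>Only variables of \<open>coords n\<close> occur in \<open>f\<close>, so the
      matrix of \<open>retract_var\<close> is read at indices within range.\<close>
    then have "c \<in> coords n" using f by (auto simp: chart_ideal_def carrier_mpol_ring)
    then show "(?h \<circ> retract_var n w) c = coord_val ?x ?\<psi> c"
      using X M by (auto simp: coords_def) (auto simp: retract_var_def)
  qed
  \<comment> \<open>The retracted coordinates are normalised and lie on the variety, the two
    conditions under which elements of the chart ideal vanish.\<close>
  also have "\<dots> = 0"
    using f antisym_ext_cell_mat_norm[OF w, of _ x] retract_plucker_image[OF w \<psi>, of x]
    unfolding chart_ideal_def by blast
  finally show "?h (meval const (retract_var n w) f) = 0" .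
qed

lemma chart_ideal_subset_genideal:
  assumes w: "w permutes {..<n}"
  shows "chart_ideal n w (plucker_image n (V_tilde n w))
     \<subseteq> Idl\<^bsub>(mpol_ring n :: 'k::field_char_0 mpol ring)\<^esub> (base_change ` (equations n w \<union> chart_eqs n w))"
proof
  let ?R = "mpol_ring n :: 'k mpol ring" and ?S = "base_change ` (equations n w \<union> chart_eqs n w) :: 'k mpol set"
  interpret R: cring ?R by (rule cring_mpol_ring)
  have S: "?S \<subseteq> carrier ?R" using equations_carrier[OF w] by blast
  interpret I: ideal "Idl\<^bsub>?R\<^esub> ?S" ?R by (rule R.genideal_ideal[OF S])
  interpret res: comm_ring_hom "restrict_pol n :: 'k mpol \<Rightarrow> 'k mpol" by (rule comm_ring_hom_restrict_pol)
  interpret J: ring_ideal "{f. restrict_pol n f \<in> Idl\<^bsub>?R\<^esub> ?S}"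
  proof
    show "0 \<in> {f. restrict_pol n f \<in> Idl\<^bsub>?R\<^esub> ?S}"
      using I.zero_closed by (simp add: mpol_ring_simps)
    fix a b r :: "'k mpol" assume a: "a \<in> {f. restrict_pol n f \<in> Idl\<^bsub>?R\<^esub> ?S}"
    show "r * a \<in> {f. restrict_pol n f \<in> Idl\<^bsub>?R\<^esub> ?S}"
      using I.I_l_closed[OF _ restrict_pol_carrier, of "restrict_pol n a" r] a
      by (simp add: res.hom_mult mpol_ring_simps)
    assume "b \<in> {f. restrict_pol n f \<in> Idl\<^bsub>?R\<^esub> ?S}"
    then show "a + b \<in> {f. restrict_pol n f \<in> Idl\<^bsub>?R\<^esub> ?S}"
      using I.a_closed[of "restrict_pol n a" "restrict_pol n b"] a
      by (simp add: res.hom_add mpol_ring_simps)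
  qed
  let ?J = "{f. restrict_pol n f \<in> Idl\<^bsub>?R\<^esub> ?S}"
  have gen: "meval of_int mvar f \<in> ?J" if "f \<in> equations n w \<union> chart_eqs n w" for f
  proof -
    have "base_change f \<in> Idl\<^bsub>?R\<^esub> ?S" using R.genideal_self[OF S] that by blast
    moreover have "base_change f \<in> carrier ?R" by (rule equations_carrier[OF w that])
    ultimately show ?thesis
      by (simp add: restrict_pol_ident flip: base_change_eq_meval)
  qed
  let ?x = "\<lambda>I. mvar (XC I) :: 'k mpol" and ?\<psi> = "generic_mat n :: 'k mpol mat"
  let ?g = "cell_mat n w ?x"
  have "J.solution n w ?x ?\<psi>"
    using J.solution_iff_equations[OF w generic_mat_upper, of mvar] gen
    by (auto simp: generic_mat_def)
  then have ex: "J.exchange_mod n ?x"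
    and schubert: "\<And>d I. d \<in> {1..<n} \<Longrightarrow> I \<in> subsets_of_size n d \<Longrightarrow> \<not> index_le I (w ` {..<d}) \<Longrightarrow> J.eqv (?x I) 0"
    and P: "\<And>d I s. d \<in> {1..<n} \<Longrightarrow> I \<in> subsets_of_size n d \<Longrightarrow> s < d \<Longrightarrow> J.eqv (coeff (P_val n w ?x ?\<psi> I) s) 0"
    unfolding J.solution_def by blast+
  have "\<forall>f\<in>chart_eqs n w. meval of_int mvar f \<in> ?J" using gen by blast
  then have norm: "J.eqv (antisym_ext ?x (map w [0..<d])) 1" if "d \<in> {1..<n}" for d
    using that unfolding meval_chart_eqs J.eqv_def by blast
  have minors: "J.eqv (?x I) (flag_minor ?g I)" if "d \<in> {1..<n}" "I \<in> subsets_of_size n d" for d I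
    by (rule J.eqv_flag_minor_cell_mat[OF w ex norm schubert that])
  have conj: "J.eqv (cell_conj n w ?x ?\<psi> $$ (w i, w j)) 0" if "j < i" "i < n" for i j
    by (rule J.cell_conj_mem[OF w generic_mat_upper(1) minors P that])
  have mat: "J.eqv (?\<psi> $$ (i, j)) (retract_mat n w ?x ?\<psi> $$ (i, j))" if "i < n" "j < n" for i j
    by (rule J.eqv_retract_mat[OF w generic_mat_upper(1) conj that])
  have var: "J.eqv (mvar c) (retract_var n w c)" if c: "c \<in> coords n" for c
  proof -
    consider d I where "c = XC I" "d \<in> {1..<n}" "I \<in> subsets_of_size n d"
      | k l where "c = UC k l" "k < l" "l < n" | m where "c = TC m" "m < n"
      using c unfolding coords_def by blast
    then show ?thesis
    proof cases
      case 1
      then show ?thesis using minors by (simp add: retract_var_def)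
    next
      case 2
      then show ?thesis using mat[of k l] by (simp add: retract_var_def) (simp add: generic_mat_def)
    next
      case 3
      then show ?thesis using mat[of m m] by (simp add: retract_var_def) (simp add: generic_mat_def)
    qed
  qed
  fix f :: "'k mpol" assume f: "f \<in> chart_ideal n w (plucker_image n (V_tilde n w))"
  then have fR: "f \<in> carrier ?R" by (simp add: chart_ideal_def)
  \<comment> \<open>Polynomials respect congruences, and each variable in \<open>coords n\<close> is
    congruent to its image under the retraction.\<close>
  have "J.eqv (meval const mvar f) (meval const (retract_var n w) f)"
    unfolding meval_def
    by (intro J.eqv_sum J.eqv_mult J.eqv_prod J.eqv_power J.eqv_refl var)
      (use fR in \<open>auto simp: carrier_mpol_ring\<close>)
  then have "restrict_pol n f \<in> Idl\<^bsub>?R\<^esub> ?S"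
    by (simp add: meval_const_mvar meval_retract_var_eq_0[OF w f] J.eqv_0_iff)
  then show "f \<in> Idl\<^bsub>?R\<^esub> ?S" by (simp add: restrict_pol_ident[OF fR])
qed

theorem proposition5p2p4:
  fixes n :: nat and w :: "nat \<Rightarrow> nat" and \<iota> :: "'k::field_char_0 \<Rightarrow> 'K::field"
  assumes "n \<ge> 1" and "w permutes {..<n}" and "field_hom \<iota>"
  shows "(\<forall>d\<in>{1..<n}. \<forall>I\<in>subsets_of_size n d.
           P_poly n w I = (\<Sum>s<d. monom (coeff (P_poly n w I) s) s))
    \<and> plucker_image n (V_tilde n w) =
           locus \<iota> n (base_change ` equations n w) (base_change ` nonvanishing n w)
    \<and> chart_ideal n w (plucker_image n (V_tilde n w)) =
           Idl\<^bsub>(mpol_ring n :: 'k mpol ring)\<^esub>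
             (base_change ` (equations n w \<union> chart_eqs n w))"
proof (intro conjI ballI)
  note w = assms(2)
  interpret \<iota>: field_hom \<iota> by (rule assms(3))
  show "P_poly n w I = (\<Sum>s<d. monom (coeff (P_poly n w I) s) s)"
    if "d \<in> {1..<n}" "I \<in> subsets_of_size n d" for d I
    by (rule P_poly_expansion[OF w that])
  show "plucker_image n (V_tilde n w) =
      locus \<iota> n (base_change ` equations n w) (base_change ` nonvanishing n w)"
    by (rule plucker_image_eq_locus[OF w \<iota>.comm_ring_hom_axioms])
  interpret R: cring "mpol_ring n :: 'k mpol ring" by (rule cring_mpol_ring)
  show "chart_ideal n w (plucker_image n (V_tilde n w)) =
      Idl\<^bsub>(mpol_ring n :: 'k mpol ring)\<^esub> (base_change ` (equations n w \<union> chart_eqs n w))"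
    by (intro equalityI chart_ideal_subset_genideal[OF w]
      R.genideal_minimal[OF ideal_chart_ideal equations_subset_chart_ideal[OF w]])
qed

end
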